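(* Let $\alpha>0$ be a real number. Then: (i) If $\alpha\in\mathbb{Q}$, then $\mathcal{P}_\alpha$ is a strip packing and $\mathrm{Symm}(\mathcal{P}_\alpha)\cong D_\infty\times\mathbb{Z}/2\mathbb{Z}$, with subgroup $\mathrm{Symm}_+(\mathcal{P}_\alpha)\cong D_\infty$, where $D_\infty$ denotes the infinite dihedral group. (ii) If $\alpha$ is quadratic over $\mathbb{Q}$ (algebraic of degree exactly $2$), then $\mathrm{Symm}(\mathcal{P}_\alpha)\cong\mathbb{Z}$. Let $D$ denote the discriminant of the primitive integral (quadratic) polynomial with root $\alpha$. Then $\mathrm{Symm}_+(\mathcal{P}_\alpha)$ is equal to $\mathrm{Symm}(\mathcal{P}_\alpha)$ if the equation $x^2-Dy^2=-4$ has no integral solution $(x,y)$, and is the index $2$ subgroup of $\mathrm{Symm}(\mathcal{P}_\alpha)$ if $x^2-Dy^2=-4$ does have an integral solution. (iii) Otherwise (if $\alpha$ is neither rational nor quadratic over $\mathbb{Q}$), $\mathrm{Symm}_+(\mathcal{P}_\alpha)=\mathrm{Symm}(\mathcal{P}_\alpha)=1$.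
   Context: A \emph{circle} in $\mathbb{R}^2$ is a Euclidean circle or a straight line, together with a choice of one of the two components of its complement, called its \emph{interior} (possibly the unbounded component; for a line, one of the two half-planes). Parallel lines are regarded as tangent (at infinity). An \emph{Apollonian circle packing} is a collection $\mathcal{P}$ of circles with pairwise disjoint interiors such that (i) $\mathcal{P}$ contains three mutually tangent circles, and (ii) any circle tangent to three mutually tangent circles of $\mathcal{P}$ (with interior chosen so that interiors are disjoint) is also in $\mathcal{P}$. Given a set $\mathcal{P}^{(0)}$ of three mutually tangent circles with disjoint interiors, let $\mathcal{P}^{(n+1)}$ consist of $\mathcal{P}^{(n)}$ together with all circles tangent to three mutually tangent circles in $\mathcal{P}^{(n)}$; the packing generated by $\mathcal{P}^{(0)}$ is $\bigcup_{n\ge0}\mathcal{P}^{(n)}$, which is an Apollonian circle packing. The curvature of a circle is the reciprocal of its radius; a line has curvature $0$. For $\alpha>0$, $\mathcal{P}_\alpha$ is the packing generated by $\{X,Y,L\}$, where $L$ is the $x$-axis (with interior the lower half-plane), $X$ is the circle of curvature $\alpha^2$ lying above $L$ and tangent to $L$ at the origin, and $Y$ is the circle of curvature $1$ lying above $L$, tangent to $L$ and tangent to $X$ on the right. A \emph{strip packing} is an Apollonian circle packing containing two (necessarily parallel) lines. A similarity of $\mathbb{R}^2$ is a map $\Phi(x)=\mu Ax+b$ with $\mu>0$, $A$ an orthogonal $2\times2$ matrix, $b\in\mathbb{R}^2$; it is orientation-preserving if $\det A=1$ and orientation-reversing if $\det A=-1$. $\mathrm{Symm}(\mathcal{P})$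 is the group (under composition) of similarities $\Phi$ with $\Phi\cdot\mathcal{P}:=\{\Phi(C):C\in\mathcal{P}\}$ equal to $\mathcal{P}$, and $\mathrm{Symm}_+(\mathcal{P})$ is its subgroup of orientation-preserving elements. *)

theory Defs
  imports "HOL-Analysis.Analysis" "HOL-Algebra.Elementary_Groups"
    "HOL-Computational_Algebra.Computational_Algebra"
begin

definition euclidean_circle :: "(real^2) set \<Rightarrow> bool" where
  "euclidean_circle C \<longleftrightarrow> (\<exists>c r. r > 0 \<and> C = sphere c r)"

definition straight_line :: "(real^2) set \<Rightarrow> bool" where
  "straight_line C \<longleftrightarrow> (\<exists>n k. n \<noteq> 0 \<and> C = {x. n \<bullet> x = k})"

text \<open>A circle is a pair of its underlying point set and its interior.\<close>

type_synonym ocircle = "(real^2) set \<times> (real^2) set"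

definition oriented_circle :: "ocircle \<Rightarrow> bool" where
  "oriented_circle C \<longleftrightarrow>
     (euclidean_circle (fst C) \<or> straight_line (fst C)) \<and> snd C \<in> components (- fst C)"

text \<open>Two lines are tangent (at infinity) iff they are parallel, that is, disjoint; in all other
  cases tangency means meeting in exactly one point. In particular, circles with the
  same underlying point set are never tangent.\<close>

definition tangent :: "ocircle \<Rightarrow> ocircle \<Rightarrow> bool" where
  "tangent C D \<longleftrightarrow>
     (if straight_line (fst C) \<and> straight_line (fst D) then fst C \<inter> fst D = {}
      else (\<exists>p. fst C \<inter> fst D = {p}))"

definition mutually_tangent :: "ocircle \<Rightarrow> ocircle \<Rightarrow> ocircle \<Rightarrow> bool" where
  "mutually_tangent C1 C2 C3 \<longleftrightarrow> tangent C1 C2 \<and> tangent C1 C3 \<and> tangent C2 C3"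

text \<open>The circles tangent to three mutually tangent circles of \<open>P\<close>, with interior chosen to be
  disjoint from the interiors of those three circles.\<close>

definition inscribed_circles :: "ocircle set \<Rightarrow> ocircle set" where
  "inscribed_circles P =
     {C. oriented_circle C \<and>
         (\<exists>C1\<in>P. \<exists>C2\<in>P. \<exists>C3\<in>P. mutually_tangent C1 C2 C3 \<and>
            (\<forall>D\<in>{C1, C2, C3}. tangent C D \<and> disjnt (snd C) (snd D)))}"

definition apollonian_packing :: "ocircle set \<Rightarrow> bool" where
  "apollonian_packing P \<longleftrightarrow>
     (\<forall>C\<in>P. oriented_circle C) \<and>
     pairwise (\<lambda>C D. disjnt (snd C) (snd D)) P \<and>
     (\<exists>C1\<in>P. \<exists>C2\<in>P. \<exists>C3\<in>P. mutually_tangent C1 C2 C3) \<and>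
     inscribed_circles P \<subseteq> P"

definition strip_packing :: "ocircle set \<Rightarrow> bool" where
  "strip_packing P \<longleftrightarrow> apollonian_packing P \<and>
     (\<exists>C\<in>P. \<exists>D\<in>P. straight_line (fst C) \<and> straight_line (fst D) \<and> fst C \<noteq> fst D)"

definition generated_packing :: "ocircle set \<Rightarrow> ocircle set" where
  "generated_packing P0 = (\<Union>n. ((\<lambda>P. P \<union> inscribed_circles P) ^^ n) P0)"

definition disk_circle :: "real^2 \<Rightarrow> real \<Rightarrow> ocircle" where
  "disk_circle c r = (sphere c r, ball c r)"

definition circle_L :: ocircle where
  "circle_L = ({x. x $ 2 = 0}, {x. x $ 2 < 0})"

definition circle_X :: "real \<Rightarrow> ocircle" where
  "circle_X \<alpha> = disk_circle (vector [0, 1 / \<alpha>\<^sup>2]) (1 / \<alpha>\<^sup>2)"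

text \<open>A unit circle tangent to the \<open>x\<close>-axis from above has centre \<open>(t, 1)\<close>. Being tangent to
  \<open>X\<close> on the right forces \<open>t = 2 / \<alpha>\<close>; see \<open>tangent_circle_X_iff\<close> below.\<close>

definition circle_Y :: "real \<Rightarrow> ocircle" where
  "circle_Y \<alpha> = disk_circle (vector [2 / \<alpha>, 1]) 1"

definition packing :: "real \<Rightarrow> ocircle set" where
  "packing \<alpha> = generated_packing {circle_X \<alpha>, circle_Y \<alpha>, circle_L}"

lemma sphere_not_straight_line: "\<not> straight_line (sphere c r)"
proof
  assume "straight_line (sphere c r)"
  then obtain n k where n: "n \<noteq> 0" "sphere c r = {x. n \<bullet> x = k}"
    unfolding straight_line_def by blast
  define m :: "real^2" where "m = vector [- (n$2), n$1]"
  have m0: "m \<noteq> 0" and nm: "n \<bullet> m = 0"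
    using n(1) by (auto simp: m_def vec_eq_iff forall_2 inner_vec_def sum_2)
  define p where "p = (k / (n \<bullet> n)) *\<^sub>R n"
  have "p + s *\<^sub>R m \<in> sphere c r" for s
    using n(1) nm unfolding n(2) p_def by (simp add: inner_right_distrib)
  hence bd: "norm (p + s *\<^sub>R m - c) = r" for s
    by (simp add: dist_norm norm_minus_commute)
  define s where "s = (2 * r + 1) / norm m"
  have "norm (s *\<^sub>R m) \<le> norm (p + s *\<^sub>R m - c) + norm (p + 0 *\<^sub>R m - c)"
    using norm_triangle_ineq4[of "p + s *\<^sub>R m - c" "p + 0 *\<^sub>R m - c"] by simp
  hence "norm (s *\<^sub>R m) \<le> 2 * r" using bd by (metis mult_2)
  moreover have "r \<ge> 0" using bd[of 0] norm_ge_zero by metis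
  ultimately show False using m0 by (simp add: s_def)
qed

lemma tangent_circle_X_iff:
  fixes \<alpha> t :: real
  assumes \<alpha>: "\<alpha> > 0" and t: "t > 0"
  shows "tangent (circle_X \<alpha>) (disk_circle (vector [t, 1]) 1) \<longleftrightarrow> t = 2 / \<alpha>"
proof -
  define r where "r = 1 / \<alpha>\<^sup>2"
  define a :: "real^2" where "a = vector [0, r]"
  define b :: "real^2" where "b = vector [t, 1]"
  have r0: "r > 0" using \<alpha> by (simp add: r_def)
  have d2: "(dist a b)\<^sup>2 = t\<^sup>2 + (1 - r)\<^sup>2"
    by (simp add: dist_vec_def L2_set_def sum_2 a_def b_def dist_real_def power2_commute)
  have ta: "t = 2 / \<alpha> \<longleftrightarrow> t\<^sup>2 = 4 * r"
  proof -
    have "t = 2 / \<alpha> \<longleftrightarrow> t\<^sup>2 = (2 / \<alpha>)\<^sup>2"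
      using \<alpha> t by (metis divide_nonneg_pos less_imp_le power2_eq_imp_eq zero_le_numeral)
    thus ?thesis by (simp add: r_def power_divide)
  qed
  have T: "tangent (circle_X \<alpha>) (disk_circle (vector [t, 1]) 1)
      \<longleftrightarrow> (\<exists>p. sphere a r \<inter> sphere b 1 = {p})"
    by (simp add: tangent_def circle_X_def disk_circle_def sphere_not_straight_line
        r_def a_def b_def)
  show ?thesis unfolding T ta
  proof
    assume "\<exists>p. sphere a r \<inter> sphere b 1 = {p}"
    then obtain p where p: "sphere a r \<inter> sphere b 1 = {p}" by blast
    define w where "w = b - a"
    define q where "q = p - a"
    have w2: "w \<bullet> w = t\<^sup>2 + (1 - r)\<^sup>2"
      using d2 by (simp add: w_def dist_norm norm_minus_commute dot_square_norm)
    have w0: "w \<bullet> w > 0" using t w2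
      by (metis add_pos_nonneg zero_le_power2 zero_less_power)
    define l where "l = (q \<bullet> w) / (w \<bullet> w)"
    have lw: "l * (w \<bullet> w) = q \<bullet> w" using w0 by (simp add: l_def)
    define q' where "q' = (2 * l) *\<^sub>R w - q"
    have "p \<in> sphere a r \<inter> sphere b 1" using p by blast
    hence nq: "norm q = r" "norm (q - w) = 1"
      by (auto simp: q_def w_def dist_norm norm_minus_commute)
    have "q' \<bullet> q' = 4 * l * (l * (w \<bullet> w)) - 4 * l * (q \<bullet> w) + q \<bullet> q"
      by (simp add: q'_def inner_diff_left inner_diff_right inner_commute algebra_simps)
    hence qq: "q' \<bullet> q' = q \<bullet> q" by (simp add: lw)
    have qw: "q' \<bullet> w = q \<bullet> w"
      by (simp add: q'_def inner_diff_left lw)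
    have "norm q' = r" using qq nq(1) by (simp add: norm_eq_sqrt_inner)
    moreover have "norm (q' - w) = norm (q - w)"
      using qq qw by (simp add: norm_eq_sqrt_inner inner_diff_left inner_diff_right inner_commute)
    ultimately have "a + q' \<in> sphere a r \<inter> sphere b 1"
      using nq(2) by (auto simp: dist_norm w_def norm_minus_commute algebra_simps)
    hence "a + q' = p" using p by blast
    hence "q' = q" by (auto simp: q_def)
    hence "2 *\<^sub>R q = 2 *\<^sub>R (l *\<^sub>R w)"
      by (simp add: q'_def scaleR_2 algebra_simps)
    hence ql: "q = l *\<^sub>R w" unfolding scaleR_cancel_left by simp
    define d where "d = norm w"
    have d: "d\<^sup>2 = t\<^sup>2 + (1 - r)\<^sup>2" using w2 by (simp add: d_def dot_square_norm)
    have "norm (q - w) = \<bar>l - 1\<bar> * d"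
      unfolding ql d_def by (metis norm_scaleR scaleR_left_diff_distrib scaleR_one)
    hence 1: "\<bar>l - 1\<bar> * d = 1" using nq by simp
    have 2: "\<bar>l\<bar> * d = r" using nq by (simp add: ql d_def)
    have "d = r + 1 \<or> d = r - 1 \<or> d = 1 - r"
      using 1 2 by (cases "l \<ge> 1"; cases "l \<ge> 0") (auto simp: algebra_simps)
    hence "d\<^sup>2 = (r + 1)\<^sup>2 \<or> d\<^sup>2 = (1 - r)\<^sup>2" by (metis power2_commute)
    thus "t\<^sup>2 = 4 * r" using d t by (auto simp: power2_eq_square algebra_simps)
  next
    assume "t\<^sup>2 = 4 * r"
    hence "(dist a b)\<^sup>2 = (r + 1)\<^sup>2" using d2 by (simp add: power2_eq_square algebra_simps)
    hence d: "dist a b = r + 1"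
      using r0 by (metis add_nonneg_nonneg less_imp_le power2_eq_imp_eq zero_le_dist zero_le_one)
    define p where "p = a + (r / (r + 1)) *\<^sub>R (b - a)"
    have "x = p" if x: "x \<in> sphere a r \<inter> sphere b 1" for x
    proof -
      have n: "norm (a - x) = r" "norm (x - b) = 1"
        using x by (auto simp: dist_norm norm_minus_commute)
      hence "dist a b = dist a x + dist x b" using d by (simp add: dist_norm)
      hence "r *\<^sub>R (x - b) = 1 *\<^sub>R (a - x)" using n dist_triangle_eq by metis
      hence "(r + 1) *\<^sub>R x = (r + 1) *\<^sub>R a + r *\<^sub>R (b - a)"
        by (simp add: algebra_simps)
      also have "\<dots> = (r + 1) *\<^sub>R p" using r0 by (simp add: p_def scaleR_right_distrib)
      finally show ?thesis using r0 by simp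
    qed
    moreover have "p \<in> sphere a r \<inter> sphere b 1"
    proof -
      have "b - p = (1 - r / (r + 1)) *\<^sub>R (b - a)" by (simp add: p_def algebra_simps)
      also have "1 - r / (r + 1) = 1 / (r + 1)" using r0 by (simp add: field_simps)
      finally have "norm (b - p) = 1" using d r0 by (simp add: dist_norm norm_minus_commute)
      moreover have "norm (p - a) = r"
        using d r0 by (simp add: p_def dist_norm norm_minus_commute)
      ultimately show ?thesis by (simp add: dist_norm norm_minus_commute)
    qed
    ultimately show "\<exists>p. sphere a r \<inter> sphere b 1 = {p}" by blast
  qed
qed

definition similarity :: "(real^2 \<Rightarrow> real^2) \<Rightarrow> bool" where
  "similarity \<Phi> \<longleftrightarrow>
     (\<exists>\<mu> A b. \<mu> > 0 \<and> orthogonal_matrix A \<and> \<Phi> = (\<lambda>x. \<mu> *\<^sub>R (A *v x) + b))"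

definition orientation_preserving_similarity :: "(real^2 \<Rightarrow> real^2) \<Rightarrow> bool" where
  "orientation_preserving_similarity \<Phi> \<longleftrightarrow>
     (\<exists>\<mu> A b. \<mu> > 0 \<and> orthogonal_matrix A \<and> det A = 1 \<and> \<Phi> = (\<lambda>x. \<mu> *\<^sub>R (A *v x) + b))"

definition map_circle :: "(real^2 \<Rightarrow> real^2) \<Rightarrow> ocircle \<Rightarrow> ocircle" where
  "map_circle \<Phi> C = (\<Phi> ` fst C, \<Phi> ` snd C)"

definition Symm :: "ocircle set \<Rightarrow> (real^2 \<Rightarrow> real^2) monoid" where
  "Symm P = \<lparr>carrier = {\<Phi>. similarity \<Phi> \<and> map_circle \<Phi> ` P = P}, mult = (\<circ>), one = id\<rparr>"

definition Symm_plus :: "ocircle set \<Rightarrow> (real^2 \<Rightarrow> real^2) monoid" where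
  "Symm_plus P =
     (Symm P)\<lparr>carrier := {\<Phi> \<in> carrier (Symm P). orientation_preserving_similarity \<Phi>}\<rparr>"

text \<open>The infinite dihedral group as the semidirect product of the integers with a group of
  order two acting by negation: \<open>(n, s)\<close> is the isometry \<open>k \<mapsto> n \<plusminus> k\<close> of the integers, with
  the minus sign iff \<open>s\<close>.\<close>

definition D_inf :: "(int \<times> bool) monoid" where
  "D_inf = \<lparr>carrier = UNIV,
            mult = (\<lambda>(m, s) (n, t). (m + (if s then - n else n), s \<noteq> t)),
            one = (0, False)\<rparr>"

lemma group_D_inf: "group D_inf"
proof (rule groupI)
  fix x assume "x \<in> carrier D_inf"
  obtain m s where x: "x = (m, s)" by force
  have "(if s then m else - m, s) \<otimes>\<^bsub>D_inf\<^esub> x = \<one>\<^bsub>D_inf\<^esub>"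
    by (auto simp: D_inf_def x)
  moreover have "(if s then m else - m, s) \<in> carrier D_inf" by (simp add: D_inf_def)
  ultimately show "\<exists>y\<in>carrier D_inf. y \<otimes>\<^bsub>D_inf\<^esub> x = \<one>\<^bsub>D_inf\<^esub>"
    by blast
qed (auto simp: D_inf_def split: if_splits)

lemma similarity_comp_aux:
  fixes A A' :: "real^2^2"
  shows "(\<lambda>x. \<mu> *\<^sub>R (A *v x) + b) \<circ> (\<lambda>x. \<mu>' *\<^sub>R (A' *v x) + b') =
    (\<lambda>x. (\<mu> * \<mu>') *\<^sub>R ((A ** A') *v x) + (\<mu> *\<^sub>R (A *v b') + b))"
  by (auto simp: fun_eq_iff matrix_vector_right_distrib scaleR_right_distrib
      matrix_vector_mult_scaleR matrix_vector_mul_assoc)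

lemma similarity_inverse_aux:
  fixes A :: "real^2^2"
  assumes "\<mu> > 0" "orthogonal_matrix A"
  shows "(\<lambda>x. (1 / \<mu>) *\<^sub>R (transpose A *v x) + - ((1 / \<mu>) *\<^sub>R (transpose A *v b))) \<circ>
    (\<lambda>x. \<mu> *\<^sub>R (A *v x) + b) = id"
  using assms by (auto simp: orthogonal_matrix_def fun_eq_iff matrix_vector_right_distrib
      scaleR_right_distrib matrix_vector_mult_scaleR matrix_vector_mul_assoc
      simp del: transpose_matrix_vector)

lemma map_circle_comp: "map_circle (\<Phi> \<circ> \<Psi>) = map_circle \<Phi> \<circ> map_circle \<Psi>"
  by (auto simp: map_circle_def fun_eq_iff image_comp)

lemma map_circle_id: "map_circle id = id"
  by (auto simp: map_circle_def fun_eq_iff)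

lemma map_circle_left_inverse:
  assumes "\<Psi> \<circ> \<Phi> = id" "map_circle \<Phi> ` P = P"
  shows "map_circle \<Psi> ` P = P"
proof -
  have "map_circle \<Psi> ` P = map_circle \<Psi> ` (map_circle \<Phi> ` P)" by (simp only: assms(2))
  also have "\<dots> = map_circle (\<Psi> \<circ> \<Phi>) ` P" by (simp only: map_circle_comp image_comp)
  also have "\<dots> = P" by (simp add: assms(1) map_circle_id)
  finally show ?thesis .
qed

lemma group_Symm: "group (Symm P)"
proof (rule groupI)
  fix \<Phi> \<Psi> assume *: "\<Phi> \<in> carrier (Symm P)" "\<Psi> \<in> carrier (Symm P)"
  obtain \<mu> A b where 1: "\<mu> > 0" "orthogonal_matrix A" "\<Phi> = (\<lambda>x. \<mu> *\<^sub>R (A *v x) + b)"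
    using * by (auto simp: Symm_def similarity_def)
  obtain \<mu>' A' b' where 2: "\<mu>' > 0" "orthogonal_matrix A'" "\<Psi> = (\<lambda>x. \<mu>' *\<^sub>R (A' *v x) + b')"
    using * by (auto simp: Symm_def similarity_def)
  have "\<mu> * \<mu>' > 0" "orthogonal_matrix (A ** A')"
    using 1 2 by (auto simp: orthogonal_matrix_mul)
  hence "similarity (\<Phi> \<circ> \<Psi>)"
    unfolding 1(3) 2(3) similarity_comp_aux similarity_def
    by (intro exI conjI) (assumption, assumption, rule refl)
  moreover have "map_circle (\<Phi> \<circ> \<Psi>) ` P = P"
    using * by (simp only: Symm_def map_circle_comp image_comp [symmetric]) simp
  ultimately show "\<Phi> \<otimes>\<^bsub>Symm P\<^esub> \<Psi> \<in> carrier (Symm P)"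
    by (simp add: Symm_def)
next
  have "(id :: real^2 \<Rightarrow> real^2) = (\<lambda>x. 1 *\<^sub>R (mat 1 *v x) + 0)" by auto
  hence "similarity id" unfolding similarity_def
    by (intro exI conjI) (rule zero_less_one, rule orthogonal_matrix_id)
  thus "\<one>\<^bsub>Symm P\<^esub> \<in> carrier (Symm P)" by (simp add: Symm_def map_circle_id)
next
  fix \<Phi> assume "\<Phi> \<in> carrier (Symm P)"
  then obtain \<mu> A b where *: "\<mu> > 0" "orthogonal_matrix A" "\<Phi> = (\<lambda>x. \<mu> *\<^sub>R (A *v x) + b)"
    and inv: "map_circle \<Phi> ` P = P"
    by (auto simp: Symm_def similarity_def)
  define \<Psi> where "\<Psi> = (\<lambda>x. (1 / \<mu>) *\<^sub>R (transpose A *v x) + - ((1 / \<mu>) *\<^sub>R (transpose A *v b)))"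
  have 1: "\<Psi> \<circ> \<Phi> = id" using similarity_inverse_aux * by (simp add: \<Psi>_def)
  have "1 / \<mu> > 0" "orthogonal_matrix (transpose A)"
    using * by (auto simp: orthogonal_matrix_transpose)
  hence "similarity \<Psi>" unfolding similarity_def \<Psi>_def
    by (intro exI conjI) (assumption, assumption, rule refl)
  hence "\<Psi> \<in> carrier (Symm P)"
    using map_circle_left_inverse[OF 1 inv] by (simp add: Symm_def)
  thus "\<exists>\<Psi>\<in>carrier (Symm P). \<Psi> \<otimes>\<^bsub>Symm P\<^esub> \<Phi> = \<one>\<^bsub>Symm P\<^esub>"
    using 1 by (auto simp: Symm_def)
qed (auto simp: Symm_def)

text \<open>The irreducible rational polynomials with root \<open>x\<close> are the nonzero constant multiples of the
  minimal polynomial of \<open>x\<close>.\<close>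

definition algebraic_of_degree :: "nat \<Rightarrow> real \<Rightarrow> bool" where
  "algebraic_of_degree n x \<longleftrightarrow>
     (\<exists>p :: rat poly. irreducible p \<and> degree p = n \<and> poly (map_poly of_rat p) x = 0)"

definition primitive_quadratic_of :: "real \<Rightarrow> int poly \<Rightarrow> bool" where
  "primitive_quadratic_of x q \<longleftrightarrow>
     degree q = 2 \<and> Polynomial.content q = 1 \<and> poly (map_poly of_int q) x = 0"

definition quadratic_discriminant :: "int poly \<Rightarrow> int" where
  "quadratic_discriminant q = (coeff q 1)\<^sup>2 - 4 * coeff q 2 * coeff q 0"

lemma algebraic_of_degree_2_irrational:
  assumes "algebraic_of_degree 2 x"
  shows "x \<notin> \<rat>"
proof
  assume "x \<in> \<rat>"
  then obtain c where c: "x = of_rat c" by (auto elim: Rats_cases)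
  obtain p :: "rat poly" where p: "irreducible p" "degree p = 2" "poly (map_poly of_rat p) x = 0"
    using assms by (auto simp: algebraic_of_degree_def)
  have "poly (map_poly of_rat p) (of_rat c :: real) = of_rat (poly p c)"
    by (induction p) (auto simp: map_poly_pCons of_rat_add of_rat_mult)
  hence "poly p c = 0" using p(3) c by simp
  then obtain r where r: "p = [:- c, 1:] * r" by (auto simp: poly_eq_0_iff_dvd elim: dvdE)
  have "r \<noteq> 0" using r p(2) by auto
  hence "degree r = 1" using p(2) unfolding r by (subst (asm) degree_mult_eq) auto
  hence "\<not> r dvd 1" "\<not> [:- c, 1:] dvd 1"
    using \<open>r \<noteq> 0\<close> by (auto simp: is_unit_iff_degree)
  thus False using irreducibleD[OF p(1) r] by blast
qed

lemma poly_real_quadratic: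
  assumes "degree (q :: int poly) = 2"
  shows "poly (map_poly of_int q) (x :: real) =
    of_int (coeff q 2) * x\<^sup>2 + of_int (coeff q 1) * x + of_int (coeff q 0)"
proof -
  have "degree (map_poly of_int q :: real poly) = 2" using assms by (subst degree_map_poly) auto
  thus ?thesis by (simp add: poly_altdef eval_nat_numeral coeff_map_poly algebra_simps)
qed

lemma primitive_quadratic_exists:
  assumes "algebraic_of_degree 2 x"
  shows "\<exists>q. primitive_quadratic_of x q"
proof -
  obtain p :: "rat poly" where p: "degree p = 2" "poly (map_poly of_rat p) x = 0"
    using assms by (auto simp: algebraic_of_degree_def)
  have dp: "degree (map_poly of_rat p :: real poly) = 2" using p(1) by (subst degree_map_poly) auto
  have root: "of_rat (coeff p 2) * x\<^sup>2 + of_rat (coeff p 1) * x + of_rat (coeff p 0) = 0"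
    using p(2) dp by (simp add: poly_altdef eval_nat_numeral coeff_map_poly algebra_simps)
  have ex: "\<exists>n d :: int. d > 0 \<and> r = of_int n / of_int d" for r :: rat
    by (cases r) (auto simp: Fract_of_int_quotient)
  obtain n0 d0 n1 d1 n2 d2 :: int where
    d: "d0 > 0" "d1 > 0" "d2 > 0" "coeff p 0 = of_int n0 / of_int d0"
      "coeff p 1 = of_int n1 / of_int d1" "coeff p 2 = of_int n2 / of_int d2"
    using ex[of "coeff p 0"] ex[of "coeff p 1"] ex[of "coeff p 2"] by blast
  have "coeff p 2 \<noteq> 0" using p(1) leading_coeff_0_iff[of p] by auto
  hence n2: "n2 \<noteq> 0" using d by auto
  define q where "q = [:n0 * d1 * d2, n1 * d0 * d2, n2 * d0 * d1:]"
  have dq: "degree q = 2" using n2 d by (simp add: q_def)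
  have c: "coeff q 0 = n0 * d1 * d2" "coeff q 1 = n1 * d0 * d2" "coeff q 2 = n2 * d0 * d1"
    by (simp_all add: q_def eval_nat_numeral)
  have "poly (map_poly of_int q) x = of_int (d0 * d1 * d2) *
      (of_rat (coeff p 2) * x\<^sup>2 + of_rat (coeff p 1) * x + of_rat (coeff p 0))"
    unfolding poly_real_quadratic[OF dq] c d(4-6) using d(1-3)
    by (simp add: of_rat_divide field_simps)
  hence rq: "poly (map_poly of_int q) x = 0" using root by simp
  define q' where "q' = primitive_part q"
  have q0: "q \<noteq> 0" using dq by auto
  have qq: "q = smult (Polynomial.content q) q'" by (simp add: q'_def)
  have dq': "degree q' = 2" using dq by (simp add: q'_def)
  have cq: "coeff q i = Polynomial.content q * coeff q' i" for i
    using arg_cong[OF qq, of "\<lambda>q. coeff q i"] by simp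
  have "poly (map_poly of_int q) x =
      of_int (Polynomial.content q) * poly (map_poly of_int q') x"
    unfolding poly_real_quadratic[OF dq] poly_real_quadratic[OF dq'] cq
    by (simp add: algebra_simps)
  hence "poly (map_poly of_int q') x = 0" using rq q0 by simp
  moreover have "Polynomial.content q' = 1" using q0 by (simp add: q'_def)
  ultimately show ?thesis using dq' unfolding primitive_quadratic_of_def by blast
qed

lemma primitive_quadratic_unique:
  assumes x: "x \<notin> \<rat>" and "primitive_quadratic_of x q" "primitive_quadratic_of x q'"
  shows "q = q' \<or> q = - q'"
proof -
  have q: "degree q = 2" "Polynomial.content q = 1" "poly (map_poly of_int q) x = 0"
    and q': "degree q' = 2" "Polynomial.content q' = 1" "poly (map_poly of_int q') x = 0"
    using assms by (auto simp: primitive_quadratic_of_def)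
  let ?a = "coeff q 2" and ?a' = "coeff q' 2"
  define u v where "u = ?a' * coeff q 1 - ?a * coeff q' 1"
    and "v = ?a' * coeff q 0 - ?a * coeff q' 0"
  have "of_int u * x + of_int v =
     of_int ?a' * (of_int ?a * x\<^sup>2 + of_int (coeff q 1) * x + of_int (coeff q 0)) -
     of_int ?a * (of_int ?a' * x\<^sup>2 + of_int (coeff q' 1) * x + of_int (coeff q' 0))"
    by (simp add: u_def v_def algebra_simps)
  hence uv: "of_int u * x + of_int v = 0"
    using q q' by (simp add: poly_real_quadratic)
  have u: "u = 0"
  proof (rule ccontr)
    assume "u \<noteq> 0"
    hence "x = - of_int v / of_int u" using uv by (simp add: field_simps)
    thus False using x by auto
  qed
  hence v: "v = 0" using uv by simp
  have eq: "smult ?a' q = smult ?a q'"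
  proof (rule poly_eqI)
    fix n :: nat
    consider "n = 0" | "n = 1" | "n = 2" | "n > 2" by linarith
    thus "coeff (smult ?a' q) n = coeff (smult ?a q') n"
      using u v q q' by cases (auto simp: u_def v_def coeff_eq_0)
  qed
  have "normalize ?a' = normalize ?a"
    using arg_cong[OF eq, of Polynomial.content] q q' by simp
  hence "?a' = ?a \<or> ?a' = - ?a" by auto
  moreover have "?a \<noteq> 0" using q(1) leading_coeff_0_iff[of q] by auto
  ultimately show ?thesis
  proof (elim disjE)
    assume "?a' = ?a"
    hence "smult ?a q = smult ?a q'" using eq by simp
    thus ?thesis using \<open>?a \<noteq> 0\<close> by (metis smult_cancel)
  next
    assume "?a' = - ?a"
    hence "smult ?a q = smult ?a (- q')" using eq by (simp add: minus_equation_iff)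
    thus ?thesis using \<open>?a \<noteq> 0\<close> by (metis smult_cancel)
  qed
qed

lemma quadratic_discriminant_unique:
  assumes "x \<notin> \<rat>" "primitive_quadratic_of x q" "primitive_quadratic_of x q'"
  shows "quadratic_discriminant q = quadratic_discriminant q'"
  using primitive_quadratic_unique[OF assms] by (auto simp: quadratic_discriminant_def)

end

(*
Oriented circles are vectors of a Lorentz form in which tangency with disjoint interiors means inner
product -1, so four mutually tangent circles form a basis and the packing is the orbit of one such
quadruple under the four replacement moves. Along a reduced word of moves the last replaced vector has
the most negative product with every vector of the initial quadruple; this gives pairwise disjointness
and shows that every tangent triple of the packing lies in a quadruple of the orbit.

The circles tangent to the x-axis are Ford circles: those of curvature (m alpha + n)^2 for coprime m, n,
and the packing is generated by the axis and any two of them that come from a basis of Z^2. Hence a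
symmetry that scales lengths by mu and fixes the axis amounts to a unit 1/sqrt mu of the multiplier
ring of the lattice Z alpha + Z, with orientation given by the norm. For rational alpha the only
positive unit is 1 and one Ford circle degenerates to a second line; for quadratic alpha the units are
governed by x^2 - D y^2 = +-4 and form a discrete group, nontrivial by Pell's equation.
*)

theory Submission
  imports Defs
begin

(* ambiguous with the component notation of vectors *)
no_notation fps_nth (infixl \<open>$\<close> 75)

text \<open>Tangency and disjointness are defined by point sets, and the Lorentz product sees them
  only up to one ambiguity: two opposite half-planes have product -1 even when they overlap or share
  their boundary. Separation is therefore proved for the orbit itself, by testing each vector
  against L and X, before the algebra is read back as geometry. No symmetry has to be followed
  through the whole packing. A Lorentz isometry that carries one tangent triple onto another carries
  the fourth circle to one of only two candidates, which differ by a move; so comparing three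
  circles decides whether it preserves the orbit. For irrational \<alpha> it remains to see where X
  and Y go: their images touch L, hence are Ford circles, and their curvatures, being squares of
  elements of Z \<alpha> + Z, determine these elements up to sign. The 4 in the Pell-type equation
  arises because a unit has the form (x + y sqrt D) / 2, with norm (x^2 - D y^2) / 4.\<close>

section \<open>Descartes quadruples in the Lorentz form\<close>

text \<open>\<open>(b, c, x, y)\<close> stands for the circle with equation \<open>b |z|\<^sup>2 - 2 (x, y) \<bullet> z + c = 0\<close> whose interior is
  the negative side. If the form below takes the value 1 on it, then \<open>b\<close> is the signed curvature and
  \<open>(x, y)\<close> is \<open>b\<close> times the centre (a unit normal for a line). Tangency with disjoint interiors
  becomes the value -1 of the form.\<close>

type_synonym cvec = "real \<times> real \<times> real \<times> real"

fun lorentz :: "cvec \<Rightarrow> cvec \<Rightarrow> real" where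
  "lorentz (b, c, x, y) (b', c', x', y') = x * x' + y * y' - (b * c' + c * b') / 2"

lemma lorentz_commute: "lorentz v w = lorentz w v"
  by (cases v; cases w) (auto simp: algebra_simps)

lemma linear_lorentz: "linear (\<lambda>v. lorentz v w)"
proof (rule linearI)
  fix v v' show "lorentz (v + v') w = lorentz v w + lorentz v' w"
    by (cases v; cases v'; cases w) (auto simp: field_simps)
next
  fix r v show "lorentz (r *\<^sub>R v) w = r *\<^sub>R lorentz v w"
    by (cases v; cases w) (auto simp: field_simps)
qed

lemmas lorentz_add_left = linear_add[OF linear_lorentz]
  and lorentz_diff_left = linear_diff[OF linear_lorentz]
  and lorentz_scale_left = linear_cmul[OF linear_lorentz, unfolded real_scaleR_def]
  and lorentz_neg_left = linear_neg[OF linear_lorentz]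

lemma lorentz_add_right: "lorentz u (v + w) = lorentz u v + lorentz u w"
  and lorentz_diff_right: "lorentz u (v - w) = lorentz u v - lorentz u w"
  and lorentz_scale_right: "lorentz u (r *\<^sub>R v) = r * lorentz u v"
  and lorentz_neg_right: "lorentz u (- v) = - lorentz u v"
  by (metis lorentz_commute lorentz_add_left, metis lorentz_commute lorentz_diff_left,
      metis lorentz_commute lorentz_scale_left, metis lorentz_commute lorentz_neg_left)

lemmas lorentz_simps = lorentz_add_left lorentz_diff_left lorentz_scale_left lorentz_neg_left
  lorentz_add_right lorentz_diff_right lorentz_scale_right lorentz_neg_right

section \<open>Moves on quadruples and reduced words\<close>

text \<open>The two circles tangent to three mutually tangent ones have sum twice the sum of the three;
  a move replaces one entry of a quadruple by the other solution. The sum below includes the replaced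
  entry, hence the coefficient 3 instead of 1.\<close>

definition move :: "nat \<Rightarrow> (nat \<Rightarrow> 'a::real_vector) \<Rightarrow> nat \<Rightarrow> 'a" where
  "move i q = q(i := 2 *\<^sub>R (q 0 + q 1 + q 2 + q 3) - 3 *\<^sub>R q i)"

definition moves :: "(nat \<Rightarrow> 'a::real_vector) \<Rightarrow> nat list \<Rightarrow> nat \<Rightarrow> 'a" where
  "moves q w = foldl (\<lambda>q i. move i q) q w"

lemma moves_simps [simp]: "moves q [] = q" "moves q (i # w) = moves (move i q) w"
  "moves q (u @ w) = moves (moves q u) w"
  by (simp_all add: moves_def)

lemma less_4_iff: "(i::nat) < 4 \<longleftrightarrow> i = 0 \<or> i = 1 \<or> i = 2 \<or> i = 3"
  by auto

lemma scaleR_3: "3 *\<^sub>R x = x + x + (x :: 'a::real_vector)"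
  using scaleR_add_left[of 2 1 x] by (simp add: scaleR_2)

lemma move_move: "i < 4 \<Longrightarrow> move i (move i q) = q"
  unfolding less_4_iff
  by (elim disjE) (auto simp: move_def fun_eq_iff scaleR_2 scaleR_3 algebra_simps)

lemma move_linear:
  assumes "linear f"
  shows "f \<circ> move i q = move i (f \<circ> q)"
  by (auto simp: fun_eq_iff move_def linear_add[OF assms] linear_diff[OF assms] linear_cmul[OF assms])

lemma moves_linear: "linear f \<Longrightarrow> f \<circ> moves q w = moves (f \<circ> q) w"
  by (induction w arbitrary: q) (auto simp: move_linear)

lemma moves_rev: "set w \<subseteq> {..<4} \<Longrightarrow> moves (moves q w) (rev w) = q"
  by (induction w arbitrary: q) (auto simp: move_move)

lemma moves_notin: "i \<notin> set w \<Longrightarrow> moves q w i = q i"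
  by (induction w arbitrary: q) (auto simp: move_def)

text \<open>Every move is an involution, so a letter cancels with an equal letter next to
  it.\<close>

lemma reduced_word_exists:
  assumes "set w \<subseteq> {..<4}"
  shows "\<exists>w'. distinct_adj w' \<and> set w' \<subseteq> {..<4} \<and> moves q w' = moves q w"
  using assms
proof (induction w arbitrary: q)
  case Nil
  then show ?case by (intro exI[of _ "[]"]) auto
next
  case (Cons i w)
  then obtain w' where w': "distinct_adj w'" "set w' \<subseteq> {..<4}" "moves (move i q) w' = moves (move i q) w"
    by (metis insert_subset list.simps(15))
  show ?case
  proof (cases "w' \<noteq> [] \<and> hd w' = i")
    case True
    then obtain u where u: "w' = i # u" by (cases w') auto
    hence "moves q u = moves q (i # w)" using w' Cons.prems by (simp add: move_move)
    thus ?thesis using u w' by (metis distinct_adj_ConsD set_subset_Cons subset_trans)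
  next
    case False
    hence "distinct_adj (i # w')" using w' by (cases w') (auto simp: distinct_adj_Cons)
    thus ?thesis using w' Cons.prems by (intro exI[of _ "i # w'"]) auto
  qed
qed

text \<open>Letters after the last occurrence of \<open>k\<close> leave entry \<open>k\<close>
  alone, so the word may be cut there. The estimates for reduced words concern the last replaced
  entry and reach all other entries in this way.\<close>

lemma entry_newest:
  assumes "k < 4" "distinct_adj w" "set w \<subseteq> {..<4}" "k \<in> set w"
  shows "\<exists>u. distinct_adj (u @ [k]) \<and> set u \<subseteq> set w \<and> moves q w k = moves q (u @ [k]) k"
proof -
  obtain u t where w: "w = u @ k # t" "k \<notin> set t"
    using split_list_last[OF assms(4)] by blast
  have "w = (u @ [k]) @ t" using w by simp
  hence "distinct_adj (u @ [k])" using assms(2) distinct_adj_appendD1 by metis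
  moreover have "moves q w k = moves q (u @ [k]) k" using w by (simp add: moves_notin)
  ultimately show ?thesis using w by (intro exI[of _ u]) auto
qed

text \<open>The invariant that makes the last replaced entry of a reduced word the largest one: it bounds
  the sum of the other three entries, and all pairwise sums are nonnegative.\<close>

definition dominant :: "nat \<Rightarrow> real \<Rightarrow> (nat \<Rightarrow> real) \<Rightarrow> bool" where
  "dominant i c x \<longleftrightarrow> x 0 + x 1 + x 2 + x 3 \<le> 2 * x i \<and> c \<le> x i \<and>
     (\<forall>j<4. \<forall>k<4. j \<noteq> k \<longrightarrow> 0 \<le> x j + x k)"

lemma all_less_4_iff: "(\<forall>j<4. P j) \<longleftrightarrow> P 0 \<and> P 1 \<and> P 2 \<and> P (3::nat)"
  by (auto simp: less_4_iff)

text \<open>For entries i, j, k, l the new value at \<open>j\<close> is 2 (x_i + x_k + x_l) - x_j.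
  Since x_j \<le> x_i - x_k - x_l, it is at least x_i + 3 (x_k + x_l), hence at least x_i; the
  remaining conditions follow similarly.\<close>

lemma dominant_move:
  assumes "dominant i c x" "i < 4" "j < 4" "i \<noteq> j"
  shows "dominant j c (move j x)"
  using assms unfolding less_4_iff
  by (elim disjE) (auto simp: dominant_def all_less_4_iff move_def)

lemma dominant_moves:
  assumes "dominant i c x" "distinct_adj (i # w)" "set (i # w) \<subseteq> {..<4}"
  shows "c \<le> moves x w (last (i # w))"
  using assms
proof (induction w arbitrary: i x)
  case Nil
  then show ?case by (simp add: dominant_def)
next
  case (Cons j w)
  then show ?case using dominant_move[of i c x j] Cons.IH[of j "move j x"]
    by (auto simp: distinct_adj_Cons)
qed

definition descartes :: "(nat \<Rightarrow> cvec) \<Rightarrow> bool" where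
  "descartes q \<longleftrightarrow> (\<forall>i<4. \<forall>j<4. lorentz (q i) (q j) = (if i = j then 1 else -1))"

lemma descartes_move:
  assumes "descartes q" "i < 4"
  shows "descartes (move i q)"
  using assms unfolding less_4_iff
  by (elim disjE) (auto simp: descartes_def all_less_4_iff move_def lorentz_simps)

lemma descartes_moves: "descartes q \<Longrightarrow> set w \<subseteq> {..<4} \<Longrightarrow> descartes (moves q w)"
  by (induction w arbitrary: q) (auto simp: descartes_move)

lemma descartes_inj: "descartes q \<Longrightarrow> i < 4 \<Longrightarrow> j < 4 \<Longrightarrow> q i = q j \<Longrightarrow> i = j"
  unfolding descartes_def by (metis one_neq_neg_one)

lemma reduced_lorentz:
  assumes q: "descartes q" and i: "i < 4"
    and w: "distinct_adj (j # w)" "set (j # w) \<subseteq> {..<4}"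
  shows "lorentz (moves q (j # w) (last (j # w))) (q i) \<le> (if i = j then -7 else -1)"
proof -
  let ?f = "\<lambda>v. - lorentz v (q i)"
  have f: "linear ?f" using linear_compose_neg[OF linear_lorentz] by simp
  have j: "j < 4" using w by auto
  \<comment> \<open>The functional is -1 at entry \<open>i\<close> and 1 at the other three, so the
    move at \<open>j\<close> produces 2 * 3 + 1 = 7 if i = j, and 2 * (1 + 1 - 1) - 1 = 1
    otherwise.\<close>
  have "dominant j (if i = j then 7 else 1) (move j (?f \<circ> q))"
    using i j q unfolding less_4_iff
    by (elim disjE) (auto simp: dominant_def all_less_4_iff move_def descartes_def)
  from dominant_moves[OF this w] have "(if i = j then 7 else 1) \<le> moves (?f \<circ> q) (j # w) (last (j # w))"
    by simp
  also have "\<dots> = ?f (moves q (j # w) (last (j # w)))"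
    unfolding moves_linear[OF f, symmetric] by simp
  finally show ?thesis by (auto split: if_splits)
qed

text \<open>A first letter \<open>i\<close> would push the product with \<open>q i\<close> to -7 or
  below. Any other first letter leaves \<open>q i\<close> in place, so the argument repeats with the
  moved quadruple as base.\<close>

lemma reduced_tangent_notin:
  assumes "descartes q" "i < 4" "distinct_adj w" "set w \<subseteq> {..<4}" "w \<noteq> []"
    and "lorentz (moves q w (last w)) (q i) \<ge> -1"
  shows "i \<notin> set w"
  using assms
proof (induction w arbitrary: q)
  case (Cons j w)
  have ij: "i \<noteq> j" using reduced_lorentz[of q i j w] Cons.prems by auto
  show ?case
  proof (cases "w = []")
    case False
    have "move j q i = q i" using ij by (simp add: move_def)
    hence "i \<notin> set w" using False Cons.prems ij
      by (intro Cons.IH[of "move j q"] descartes_move) (auto dest: distinct_adj_ConsD)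
    thus ?thesis using ij by simp
  qed (use ij in simp)
qed simp

section \<open>The orbit of a quadruple and its tangent triples\<close>

definition orbit_vecs :: "(nat \<Rightarrow> cvec) \<Rightarrow> cvec set" where
  "orbit_vecs q = {moves q w k |w k. set w \<subseteq> {..<4} \<and> k < 4}"

lemma orbit_vecs_moves:
  assumes "set w \<subseteq> {..<4}"
  shows "orbit_vecs (moves q w) = orbit_vecs q"
proof
  show "orbit_vecs (moves q w) \<subseteq> orbit_vecs q"
    using assms unfolding orbit_vecs_def by (auto simp flip: moves_simps(3)) (metis Un_least set_append)
  have "q = moves (moves q w) (rev w)" using moves_rev assms by metis
  moreover have "orbit_vecs (moves (moves q w) (rev w)) \<subseteq> orbit_vecs (moves q w)"
    using assms unfolding orbit_vecs_def 
    by (auto simp flip: moves_simps(3)) (metis Un_least set_append set_rev)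
  ultimately show "orbit_vecs q \<subseteq> orbit_vecs (moves q w)" by metis
qed

lemma orbit_vecs_reduced:
  assumes "v \<in> orbit_vecs q"
  obtains k where "k < 4" "v = q k"
  | u where "u \<noteq> []" "distinct_adj u" "set u \<subseteq> {..<4}" "v = moves q u (last u)"
proof -
  obtain w0 k where w0: "set w0 \<subseteq> {..<4}" "k < 4" "v = moves q w0 k"
    using assms unfolding orbit_vecs_def by blast
  obtain w where w: "distinct_adj w" "set w \<subseteq> {..<4}" "v = moves q w k"
    using reduced_word_exists[OF w0(1), of q] w0 by metis
  show thesis
  proof (cases "k \<in> set w")
    case False
    thus thesis using that(1) w0(2) w by (simp add: moves_notin)
  next
    case True
    obtain u where "distinct_adj (u @ [k])" "set u \<subseteq> set w" "moves q w k = moves q (u @ [k]) k"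
      using entry_newest[OF w0(2) w(1,2) True] by blast
    thus thesis using that(2)[of "u @ [k]"] w w0(2) by auto
  qed
qed

lemma orbit_vecs_lorentz_self:
  assumes "descartes q" "v \<in> orbit_vecs q"
  shows "lorentz v v = 1"
  using assms descartes_moves unfolding orbit_vecs_def descartes_def by auto

lemma orbit_vecs_tangent_neq: "descartes q \<Longrightarrow> v \<in> orbit_vecs q \<Longrightarrow> lorentz v v' = -1 \<Longrightarrow> v \<noteq> v'"
  using orbit_vecs_lorentz_self by fastforce

text \<open>The orbit is the same from each of its quadruples, so the base can be chosen to contain
  \<open>v'\<close>; the estimate for reduced words then applies to \<open>v\<close>.\<close>

lemma orbit_vecs_lorentz:
  assumes "descartes q" "v \<in> orbit_vecs q" "v' \<in> orbit_vecs q" "v \<noteq> v'"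
  shows "lorentz v v' \<le> -1"
proof -
  obtain w k where w: "set w \<subseteq> {..<4}" "k < 4" "v' = moves q w k"
    using assms(3) unfolding orbit_vecs_def by blast
  have r: "descartes (moves q w)" "v \<in> orbit_vecs (moves q w)"
    using assms w by (auto simp: orbit_vecs_moves descartes_moves)
  from r(2) show ?thesis
  proof (cases rule: orbit_vecs_reduced)
    case (1 j)
    thus ?thesis using r w assms(4) unfolding descartes_def by auto
  next
    case (2 u)
    then obtain j u' where "u = j # u'" by (cases u) auto
    thus ?thesis using reduced_lorentz[OF r(1) w(2), of j u'] 2 w(3) by (auto split: if_splits)
  qed
qed

text \<open>With a quadruple containing \<open>v\<close> as base, the reduced word that leads to
  \<open>v'\<close> never replaces \<open>v\<close>, so its final quadruple contains both.\<close>

lemma orbit_vecs_tangent_pair: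
  assumes "descartes q" "v \<in> orbit_vecs q" "v' \<in> orbit_vecs q" "lorentz v v' = -1"
  obtains w i j where "set w \<subseteq> {..<4}" "i < 4" "j < 4" "i \<noteq> j" "moves q w i = v" "moves q w j = v'"
proof -
  obtain w i where w: "set w \<subseteq> {..<4}" "i < 4" "v = moves q w i"
    using assms(2) unfolding orbit_vecs_def by blast
  have r: "descartes (moves q w)" "v' \<in> orbit_vecs (moves q w)"
    using assms w by (auto simp: orbit_vecs_moves descartes_moves)
  have ne: "v \<noteq> v'" using assms orbit_vecs_tangent_neq by blast
  from r(2) show thesis
  proof (cases rule: orbit_vecs_reduced)
    case (1 j)
    thus ?thesis using that[of w i j] w ne by auto
  next
    case (2 u)
    have "i \<notin> set u"
      using reduced_tangent_notin[OF r(1) w(2) 2(2,3,1)] 2(4) w(3) assms(4) by (simp add: lorentz_commute)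
    moreover have "last u < 4" using 2 last_in_set by blast
    moreover have "m \<noteq> last u" if "m \<notin> set u" for m using that last_in_set[OF 2(1)] by metis
    ultimately show thesis using that[of "w @ u" i "last u"] w 2
      by (auto simp: moves_notin)
  qed
qed

text \<open>With a quadruple containing \<open>v1\<close> and \<open>v2\<close> as base, the word
  leading to \<open>v3\<close> replaces neither. This links the packing rule, which speaks of
  arbitrary tangent triples, to the moves on quadruples.\<close>

lemma orbit_vecs_tangent_triple:
  assumes "descartes q" "v1 \<in> orbit_vecs q" "v2 \<in> orbit_vecs q" "v3 \<in> orbit_vecs q"
    "lorentz v1 v2 = -1" "lorentz v1 v3 = -1" "lorentz v2 v3 = -1"
  obtains w i j k where "set w \<subseteq> {..<4}" "i < 4" "j < 4" "k < 4" "i \<noteq> j" "i \<noteq> k" "j \<noteq> k"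
    "moves q w i = v1" "moves q w j = v2" "moves q w k = v3"
proof -
  obtain w i j where w: "set w \<subseteq> {..<4}" "i < 4" "j < 4" "i \<noteq> j" "moves q w i = v1" "moves q w j = v2"
    using orbit_vecs_tangent_pair[OF assms(1,2,3,5)] by blast
  have r: "descartes (moves q w)" "v3 \<in> orbit_vecs (moves q w)"
    using assms w by (auto simp: orbit_vecs_moves descartes_moves)
  have ne: "v1 \<noteq> v3" "v2 \<noteq> v3" using assms orbit_vecs_tangent_neq by blast+
  from r(2) show thesis
  proof (cases rule: orbit_vecs_reduced)
    case (1 k)
    thus ?thesis using that[of w i j k] w ne by auto
  next
    case (2 u)
    have "i \<notin> set u"
      using reduced_tangent_notin[OF r(1) w(2) 2(2,3,1)] 2(4) w(5) assms(6) by (simp add: lorentz_commute)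
    moreover have "j \<notin> set u"
      using reduced_tangent_notin[OF r(1) w(3) 2(2,3,1)] 2(4) w(6) assms(7) by (simp add: lorentz_commute)
    moreover have "last u < 4" using 2 last_in_set by blast
    moreover have "m \<noteq> last u" if "m \<notin> set u" for m using that last_in_set[OF 2(1)] by metis
    ultimately show thesis using that[of "w @ u" i j "last u"] w 2
      by (auto simp: moves_notin)
  qed
qed

text \<open>The Gram matrix with 1 on the diagonal and -1 elsewhere is invertible, so the four
  vectors are independent and, by dimension, a basis.\<close>

lemma descartes_expand:
  assumes "descartes q"
  obtains a :: "nat \<Rightarrow> real" where "v = a 0 *\<^sub>R q 0 + a 1 *\<^sub>R q 1 + a 2 *\<^sub>R q 2 + a 3 *\<^sub>R q 3"
proof -
  have inj: "inj_on q {..<4}" using descartes_inj[OF assms] by (auto simp: inj_on_def)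
  have sum4: "(\<Sum>i<4. f i) = f 0 + f 1 + f 2 + f 3" for f :: "nat \<Rightarrow> 'b::comm_monoid_add"
    by (simp add: eval_nat_numeral)
  have "independent (q ` {..<4})"
  proof (rule independent_if_scalars_zero)
    fix f x assume f: "(\<Sum>x\<in>q ` {..<4}. f x *\<^sub>R x) = 0" and x: "x \<in> q ` {..<4}"
    define a where "a = f \<circ> q"
    have s: "a 0 *\<^sub>R q 0 + a 1 *\<^sub>R q 1 + a 2 *\<^sub>R q 2 + a 3 *\<^sub>R q 3 = 0"
      using f unfolding sum.reindex[OF inj] sum4 a_def by simp
    have "lorentz (a 0 *\<^sub>R q 0 + a 1 *\<^sub>R q 1 + a 2 *\<^sub>R q 2 + a 3 *\<^sub>R q 3) (q i) = 0" for i
      unfolding s by (cases "q i") (simp add: zero_prod_def)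
    from this[of 0] this[of 1] this[of 2] this[of 3]
    have "a 0 = 0 \<and> a 1 = 0 \<and> a 2 = 0 \<and> a 3 = 0"
      using assms by (simp add: descartes_def all_less_4_iff lorentz_simps)
    thus "f x = 0" using x by (auto simp: a_def less_4_iff)
  qed simp
  moreover have "card (q ` {..<4}) = DIM(cvec)" using card_image[OF inj] by simp
  ultimately have "span (q ` {..<4}) = UNIV"
    by (metis card_ge_dim_independent dim_UNIV order_refl subset_UNIV top.extremum_uniqueI)
  hence "v \<in> range (\<lambda>u. \<Sum>x\<in>q ` {..<4}. u x *\<^sub>R x)"
    using span_finite[of "q ` {..<4}"] by auto
  then obtain u where "v = (\<Sum>i<4. u (q i) *\<^sub>R q i)" by (auto simp: sum.reindex[OF inj])
  thus thesis using that[of "u \<circ> q"] by (simp add: sum4)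
qed

text \<open>In coordinates with respect to \<open>q\<close>, the three prescribed products make
  every coordinate except the one at \<open>l\<close> equal to (s - 1) / 2, where \<open>s\<close>
  is the sum of the coordinates. The norm is then a quadratic condition on \<open>s\<close>; its
  roots 1 and 5 give the entry itself and its replacement.\<close>

lemma descartes_fourth:
  assumes "descartes q" "l < 4" "lorentz v v = 1" "\<And>i. i < 4 \<Longrightarrow> i \<noteq> l \<Longrightarrow> lorentz v (q i) = -1"
  shows "v = q l \<or> v = move l q l"
proof -
  obtain a :: "nat \<Rightarrow> real" where a: "v = a 0 *\<^sub>R q 0 + a 1 *\<^sub>R q 1 + a 2 *\<^sub>R q 2 + a 3 *\<^sub>R q 3"
    using descartes_expand[OF assms(1)] by blast
  define s where "s = a 0 + a 1 + a 2 + a 3"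
  have lq: "lorentz v (q i) = 2 * a i - s" if "i < 4" for i
    using that assms(1) unfolding less_4_iff
    by (elim disjE) (auto simp: a s_def descartes_def all_less_4_iff lorentz_simps)
  have ai: "a i = (s - 1) / 2" if "i < 4" "i \<noteq> l" for i
    using lq[of i] assms(4)[of i] that by simp
  consider "l = 0" "a 1 = (s - 1) / 2" "a 2 = (s - 1) / 2" "a 3 = (s - 1) / 2"
    | "l = 1" "a 0 = (s - 1) / 2" "a 2 = (s - 1) / 2" "a 3 = (s - 1) / 2"
    | "l = 2" "a 0 = (s - 1) / 2" "a 1 = (s - 1) / 2" "a 3 = (s - 1) / 2"
    | "l = 3" "a 0 = (s - 1) / 2" "a 1 = (s - 1) / 2" "a 2 = (s - 1) / 2"
  proof -
    have "l = 0 \<or> l = 1 \<or> l = 2 \<or> l = 3" using assms(2) by (simp only: less_4_iff)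
    thus thesis
      using that ai by (elim disjE) simp_all
  qed
  note cases4 = this
  have al: "a l = (3 - s) / 2"
  proof (cases rule: cases4)
    case 1
    have "a 0 + a 1 + a 2 + a 3 = s" by (simp add: s_def)
    thus ?thesis using 1(2-4) unfolding 1(1) by argo
  next
    case 2
    have "a 0 + a 1 + a 2 + a 3 = s" by (simp add: s_def)
    thus ?thesis using 2(2-4) unfolding 2(1) by argo
  next
    case 3
    have "a 0 + a 1 + a 2 + a 3 = s" by (simp add: s_def)
    thus ?thesis using 3(2-4) unfolding 3(1) by argo
  next
    case 4
    have "a 0 + a 1 + a 2 + a 3 = s" by (simp add: s_def)
    thus ?thesis using 4(2-4) unfolding 4(1) by argo
  qed
  have "lorentz v v = a 0 * lorentz v (q 0) + a 1 * lorentz v (q 1) + a 2 * lorentz v (q 2) + a 3 * lorentz v (q 3)"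
    by (subst (2) a) (simp add: lorentz_simps)
  also have "\<dots> = 2 * ((a 0)\<^sup>2 + (a 1)\<^sup>2 + (a 2)\<^sup>2 + (a 3)\<^sup>2) - s * s"
    by (simp add: lq power2_eq_square algebra_simps s_def)
  also have "(a 0)\<^sup>2 + (a 1)\<^sup>2 + (a 2)\<^sup>2 + (a 3)\<^sup>2 = 3 * ((s - 1) / 2)\<^sup>2 + ((3 - s) / 2)\<^sup>2"
  proof (cases rule: cases4)
    case 1
    show ?thesis unfolding al[unfolded 1(1)] 1(2-4) by simp
  next
    case 2
    show ?thesis unfolding al[unfolded 2(1)] 2(2-4) by simp
  next
    case 3
    show ?thesis unfolding al[unfolded 3(1)] 3(2-4) by simp
  next
    case 4
    show ?thesis unfolding al[unfolded 4(1)] 4(2-4) by simp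
  qed
  finally have "(s - 1) * (s - 5) = 0"
    using assms(3) by (simp add: power2_eq_square field_simps)
  hence "s = 1 \<or> s = 5" by simp
  thus ?thesis
  proof
    assume "s = 1"
    thus ?thesis using al a by (cases rule: cases4) simp_all
  next
    assume "s = 5"
    thus ?thesis using al a
      by (cases rule: cases4) (simp_all add: move_def algebra_simps scaleR_2 scaleR_3)
  qed
qed

text \<open>Three tangent orbit vectors leave one free index \<open>l\<close> in a common quadruple,
  and a fourth tangent vector is the entry at \<open>l\<close> or its replacement.\<close>

lemma orbit_vecs_closed:
  assumes "descartes q" "v1 \<in> orbit_vecs q" "v2 \<in> orbit_vecs q" "v3 \<in> orbit_vecs q"
    "lorentz v1 v2 = -1" "lorentz v1 v3 = -1" "lorentz v2 v3 = -1"
    "lorentz v v = 1" "lorentz v v1 = -1" "lorentz v v2 = -1" "lorentz v v3 = -1"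
  shows "v \<in> orbit_vecs q"
proof -
  obtain w i j k where w: "set w \<subseteq> {..<4}" "i < 4" "j < 4" "k < 4" "i \<noteq> j" "i \<noteq> k" "j \<noteq> k"
    "moves q w i = v1" "moves q w j = v2" "moves q w k = v3"
    using orbit_vecs_tangent_triple[OF assms(1-7)] by metis
  have "card {i, j, k} = 3" using w by simp
  hence "\<not> {..<4} \<subseteq> {i, j, k}" using card_mono[of "{i, j, k}" "{..<4::nat}"] by auto
  then obtain l where l: "l < 4" "l \<noteq> i" "l \<noteq> j" "l \<noteq> k" by auto
  have "{i, j, k, l} = {..<4}" using l w by (intro card_subset_eq) auto
  hence l2: "m = i \<or> m = j \<or> m = k" if "m < 4" "m \<noteq> l" for m using that by blast
  have "v = moves q w l \<or> v = move l (moves q w) l"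
    using l l2 w assms by (intro descartes_fourth descartes_moves) auto
  moreover have "move l (moves q w) = moves q (w @ [l])" by simp
  ultimately show ?thesis using w(1) l(1) unfolding orbit_vecs_def
    by (smt (verit) CollectI Un_least empty_subsetI insert_subset lessThan_iff list.set(1) list.simps(15) set_append)
qed

section \<open>Oriented circles as vectors\<close>

fun circle_poly :: "cvec \<Rightarrow> real^2 \<Rightarrow> real" where
  "circle_poly (b, c, x, y) z = b * ((z$1)\<^sup>2 + (z$2)\<^sup>2) - 2 * (x * z$1 + y * z$2) + c"

definition circle_of :: "cvec \<Rightarrow> ocircle" where
  "circle_of v = ({z. circle_poly v z = 0}, {z. circle_poly v z < 0})"

lemma circle_poly_minus: "circle_poly (- v) z = - circle_poly v z"
  by (cases v) (simp add: algebra_simps)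

lemma vec2_eq_iff: "(z :: real^2) = w \<longleftrightarrow> z$1 = w$1 \<and> z$2 = w$2"
  by (auto simp: vec_eq_iff forall_2)

lemma dist2: "(dist z (w :: real^2))\<^sup>2 = (z$1 - w$1)\<^sup>2 + (z$2 - w$2)\<^sup>2"
  by (simp add: dist_vec_def L2_set_def sum_2 dist_real_def)

lemma circle_poly_center:
  assumes "lorentz (b, c, x, y) (b, c, x, y) = 1" "b \<noteq> 0"
  shows "circle_poly (b, c, x, y) z = b * ((dist z (vector [x / b, y / b]))\<^sup>2 - (1 / b)\<^sup>2)"
proof -
  have c: "c = (x\<^sup>2 + y\<^sup>2 - 1) / b" using assms by (simp add: field_simps power2_eq_square)
  show ?thesis unfolding dist2 c using assms(2) by (simp add: field_simps power2_eq_square)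
qed

lemma components_Un:
  assumes "open A" "open B" "connected A" "connected B" "A \<noteq> {}" "B \<noteq> {}" "A \<inter> B = {}"
  shows "components (A \<union> B) = {A, B}"
proof -
  have *: "A \<in> components (A \<union> B)"
    if "open A" "open B" "connected A" "A \<noteq> {}" "A \<inter> B = {}" for A B :: "'a set"
    unfolding in_components_maximal
  proof (intro conjI allI impI)
    fix D assume D: "D \<noteq> {} \<and> A \<subseteq> D \<and> D \<subseteq> A \<union> B \<and> connected D"
    have "A \<inter> B \<inter> D = {}" using that by blast
    hence "A \<inter> D = {} \<or> B \<inter> D = {}" using D that by (intro connectedD) auto
    thus "D = A" using D that by blast
  qed (use that in auto)
  have AB: "A \<in> components (A \<union> B)" "B \<in> components (A \<union> B)"
    using *[of A B] *[of B A] assms by (auto simp: Un_commute Int_commute)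
  have "C = A \<or> C = B" if C: "C \<in> components (A \<union> B)" for C
  proof -
    have "C \<inter> A \<noteq> {} \<or> C \<inter> B \<noteq> {}"
      using in_components_nonempty[OF C] in_components_subset[OF C] by blast
    thus ?thesis using components_eq[OF C AB(1)] components_eq[OF C AB(2)] by blast
  qed
  thus ?thesis using AB by blast
qed

lemma components_sphere:
  fixes c :: "real^2"
  assumes "r > 0"
  shows "components (- sphere c r) = {ball c r, - cball c r}"
proof -
  have "- sphere c r = ball c r \<union> - cball c r" by auto
  moreover have "connected (- cball c r)"
    by (rule connected_complement_bounded_convex) auto
  moreover have "- cball c r \<noteq> {}" using bounded_cball[of c r] not_bounded_UNIV by (metis Compl_empty_eq double_compl)
  ultimately show ?thesis using assms
    by (simp only:) (rule components_Un, auto)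
qed

lemma components_line:
  fixes n :: "real^2"
  assumes "n \<noteq> 0"
  shows "components (- {x. n \<bullet> x = k}) = {{x. n \<bullet> x < k}, {x. n \<bullet> x > k}}"
proof -
  have "- {x. n \<bullet> x = k} = {x. n \<bullet> x < k} \<union> {x. n \<bullet> x > k}" by auto
  moreover have "((k - 1) / (n \<bullet> n)) *\<^sub>R n \<in> {x. n \<bullet> x < k}" "((k + 1) / (n \<bullet> n)) *\<^sub>R n \<in> {x. n \<bullet> x > k}"
    using assms by auto
  hence "{x. n \<bullet> x < k} \<noteq> {}" "{x. n \<bullet> x > k} \<noteq> {}" by blast+
  ultimately show ?thesis
    by (simp only:) (rule components_Un, auto intro: open_halfspace_lt open_halfspace_gt
      convex_connected convex_halfspace_lt convex_halfspace_gt)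
qed

lemma power2_less_iff: "0 \<le> a \<Longrightarrow> 0 \<le> b \<Longrightarrow> a\<^sup>2 < b\<^sup>2 \<longleftrightarrow> a < (b :: real)"
  by (meson power2_less_imp_less power_strict_mono zero_less_numeral)

lemma circle_of_disk:
  assumes "lorentz (b, c, x, y) (b, c, x, y) = 1" "b \<noteq> 0"
  shows "circle_of (b, c, x, y) = (sphere (vector [x / b, y / b]) (1 / \<bar>b\<bar>),
    if b > 0 then ball (vector [x / b, y / b]) (1 / \<bar>b\<bar>)
    else - cball (vector [x / b, y / b]) (1 / \<bar>b\<bar>))"
proof -
  let ?c = "vector [x / b, y / b] :: real^2"
  have sq: "(1 / b)\<^sup>2 = (1 / \<bar>b\<bar>)\<^sup>2" by (simp add: power_divide)
  have "circle_poly (b, c, x, y) z = 0 \<longleftrightarrow> dist ?c z = 1 / \<bar>b\<bar>" for z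
    unfolding circle_poly_center[OF assms] sq using assms(2)
    by (auto simp: dist_commute power2_eq_iff_nonneg)
  moreover have "circle_poly (b, c, x, y) z < 0 \<longleftrightarrow>
      (if b > 0 then dist ?c z < 1 / \<bar>b\<bar> else dist ?c z > 1 / \<bar>b\<bar>)" for z
    unfolding circle_poly_center[OF assms] sq using assms(2)
      power2_less_iff[of "dist z ?c" "1 / \<bar>b\<bar>"] power2_less_iff[of "1 / \<bar>b\<bar>" "dist z ?c"]
    by (auto simp: dist_commute mult_less_0_iff)
  ultimately show ?thesis unfolding circle_of_def by auto
qed

lemma inner2: "(z :: real^2) \<bullet> w = z$1 * w$1 + z$2 * w$2"
  by (simp add: inner_vec_def sum_2)

lemma circle_of_line:
  "circle_of (0, c, x, y) = ({z. vector [x, y] \<bullet> z = c / 2}, {z. vector [x, y] \<bullet> z > c / 2})"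
  by (auto simp: circle_of_def inner2)

lemma lorentz_zero_curv: "lorentz (0, c, x, y) (0, c, x, y) = 1 \<longleftrightarrow> x\<^sup>2 + y\<^sup>2 = 1"
  by (simp add: power2_eq_square)

lemma straight_line_circle_of:
  assumes "lorentz v v = 1"
  shows "straight_line (fst (circle_of v)) \<longleftrightarrow> fst v = 0"
proof -
  obtain b c x y where v: "v = (b, c, x, y)" by (cases v)
  show ?thesis
  proof (cases "b = 0")
    case True
    hence "x\<^sup>2 + y\<^sup>2 = 1" using assms v lorentz_zero_curv by simp
    hence "vector [x, y] \<noteq> (0 :: real^2)" by (auto simp: vec2_eq_iff)
    hence "straight_line (fst (circle_of (0, c, x, y)))"
      unfolding straight_line_def circle_of_line fst_conv by blast
    thus ?thesis using True v by simp
  next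
    case False
    thus ?thesis using assms unfolding v
      by (simp add: circle_of_disk sphere_not_straight_line)
  qed
qed

lemma oriented_circle_circle_of:
  assumes "lorentz v v = 1"
  shows "oriented_circle (circle_of v)"
proof -
  obtain b c x y where v: "v = (b, c, x, y)" by (cases v)
  show ?thesis
  proof (cases "b = 0")
    case True
    hence "x\<^sup>2 + y\<^sup>2 = 1" using assms v lorentz_zero_curv by simp
    hence n: "vector [x, y] \<noteq> (0 :: real^2)" by (auto simp: vec2_eq_iff)
    have "straight_line (fst (circle_of v))" using assms True v by (simp add: straight_line_circle_of)
    moreover have "snd (circle_of v) \<in> components (- fst (circle_of v))"
      unfolding v True circle_of_line fst_conv snd_conv components_line[OF n] by blast
    ultimately show ?thesis unfolding oriented_circle_def by blast
  next
    case False
    hence r: "1 / \<bar>b\<bar> > 0" by simp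
    have "snd (circle_of v) \<in> components (- fst (circle_of v))"
      unfolding v circle_of_disk[OF assms[unfolded v] False] fst_conv snd_conv components_sphere[OF r]
      by simp
    moreover have "euclidean_circle (fst (circle_of v))"
      unfolding v circle_of_disk[OF assms[unfolded v] False] fst_conv euclidean_circle_def using r by blast
    ultimately show ?thesis unfolding oriented_circle_def by blast
  qed
qed

lemma oriented_circle_imp_circle_of:
  assumes "oriented_circle C"
  shows "\<exists>v. lorentz v v = 1 \<and> C = circle_of v"
proof -
  \<comment> \<open>\<open>v\<close> and \<open>- v\<close> have the same zero set and opposite
    negative sides, so once the point set is right a choice of sign yields the interior.\<close>
  have *: ?thesis if "lorentz v v = 1" "fst C = fst (circle_of v)" "snd C = snd (circle_of v) \<or> snd C = snd (circle_of (- v))" for v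
  proof -
    have "fst (circle_of (- v)) = fst (circle_of v)" by (simp add: circle_of_def circle_poly_minus)
    thus ?thesis using that
      by (metis lorentz_neg_left lorentz_neg_right add.inverse_inverse prod.collapse)
  qed
  from assms consider "euclidean_circle (fst C)" | "straight_line (fst C)"
    unfolding oriented_circle_def by blast
  thus ?thesis
  proof cases
    case 1
    then obtain z r where zr: "r > 0" "fst C = sphere z r" unfolding euclidean_circle_def by blast
    define v where "v = (1 / r, ((z$1)\<^sup>2 + (z$2)\<^sup>2 - r\<^sup>2) / r, z$1 / r, z$2 / r)"
    have l: "lorentz v v = 1" using zr by (simp add: v_def field_simps power2_eq_square)
    have z: "vector [z$1, z$2] = z" by (simp add: vec2_eq_iff)
    have v1: "circle_of v = (sphere z r, ball z r)"
      using circle_of_disk[OF l[unfolded v_def]] zr by (simp add: v_def z)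
    have "lorentz (- v) (- v) = 1" using l by (simp add: lorentz_simps)
    hence l': "lorentz (- (1 / r), - (((z$1)\<^sup>2 + (z$2)\<^sup>2 - r\<^sup>2) / r), - (z$1 / r), - (z$2 / r))
        (- (1 / r), - (((z$1)\<^sup>2 + (z$2)\<^sup>2 - r\<^sup>2) / r), - (z$1 / r), - (z$2 / r)) = 1"
      unfolding v_def uminus_Pair .
    have v2: "circle_of (- v) = (sphere z r, - cball z r)"
      unfolding v_def uminus_Pair using circle_of_disk[OF l'] zr by (simp add: z)
    show ?thesis using *[of v] l v1 v2 zr assms components_sphere[OF zr(1), of z]
      by (auto simp: oriented_circle_def)
  next
    case 2
    then obtain n k where n: "n \<noteq> 0" "fst C = {x. n \<bullet> x = k}" unfolding straight_line_def by blast
    define m where "m = norm n"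
    have m: "m > 0" "m\<^sup>2 = (n$1)\<^sup>2 + (n$2)\<^sup>2" using n(1)
      by (simp add: m_def) (simp add: m_def power2_norm_eq_inner inner2, simp add: power2_eq_square)
    define v where "v = (0::real, 2 * k / m, n$1 / m, n$2 / m)"
    have "lorentz v v = ((n$1)\<^sup>2 + (n$2)\<^sup>2) / m\<^sup>2"
      by (simp add: v_def power2_eq_square add_divide_distrib)
    hence l: "lorentz v v = 1" unfolding m(2)[symmetric] using m(1) by simp
    have g: "circle_poly v z = 2 * (k - n \<bullet> z) / m" for z
      using m by (simp add: v_def inner2 field_simps)
    have "circle_of v = ({x. n \<bullet> x = k}, {x. n \<bullet> x > k})" "circle_of (- v) = ({x. n \<bullet> x = k}, {x. n \<bullet> x < k})"
      using m unfolding circle_of_def circle_poly_minus g by (auto simp: divide_less_0_iff zero_less_divide_iff)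
    thus ?thesis using *[of v] l n assms components_line[OF n(1), of k]
      by (auto simp: oriented_circle_def)
  qed
qed

text \<open>Half the gradient of \<open>circle_poly (b, c, x, y)\<close> at \<open>z\<close> is
  \<open>(b * z$1 - x, b * z$2 - y)\<close>, which is a unit vector at points of a circle of norm 1.
  At a common point of two circles the Lorentz product is thus the cosine of the angle between the
  normals.\<close>

lemma normal_inner:
  "(b * z$1 - x) * (b' * z$1 - x') + (b * z$2 - y) * (b' * z$2 - y') =
    lorentz (b, c, x, y) (b', c', x', y') + (b * circle_poly (b', c', x', y') z + b' * circle_poly (b, c, x, y) z) / 2"
  by (simp add: algebra_simps power2_eq_square add_divide_distrib diff_divide_distrib)

lemma circle_poly_add:
  "circle_poly (b, c, x, y) (z + s *\<^sub>R d) = circle_poly (b, c, x, y) z +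
    2 * s * ((b * z$1 - x) * d$1 + (b * z$2 - y) * d$2) + b * s\<^sup>2 * ((d$1)\<^sup>2 + (d$2)\<^sup>2)"
  by (simp add: algebra_simps power2_eq_square)

text \<open>If the normals at a common point are not parallel, there is a second common point; if
  the normals of two lines are not parallel, the lines meet.\<close>

lemma tangent_lorentz:
  assumes v: "lorentz v v = 1" and v': "lorentz v' v' = 1" and t: "tangent (circle_of v) (circle_of v')"
  shows "lorentz v v' = 1 \<or> lorentz v v' = -1"
proof -
  obtain b c x y where vv: "v = (b, c, x, y)" by (cases v)
  obtain b' c' x' y' where vv': "v' = (b', c', x', y')" by (cases v')
  have fin: "l = 1 \<or> l = -1"
    if "n1\<^sup>2 + n2\<^sup>2 = 1" "m1\<^sup>2 + m2\<^sup>2 = 1" "n1 * m2 - n2 * m1 = 0" "l = n1 * m1 + n2 * m2"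
    for l n1 n2 m1 m2 :: real
  proof -
    have "(n1 * m1 + n2 * m2)\<^sup>2 + (n1 * m2 - n2 * m1)\<^sup>2 = (n1\<^sup>2 + n2\<^sup>2) * (m1\<^sup>2 + m2\<^sup>2)"
      by (simp add: algebra_simps power2_eq_square)
    thus ?thesis using that by (simp add: power2_eq_1_iff)
  qed
  show ?thesis
  proof (cases "b = 0 \<and> b' = 0")
    case True
    have n: "x\<^sup>2 + y\<^sup>2 = 1" "x'\<^sup>2 + y'\<^sup>2 = 1" using v v' True vv vv' lorentz_zero_curv by simp_all
    have dj: "fst (circle_of v) \<inter> fst (circle_of v') = {}"
      using t True v v' unfolding tangent_def by (simp add: straight_line_circle_of vv vv')
    have "x * y' - y * x' = 0"
    proof (rule ccontr)
      define d where "d = x * y' - y * x'"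
      assume "x * y' - y * x' \<noteq> 0"
      hence d: "d \<noteq> 0" by (simp add: d_def)
      \<comment> \<open>Intersection point of the two lines by Cramer's rule.\<close>
      define z :: "real^2" where "z = vector [(c * y' - c' * y) / (2 * d), (x * c' - x' * c) / (2 * d)]"
      have "2 * (x * z$1 + y * z$2) = c * (d / d)" "2 * (x' * z$1 + y' * z$2) = c' * (d / d)"
        using d by (simp_all add: z_def field_simps, simp_all add: d_def algebra_simps)
      hence "z \<in> fst (circle_of v) \<inter> fst (circle_of v')"
        using d True by (simp add: circle_of_def vv vv')
      thus False using dj by blast
    qed
    thus ?thesis using fin[OF n] True vv vv' by simp
  next
    case False
    then obtain p where p: "fst (circle_of v) \<inter> fst (circle_of v') = {p}"
      using t v v' unfolding tangent_def by (auto simp: straight_line_circle_of vv vv')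
    hence g: "circle_poly v p = 0" "circle_poly v' p = 0" by (auto simp: circle_of_def)
    define n1 n2 m1 m2 where "n1 = b * p$1 - x" "n2 = b * p$2 - y"
      "m1 = b' * p$1 - x'" "m2 = b' * p$2 - y'"
    note nd = this
    have n: "n1\<^sup>2 + n2\<^sup>2 = 1" "m1\<^sup>2 + m2\<^sup>2 = 1" "lorentz v v' = n1 * m1 + n2 * m2"
      using normal_inner[of b p x b x y y c c] normal_inner[of b' p x' b' x' y' y' c' c']
        normal_inner[of b p x b' x' y y' c c'] v v' g
      unfolding nd vv vv' power2_eq_square by simp_all
    define cr where "cr = n1 * m2 - n2 * m1"
    have "cr = 0"
    proof (rule ccontr)
      assume cr: "cr \<noteq> 0"
      \<comment> \<open>\<open>d\<close> is the direction of the radical line. Along it both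
        polynomials are multiples of the same quadratic 2 s cr + s^2 |d|^2, whose nonzero root gives
        the second common point.\<close>
      define d :: "real^2" where "d = vector [- (b' * n2 - b * m2), b' * n1 - b * m1]"
      have nd1: "n1 * d$1 + n2 * d$2 = b * cr" and nd2: "m1 * d$1 + m2 * d$2 = b' * cr"
        by (simp_all add: d_def cr_def algebra_simps)
      have d0: "d \<noteq> 0" using nd1 nd2 cr False by auto
      hence e: "(d$1)\<^sup>2 + (d$2)\<^sup>2 \<noteq> 0" by (auto simp: vec2_eq_iff sum_power2_eq_zero_iff)
      define s where "s = - 2 * cr / ((d$1)\<^sup>2 + (d$2)\<^sup>2)"
      have s: "s \<noteq> 0" "s * ((d$1)\<^sup>2 + (d$2)\<^sup>2) = - 2 * cr" using e cr by (simp_all add: s_def)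
      have "circle_poly v (p + s *\<^sub>R d) = 2 * s * (b * cr) + b * s * (s * ((d$1)\<^sup>2 + (d$2)\<^sup>2))"
        using g(1) nd1 unfolding vv circle_poly_add nd(1,2) by (simp add: power2_eq_square)
      moreover have "circle_poly v' (p + s *\<^sub>R d) = 2 * s * (b' * cr) + b' * s * (s * ((d$1)\<^sup>2 + (d$2)\<^sup>2))"
        using g(2) nd2 unfolding vv' circle_poly_add nd(3,4) by (simp add: power2_eq_square)
      ultimately have "p + s *\<^sub>R d \<in> fst (circle_of v) \<inter> fst (circle_of v')"
        unfolding s(2) by (simp add: circle_of_def)
      thus False using p s d0 by auto
    qed
    thus ?thesis using fin[OF n(1,2) _ n(3)] by (simp add: cr_def)
  qed
qed

text \<open>Product 1 means equal outward normals at the contact point, so a short step against the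
  normal enters both interiors. For two lines the normals agree and a long step along them
  does.\<close>

lemma lorentz_one_overlap:
  assumes v: "lorentz v v = 1" and v': "lorentz v' v' = 1" and t: "tangent (circle_of v) (circle_of v')"
    and l: "lorentz v v' = 1"
  shows "\<not> disjnt (snd (circle_of v)) (snd (circle_of v'))"
proof -
  obtain b c x y where vv: "v = (b, c, x, y)" by (cases v)
  obtain b' c' x' y' where vv': "v' = (b', c', x', y')" by (cases v')
  have "\<exists>z. circle_poly v z < 0 \<and> circle_poly v' z < 0"
  proof (cases "b = 0 \<and> b' = 0")
    case True
    have n: "x\<^sup>2 + y\<^sup>2 = 1" "x'\<^sup>2 + y'\<^sup>2 = 1" using v v' True vv vv' lorentz_zero_curv by simp_all
    have "(x - x')\<^sup>2 + (y - y')\<^sup>2 = 0"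
      using n l True unfolding vv vv' by (simp add: power2_eq_square algebra_simps)
    hence e: "x' = x" "y' = y" by (simp_all add: sum_power2_eq_zero_iff)
    define s where "s = \<bar>c\<bar> + \<bar>c'\<bar> + 1"
    define z :: "real^2" where "z = vector [s * x, s * y]"
    have "x * z$1 + y * z$2 = s * (x\<^sup>2 + y\<^sup>2)" by (simp add: z_def power2_eq_square algebra_simps)
    hence "x * z$1 + y * z$2 = s" using n by simp
    hence "circle_poly v z < 0" "circle_poly v' z < 0" using True e by (simp_all add: vv vv' s_def)
    thus ?thesis by blast
  next
    case False
    then obtain p where p: "fst (circle_of v) \<inter> fst (circle_of v') = {p}"
      using t v v' unfolding tangent_def by (auto simp: straight_line_circle_of vv vv')
    hence g: "circle_poly v p = 0" "circle_poly v' p = 0" by (auto simp: circle_of_def)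
    define n1 n2 m1 m2 where "n1 = b * p$1 - x" "n2 = b * p$2 - y"
      "m1 = b' * p$1 - x'" "m2 = b' * p$2 - y'"
    note nd = this
    have n: "n1\<^sup>2 + n2\<^sup>2 = 1" "m1\<^sup>2 + m2\<^sup>2 = 1" "lorentz v v' = n1 * m1 + n2 * m2"
      using normal_inner[of b p x b x y y c c] normal_inner[of b' p x' b' x' y' y' c' c']
        normal_inner[of b p x b' x' y y' c c'] v v' g
      unfolding nd vv vv' power2_eq_square by simp_all
    have "(n1 - m1)\<^sup>2 + (n2 - m2)\<^sup>2 = 0"
      using n l by (simp add: power2_eq_square algebra_simps)
    hence e: "m1 = n1" "m2 = n2" by (simp_all add: sum_power2_eq_zero_iff)
    define s where "s = 1 / (1 + \<bar>b\<bar> + \<bar>b'\<bar>)"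
    have s: "s > 0" "b * s < 2" "b' * s < 2" by (auto simp: s_def field_simps)
    define d :: "real^2" where "d = vector [n1, n2]"
    have "circle_poly v (p + (- s) *\<^sub>R d) = s * (b * s - 2)"
      using g(1) n(1) unfolding vv circle_poly_add nd(1,2)[symmetric]
      by (simp add: d_def power2_eq_square algebra_simps)
    moreover have "circle_poly v' (p + (- s) *\<^sub>R d) = s * (b' * s - 2)"
      using g(2) n(1) unfolding vv' circle_poly_add nd(3,4)[symmetric] e
      by (simp add: d_def power2_eq_square algebra_simps)
    ultimately show ?thesis using s by (metis mult_pos_neg diff_less_0_iff_less)
  qed
  thus ?thesis by (auto simp: circle_of_def disjnt_iff)
qed

lemma tangent_disjoint_lorentz:
  assumes "lorentz v v = 1" "lorentz v' v' = 1" "tangent (circle_of v) (circle_of v')"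
    "disjnt (snd (circle_of v)) (snd (circle_of v'))"
  shows "lorentz v v' = -1"
  using tangent_lorentz[OF assms(1-3)] lorentz_one_overlap[OF assms(1-3)] assms(4) by blast

text \<open>With nonnegative curvatures the only pairs for which the form does not detect disjointness
  of interiors are pairs of opposite half-planes; the sum of the second entries is then twice the
  signed distance of the two lines.\<close>

definition separable :: "cvec \<Rightarrow> cvec \<Rightarrow> bool" where
  "separable v v' \<longleftrightarrow> fst v \<ge> 0 \<and> fst v' \<ge> 0 \<and>
     (fst v + fst v' > 0 \<or> fst (snd v) + fst (snd v') > 0)"

text \<open>Let n and m be the half gradients at a common interior point. Then |n + m|^2 is a sum of
  nonpositive terms, so each term vanishes: both curvatures are 0 and the half-planes are opposite,
  in which case the two polynomials add up to c + c' > 0.\<close>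

lemma lorentz_disjoint:
  assumes v: "lorentz v v = 1" and v': "lorentz v' v' = 1" and l: "lorentz v v' \<le> -1" and s: "separable v v'"
  shows "disjnt (snd (circle_of v)) (snd (circle_of v'))"
proof -
  obtain b c x y where vv: "v = (b, c, x, y)" by (cases v)
  obtain b' c' x' y' where vv': "v' = (b', c', x', y')" by (cases v')
  have b: "b \<ge> 0" "b' \<ge> 0" "b + b' > 0 \<or> c + c' > 0" using s by (auto simp: separable_def vv vv')
  have False if g: "circle_poly v z < 0" "circle_poly v' z < 0" for z
  proof -
    define n1 n2 m1 m2 where "n1 = b * z$1 - x" "n2 = b * z$2 - y"
      "m1 = b' * z$1 - x'" "m2 = b' * z$2 - y'"
    note nd = this
    have n: "n1\<^sup>2 + n2\<^sup>2 = 1 + b * circle_poly v z" "m1\<^sup>2 + m2\<^sup>2 = 1 + b' * circle_poly v' z"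
      "n1 * m1 + n2 * m2 = lorentz v v' + (b * circle_poly v' z + b' * circle_poly v z) / 2"
      using normal_inner[of b z x b x y y c c] normal_inner[of b' z x' b' x' y' y' c' c']
        normal_inner[of b z x b' x' y y' c c'] v v'
      unfolding nd vv vv' power2_eq_square by simp_all
    have nn: "b * circle_poly v z \<le> 0" "b' * circle_poly v' z \<le> 0" "b * circle_poly v' z \<le> 0" "b' * circle_poly v z \<le> 0"
      using b g by (simp_all add: mult_nonneg_nonpos)
    have "0 \<le> (n1 + m1)\<^sup>2 + (n2 + m2)\<^sup>2" by simp
    also have "\<dots> = (n1\<^sup>2 + n2\<^sup>2) + (m1\<^sup>2 + m2\<^sup>2) + 2 * (n1 * m1 + n2 * m2)"
      by (simp add: power2_eq_square algebra_simps)
    also have "\<dots> = 2 + 2 * lorentz v v' + b * circle_poly v z + b' * circle_poly v' z + b * circle_poly v' z + b' * circle_poly v z"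
      unfolding n by simp
    finally have z: "b * circle_poly v z = 0" "b' * circle_poly v' z = 0" "lorentz v v' = -1"
      using nn l by linarith+
    have b0: "b = 0" "b' = 0" using z g by auto
    have "x\<^sup>2 + y\<^sup>2 = 1" "x'\<^sup>2 + y'\<^sup>2 = 1" using v v' b0 vv vv' lorentz_zero_curv by simp_all
    hence "(x + x')\<^sup>2 + (y + y')\<^sup>2 = 0"
      using z(3) b0 unfolding vv vv' by (simp add: power2_eq_square algebra_simps)
    hence "x' = - x" "y' = - y" by (simp_all add: sum_power2_eq_zero_iff)
    hence "circle_poly v z + circle_poly v' z = c + c'" using b0 by (simp add: vv vv')
    thus False using g b b0 by simp
  qed
  thus ?thesis by (auto simp: circle_of_def disjnt_iff)
qed

text \<open>At a common point the unit normals are opposite. Unless both circles are lines, this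
  forces the point to be (x + x', y + y') / (b + b'), and that point does lie on both.\<close>

lemma lorentz_tangent:
  assumes v: "lorentz v v = 1" and v': "lorentz v' v' = 1" and l: "lorentz v v' = -1" and s: "separable v v'"
  shows "tangent (circle_of v) (circle_of v')"
proof -
  obtain b c x y where vv: "v = (b, c, x, y)" by (cases v)
  obtain b' c' x' y' where vv': "v' = (b', c', x', y')" by (cases v')
  have b: "b \<ge> 0" "b' \<ge> 0" "b + b' > 0 \<or> c + c' > 0" using s by (auto simp: separable_def vv vv')
  show ?thesis
  proof (cases "b = 0 \<and> b' = 0")
    case True
    have "x\<^sup>2 + y\<^sup>2 = 1" "x'\<^sup>2 + y'\<^sup>2 = 1" using v v' True vv vv' lorentz_zero_curv by simp_all
    hence "(x + x')\<^sup>2 + (y + y')\<^sup>2 = 0"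
      using l True unfolding vv vv' by (simp add: power2_eq_square algebra_simps)
    hence "x' = - x" "y' = - y" by (simp_all add: sum_power2_eq_zero_iff)
    hence "circle_poly v z + circle_poly v' z = c + c'" for z using True by (simp add: vv vv')
    hence "\<not> (circle_poly v z = 0 \<and> circle_poly v' z = 0)" for z using b True by (metis add_0 less_irrefl)
    hence "fst (circle_of v) \<inter> fst (circle_of v') = {}" by (auto simp: circle_of_def)
    thus ?thesis using True v v' by (simp add: tangent_def straight_line_circle_of vv vv')
  next
    case False
    define k where "k = b + b'"
    have k: "k > 0" using False b by (auto simp: k_def)
    define p :: "real^2" where "p = vector [(x + x') / k, (y + y') / k]"
    have uniq: "z = p" if g: "circle_poly v z = 0" "circle_poly v' z = 0" for z
    proof -
      define n1 n2 m1 m2 where "n1 = b * z$1 - x" "n2 = b * z$2 - y"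
        "m1 = b' * z$1 - x'" "m2 = b' * z$2 - y'"
      note nd = this
      have n: "n1\<^sup>2 + n2\<^sup>2 = 1" "m1\<^sup>2 + m2\<^sup>2 = 1" "n1 * m1 + n2 * m2 = -1"
        using normal_inner[of b z x b x y y c c] normal_inner[of b' z x' b' x' y' y' c' c']
          normal_inner[of b z x b' x' y y' c c'] v v' l g
        unfolding nd vv vv' power2_eq_square by simp_all
      have "(n1 + m1)\<^sup>2 + (n2 + m2)\<^sup>2 = (n1\<^sup>2 + n2\<^sup>2) + (m1\<^sup>2 + m2\<^sup>2) + 2 * (n1 * m1 + n2 * m2)"
        by (simp add: power2_eq_square algebra_simps)
      hence "(n1 + m1)\<^sup>2 + (n2 + m2)\<^sup>2 = 0" unfolding n by simp
      hence "n1 + m1 = 0" "n2 + m2 = 0" by (simp_all add: sum_power2_eq_zero_iff)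
      hence "k * z$1 = x + x'" "k * z$2 = y + y'"
        by (simp_all add: nd k_def algebra_simps)
      thus ?thesis using k by (simp add: p_def vec2_eq_iff field_simps)
    qed
    have "circle_poly v p = 0 \<and> circle_poly v' p = 0"
    proof -
      have kp: "k * p$1 = x + x'" "k * p$2 = y + y'" using k by (simp_all add: p_def)
      define n1 n2 where "n1 = b * p$1 - x" "n2 = b * p$2 - y"
      note nd = this
      have m: "b' * p$1 - x' = - n1" "b' * p$2 - y' = - n2"
        using kp by (simp_all add: nd k_def algebra_simps)
      \<comment> \<open>\<open>N\<close> measures how far \<open>p\<close> is from lying on the
        circles; the three relations for it combine to (b + b')^2 N = 0.\<close>
      define N where "N = n1\<^sup>2 + n2\<^sup>2 - 1"
      have N: "b * circle_poly v p = N" "b' * circle_poly v' p = N" "b * circle_poly v' p + b' * circle_poly v p = - 2 * N"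
        using normal_inner[of b p x b x y y c c] normal_inner[of b' p x' b' x' y' y' c' c']
          normal_inner[of b p x b' x' y y' c c'] v v' l
        unfolding m nd[symmetric] vv[symmetric] vv'[symmetric] N_def power2_eq_square by (simp, simp, argo)
      have "N * (b + b')\<^sup>2 = b\<^sup>2 * (b' * circle_poly v' p) + b'\<^sup>2 * (b * circle_poly v p) + 2 * (b * b') * N"
        unfolding N by (simp add: power2_eq_square algebra_simps)
      also have "\<dots> = b * b' * (b * circle_poly v' p + b' * circle_poly v p) + 2 * (b * b') * N"
        by (simp add: power2_eq_square algebra_simps)
      also have "\<dots> = 0" unfolding N by simp
      finally have "N = 0" using k by (simp add: k_def)
      thus ?thesis using N False by auto
    qed
    hence "fst (circle_of v) \<inter> fst (circle_of v') = {p}" using uniq by (auto simp: circle_of_def)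
    moreover have "\<not> (straight_line (fst (circle_of v)) \<and> straight_line (fst (circle_of v')))"
      using False v v' by (simp add: straight_line_circle_of) (simp add: vv vv')
    ultimately show ?thesis unfolding tangent_def by auto
  qed
qed

lemma circle_of_inj:
  assumes v: "lorentz v v = 1" and v': "lorentz v' v' = 1" and eq: "circle_of v = circle_of v'"
  shows "v = v'"
proof -
  have sgn: "circle_poly v z = 0 \<longleftrightarrow> circle_poly v' z = 0" "circle_poly v z < 0 \<longleftrightarrow> circle_poly v' z < 0" for z
    using eq by (auto simp: circle_of_def)
  have curved: "u = u'" if u: "lorentz u u = 1" and u': "lorentz u' u' = 1" and b0: "fst u \<noteq> 0"
    and bool_sign: "\<And>z. circle_poly u z = 0 \<longleftrightarrow> circle_poly u' z = 0" "\<And>z. circle_poly u z < 0 \<longleftrightarrow> circle_poly u' z < 0" for u u'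
  proof -
    obtain b c x y where uu: "u = (b, c, x, y)" by (cases u)
    obtain b' c' x' y' where uu': "u' = (b', c', x', y')" by (cases u')
    have b: "b \<noteq> 0" using b0 uu by simp
    define k where "k = b' / b"
    define X Y where "X = x / b" "Y = y / b"
    have xy: "x = b * X" "y = b * Y" "b' = k * b" using b by (simp_all add: X_Y_def k_def)
    have c: "c = b * (X\<^sup>2 + Y\<^sup>2) - 1 / b" using u b unfolding uu xy
      by (simp add: field_simps power2_eq_square)
    \<comment> \<open>Coordinates centred at the circle and scaled by 1 / b. Four points of the
      circle determine \<open>u'\<close> up to a factor; the centre and an outside point settle its
      sign.\<close>
    define P where "P s t = (vector [X + s / b, Y + t / b] :: real^2)" for s t
    have gP: "circle_poly u (P s t) = (s\<^sup>2 + t\<^sup>2 - 1) / b" for s t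
      using b unfolding uu xy c P_def by (simp add: field_simps power2_eq_square)
    have g': "circle_poly u' (P s t) = k * b * ((X + s / b)\<^sup>2 + (Y + t / b)\<^sup>2) - 2 * (x' * (X + s / b) + y' * (Y + t / b)) + c'" for s t
      by (simp add: uu' P_def xy)
    have z: "circle_poly u' (P 1 0) = 0" "circle_poly u' (P (-1) 0) = 0" "circle_poly u' (P 0 1) = 0" "circle_poly u' (P 0 (-1)) = 0"
      using gP by (simp_all add: bool_sign(1)[symmetric])
    have "circle_poly u' (P 1 0) - circle_poly u' (P (-1) 0) = 4 * (k * x - x') / b"
      "circle_poly u' (P 0 1) - circle_poly u' (P 0 (-1)) = 4 * (k * y - y') / b"
      using b unfolding g' xy by (simp_all add: field_simps power2_eq_square)
    hence x': "x' = k * x" and y': "y' = k * y" using z b by simp_all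
    have "circle_poly u' w = k * circle_poly u w + (c' - k * c)" for w
      by (simp add: uu uu' x' y' xy algebra_simps)
    hence c': "c' = k * c" using z(1) gP[of 1 0] by simp
    have uk: "u' = k *\<^sub>R u" by (simp add: uu uu' x' y' c' xy)
    hence "k * k = 1" using u u' by (simp add: lorentz_simps)
    moreover have "circle_poly u' w = k * circle_poly u w" for w unfolding uk by (simp add: uu algebra_simps)
    hence "circle_poly u' (P 0 0) = k * (- 1 / b)" "circle_poly u' (P 2 0) = k * (3 / b)" using gP by simp_all
    hence "k \<noteq> -1" using bool_sign(2)[of "P 0 0"] bool_sign(2)[of "P 2 0"] b gP[of 0 0] gP[of 2 0]
      by (auto simp: divide_less_0_iff zero_less_divide_iff)
    ultimately have "k = 1" using square_eq_1_iff by blast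
    thus ?thesis using uk by simp
  qed
  show ?thesis
  proof (cases "fst v = 0 \<and> fst v' = 0")
    case False
    thus ?thesis using curved[OF v v' _ sgn] curved[OF v' v _ sgn[symmetric]] by metis
  next
    case True
    obtain c x y where vv: "v = (0, c, x, y)" using True by (cases v) auto
    obtain c' x' y' where vv': "v' = (0, c', x', y')" using True by (cases v') auto
    have n: "x\<^sup>2 + y\<^sup>2 = 1" "x'\<^sup>2 + y'\<^sup>2 = 1" using v v' True vv vv' lorentz_zero_curv by simp_all
    \<comment> \<open>Here \<open>s\<close> runs along the normal and \<open>t\<close> along the
      line; two points on the line and one in the interior suffice.\<close>
    define P where "P s t = (vector [s * x - t * y, s * y + t * x] :: real^2)" for s t
    have "circle_poly v (P s t) = - 2 * s * (x\<^sup>2 + y\<^sup>2) + c" for s t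
      by (simp add: vv P_def algebra_simps power2_eq_square)
    hence g: "circle_poly v (P s t) = - 2 * s + c" for s t using n by simp
    define k h where "k = x * x' + y * y'" "h = x * y' - y * x'"
    have g': "circle_poly v' (P s t) = - 2 * (s * k + t * h) + c'" for s t
      by (simp add: vv' P_def k_h_def algebra_simps)
    have z: "circle_poly v' (P (c / 2) 0) = 0" "circle_poly v' (P (c / 2) 1) = 0" "circle_poly v' (P (c / 2 + 1) 0) < 0"
      unfolding sgn[symmetric] g by simp_all
    have h1: "c' = c * k" using z(1) unfolding g' by simp
    have h: "h = 0" using z(2) unfolding g' h1 by simp
    have "k > 0" using z(3) unfolding g' h1 h by (simp add: algebra_simps)
    note h = h h1 this
    have "k\<^sup>2 + h\<^sup>2 = (x\<^sup>2 + y\<^sup>2) * (x'\<^sup>2 + y'\<^sup>2)"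
      by (simp add: k_h_def power2_eq_square algebra_simps)
    hence k: "k = 1" using h n by (simp add: power2_eq_1_iff)
    have "(x - x')\<^sup>2 + (y - y')\<^sup>2 = (x\<^sup>2 + y\<^sup>2) + (x'\<^sup>2 + y'\<^sup>2) - 2 * k"
      by (simp add: k_h_def power2_eq_square algebra_simps)
    hence "x = x'" "y = y'" using n k by (simp_all add: sum_power2_eq_zero_iff)
    thus ?thesis using h k vv vv' by simp
  qed
qed

lemma not_tangent_self:
  assumes "oriented_circle C"
  shows "\<not> tangent C C"
proof (cases "straight_line (fst C)")
  case True
  then obtain n k where n: "n \<noteq> 0" "fst C = {x. n \<bullet> x = k}" unfolding straight_line_def by blast
  hence "(k / (n \<bullet> n)) *\<^sub>R n \<in> fst C" by simp
  thus ?thesis using True unfolding tangent_def by auto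
next
  case False
  then obtain z r where z: "r > 0" "fst C = sphere z r"
    using assms unfolding oriented_circle_def euclidean_circle_def by blast
  hence "z + vector [r, 0] \<in> fst C" "z - vector [r, 0] \<in> fst C"
    by (simp_all add: dist_norm norm_vec_def L2_set_def sum_2)
  moreover have "z + vector [r, 0] \<noteq> z - vector [r, 0]" using z by (auto simp: vec2_eq_iff)
  ultimately show ?thesis using False unfolding tangent_def by auto
qed

section \<open>Generated packings as least closed sets\<close>

lemma inscribed_circles_mono:
  assumes "P \<subseteq> P'"
  shows "inscribed_circles P \<subseteq> inscribed_circles P'"
proof
  fix C assume "C \<in> inscribed_circles P"
  then obtain C1 C2 C3 where C: "C1 \<in> P" "C2 \<in> P" "C3 \<in> P" "oriented_circle C"
    "mutually_tangent C1 C2 C3" "\<forall>D\<in>{C1, C2, C3}. tangent C D \<and> disjnt (snd C) (snd D)"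
    unfolding inscribed_circles_def mem_Collect_eq by blast
  show "C \<in> inscribed_circles P'"
    unfolding inscribed_circles_def mem_Collect_eq
    using C(4-6) subsetD[OF assms C(1)] subsetD[OF assms C(2)] subsetD[OF assms C(3)] by metis
qed

lemma generated_packing_closed: "inscribed_circles (generated_packing P0) \<subseteq> generated_packing P0"
proof
  let ?S = "\<lambda>n. ((\<lambda>P. P \<union> inscribed_circles P) ^^ n) P0"
  have mono: "?S n \<subseteq> ?S m" if "n \<le> m" for n m
    using that by (induction rule: dec_induct) auto
  fix C assume "C \<in> inscribed_circles (generated_packing P0)"
  then obtain C1 C2 C3 where C: "C1 \<in> generated_packing P0" "C2 \<in> generated_packing P0"
    "C3 \<in> generated_packing P0" "oriented_circle C" "mutually_tangent C1 C2 C3"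
    "\<forall>D\<in>{C1, C2, C3}. tangent C D \<and> disjnt (snd C) (snd D)"
    unfolding inscribed_circles_def mem_Collect_eq by blast
  hence I: "C \<in> inscribed_circles {C1, C2, C3}"
    unfolding inscribed_circles_def mem_Collect_eq
    by (intro conjI bexI[of _ C1] bexI[of _ C2] bexI[of _ C3]) simp_all
  from C(1-3) obtain a b c where "C1 \<in> ?S a" "C2 \<in> ?S b" "C3 \<in> ?S c"
    unfolding generated_packing_def by blast
  hence "{C1, C2, C3} \<subseteq> ?S (a + b + c)"
    using mono[of a "a + b + c"] mono[of b "a + b + c"] mono[of c "a + b + c"] by auto
  hence "C \<in> ?S (Suc (a + b + c))" using I inscribed_circles_mono[of "{C1, C2, C3}"] by auto
  thus "C \<in> generated_packing P0" unfolding generated_packing_def by blast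
qed

lemma generated_packing_least:
  assumes "P0 \<subseteq> P" "inscribed_circles P \<subseteq> P"
  shows "generated_packing P0 \<subseteq> P"
proof -
  have "((\<lambda>P. P \<union> inscribed_circles P) ^^ n) P0 \<subseteq> P" for n
  proof (induction n)
    case (Suc n)
    thus ?case using inscribed_circles_mono[OF Suc] assms(2) by simp
  qed (use assms in simp)
  thus ?thesis unfolding generated_packing_def by blast
qed

lemma base_subset_generated_packing: "P0 \<subseteq> generated_packing P0"
  unfolding generated_packing_def 
  using UN_upper[of 0 UNIV "\<lambda>n. ((\<lambda>P. P \<union> inscribed_circles P) ^^ n) P0"] by simp

context
  fixes q :: "nat \<Rightarrow> cvec"
  assumes q: "descartes q"
    and sep: "\<And>v v'. v \<in> orbit_vecs q \<Longrightarrow> v' \<in> orbit_vecs q \<Longrightarrow> v \<noteq> v' \<Longrightarrow> separable v v'"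
begin

lemma orbit_vecs_tangent_iff:
  assumes "v \<in> orbit_vecs q" "v' \<in> orbit_vecs q"
  shows "tangent (circle_of v) (circle_of v') \<longleftrightarrow> lorentz v v' = -1"
proof
  assume t: "tangent (circle_of v) (circle_of v')"
  hence "v \<noteq> v'" using not_tangent_self oriented_circle_circle_of orbit_vecs_lorentz_self[OF q] assms by blast
  hence "lorentz v v' \<le> -1" using orbit_vecs_lorentz[OF q] assms by blast
  thus "lorentz v v' = -1" 
    using tangent_lorentz[OF orbit_vecs_lorentz_self[OF q assms(1)] orbit_vecs_lorentz_self[OF q assms(2)] t] by linarith
next
  assume "lorentz v v' = -1"
  thus "tangent (circle_of v) (circle_of v')"
    using orbit_vecs_tangent_neq[OF q] orbit_vecs_lorentz_self[OF q] assms by (intro lorentz_tangent sep) auto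
qed

lemma orbit_vecs_disjnt:
  assumes "v \<in> orbit_vecs q" "v' \<in> orbit_vecs q" "v \<noteq> v'"
  shows "disjnt (snd (circle_of v)) (snd (circle_of v'))"
  using assms orbit_vecs_lorentz[OF q] orbit_vecs_lorentz_self[OF q] by (intro lorentz_disjoint sep) auto

lemma inscribed_circles_orbit_vecs: "inscribed_circles (circle_of ` orbit_vecs q) \<subseteq> circle_of ` orbit_vecs q"
proof
  fix C assume "C \<in> inscribed_circles (circle_of ` orbit_vecs q)"
  then obtain v1 v2 v3 where C: "oriented_circle C" and v: "v1 \<in> orbit_vecs q" "v2 \<in> orbit_vecs q" "v3 \<in> orbit_vecs q"
    and m: "mutually_tangent (circle_of v1) (circle_of v2) (circle_of v3)"
    and t: "\<forall>D\<in>{circle_of v1, circle_of v2, circle_of v3}. tangent C D \<and> disjnt (snd C) (snd D)"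
    unfolding inscribed_circles_def by auto
  obtain v where vC: "lorentz v v = 1" "C = circle_of v" using oriented_circle_imp_circle_of[OF C] by blast
  \<comment> \<open>The new circle is not yet known to be in the orbit, so its products come from
    geometry: tangency leaves 1 and -1, and disjoint interiors exclude 1.\<close>
  have "lorentz v v1 = -1" "lorentz v v2 = -1" "lorentz v v3 = -1"
    using t vC v orbit_vecs_lorentz_self[OF q] tangent_disjoint_lorentz by simp_all
  hence "v \<in> orbit_vecs q"
    using orbit_vecs_closed[OF q v] m v vC(1) by (auto simp: mutually_tangent_def orbit_vecs_tangent_iff)
  thus "C \<in> circle_of ` orbit_vecs q" using vC by blast
qed

text \<open>The fourth entry of \<open>q\<close> is inscribed in the three given ones, and every
  move creates a circle inscribed in the three entries that it keeps.\<close>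

lemma orbit_vecs_subset_closed:
  assumes P: "inscribed_circles P \<subseteq> P" "circle_of (q 0) \<in> P" "circle_of (q 1) \<in> P" "circle_of (q 2) \<in> P"
  shows "circle_of ` orbit_vecs q \<subseteq> P"
proof -
  have new: "circle_of (r i) \<in> P"
    if w: "set w \<subseteq> {..<4}" "r = moves q w" "i < 4" and o: "\<And>j. j < 4 \<Longrightarrow> j \<noteq> i \<Longrightarrow> circle_of (r j) \<in> P"
    for r w i
  proof -
    have r: "r j \<in> orbit_vecs q" if "j < 4" for j using w that unfolding orbit_vecs_def by blast
    have d: "descartes r" using w descartes_moves q by simp
    have tj: "tangent (circle_of (r j)) (circle_of (r k)) \<and> disjnt (snd (circle_of (r j))) (snd (circle_of (r k)))"
      if "j < 4" "k < 4" "j \<noteq> k" for j k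
      using that d r orbit_vecs_disjnt orbit_vecs_tangent_iff descartes_inj unfolding descartes_def by (metis (full_types))
    obtain j k l where jkl: "j < 4" "k < 4" "l < 4" "j \<noteq> k" "j \<noteq> l" "k \<noteq> l" "i \<noteq> j" "i \<noteq> k" "i \<noteq> l"
    proof -
      consider "i = 0" | "i = 1" | "i = 2" | "i = 3" using w(3) by (auto simp: less_4_iff)
      thus thesis
        by cases (use that[of 1 2 3] in simp, use that[of 0 2 3] in simp,
          use that[of 0 1 3] in simp, use that[of 0 1 2] in simp)
    qed
    have "circle_of (r i) \<in> inscribed_circles P"
      unfolding inscribed_circles_def mem_Collect_eq
    proof (intro conjI bexI)
      show "oriented_circle (circle_of (r i))"
        using d w(3) by (intro oriented_circle_circle_of) (auto simp: descartes_def)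
      show "mutually_tangent (circle_of (r j)) (circle_of (r k)) (circle_of (r l))"
        using tj jkl by (simp add: mutually_tangent_def)
      show "\<forall>D\<in>{circle_of (r j), circle_of (r k), circle_of (r l)}. tangent (circle_of (r i)) D \<and> disjnt (snd (circle_of (r i))) (snd D)"
        using tj jkl w(3) by simp
    qed (use o jkl in auto)
    thus ?thesis using P(1) by blast
  qed
  have "\<forall>k<4. circle_of (moves q w k) \<in> P" if "set w \<subseteq> {..<4}" for w
    using that
  proof (induction w rule: rev_induct)
    case Nil
    have *: "circle_of (q j) \<in> P" if "j < 4" "j \<noteq> 3" for j
      using that P(2-4) less_4_iff[of j] by metis
    moreover have "circle_of (q 3) \<in> P" by (rule new[of "[]"]) (use * in simp_all)
    ultimately show ?case by (metis moves_simps(1))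
  next
    case (snoc i w)
    let ?r = "moves q (w @ [i])"
    have e: "?r j = moves q w j" if "j \<noteq> i" for j using that by (simp add: move_def)
    have w: "set w \<subseteq> {..<4}" "i < 4" using snoc.prems by auto
    have o: "circle_of (?r j) \<in> P" if "j < 4" "j \<noteq> i" for j
      using snoc.IH[OF w(1)] e[OF that(2)] that(1) by metis
    have "circle_of (?r i) \<in> P" by (rule new[OF snoc.prems refl w(2) o])
    thus ?case using o by metis
  qed
  thus ?thesis unfolding orbit_vecs_def by blast
qed

theorem generated_packing_orbit_vecs:
  "generated_packing {circle_of (q 0), circle_of (q 1), circle_of (q 2)} = circle_of ` orbit_vecs q"
proof
  have "q i \<in> orbit_vecs q" if "i < 4" for i
    using that unfolding orbit_vecs_def by (intro CollectI exI[of _ "[]"] exI[of _ i]) auto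
  thus "generated_packing {circle_of (q 0), circle_of (q 1), circle_of (q 2)} \<subseteq> circle_of ` orbit_vecs q"
    using inscribed_circles_orbit_vecs by (intro generated_packing_least) auto
  show "circle_of ` orbit_vecs q \<subseteq> generated_packing {circle_of (q 0), circle_of (q 1), circle_of (q 2)}"
    using generated_packing_closed base_subset_generated_packing[of "{circle_of (q 0), circle_of (q 1), circle_of (q 2)}"]
    by (intro orbit_vecs_subset_closed) auto
qed

lemma apollonian_packing_orbit_vecs: "apollonian_packing (circle_of ` orbit_vecs q)"
proof -
  have qi: "q i \<in> orbit_vecs q" if "i < 4" for i
    using that unfolding orbit_vecs_def by (intro CollectI exI[of _ "[]"] exI[of _ i]) auto
  have "mutually_tangent (circle_of (q 0)) (circle_of (q 1)) (circle_of (q 2))"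
    using q qi by (simp add: mutually_tangent_def orbit_vecs_tangent_iff descartes_def)
  hence "\<exists>C1\<in>circle_of ` orbit_vecs q. \<exists>C2\<in>circle_of ` orbit_vecs q. \<exists>C3\<in>circle_of ` orbit_vecs q. mutually_tangent C1 C2 C3"
    using qi by (metis image_eqI zero_less_numeral one_less_numeral_iff numeral_less_iff semiring_norm(76,78,81))
  moreover have "pairwise (\<lambda>C D. disjnt (snd C) (snd D)) (circle_of ` orbit_vecs q)"
    unfolding pairwise_def using orbit_vecs_disjnt by (metis imageE)
  ultimately show ?thesis
    unfolding apollonian_packing_def
    using oriented_circle_circle_of orbit_vecs_lorentz_self[OF q] inscribed_circles_orbit_vecs by auto
qed

end

section \<open>Ford circles\<close>

text \<open>The sum of the entries is symmetric, so relabelling the entries merely relabels the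
  moves.\<close>

lemma move_perm:
  assumes "p permutes {..<4}"
  shows "move i (q \<circ> p) = move (p i) q \<circ> p"
proof -
  have sum4: "(\<Sum>i<4. f i) = f 0 + f 1 + f 2 + f 3" for f :: "nat \<Rightarrow> 'a"
    by (simp add: eval_nat_numeral)
  have "(\<Sum>i<4. (q \<circ> p) i) = (\<Sum>i<4. q i)" using sum.permute[OF assms, of q] by (simp add: comp_def)
  thus ?thesis unfolding move_def sum4
    using permutes_inj[OF assms] by (auto simp: fun_eq_iff inj_eq)
qed

lemma moves_perm: "p permutes {..<4} \<Longrightarrow> moves (q \<circ> p) w = moves q (map p w) \<circ> p"
  by (induction w arbitrary: q) (auto simp: move_perm)

lemma orbit_vecs_perm:
  assumes "p permutes {..<4}"
  shows "orbit_vecs (q \<circ> p) = orbit_vecs q"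
proof -
  have *: "orbit_vecs (q \<circ> p) \<subseteq> orbit_vecs q" if p: "p permutes {..<4}" for p :: "nat \<Rightarrow> nat" and q
  proof
    fix v assume "v \<in> orbit_vecs (q \<circ> p)"
    then obtain w k where w: "set w \<subseteq> {..<4}" "k < 4" "v = moves (q \<circ> p) w k"
      unfolding orbit_vecs_def by blast
    have "v = moves q (map p w) (p k)" using w p by (simp add: moves_perm)
    moreover have "set (map p w) \<subseteq> {..<4}" "p k < 4"
      using w permutes_image[OF p] by (auto simp: permutes_in_image[OF p, simplified])
    ultimately show "v \<in> orbit_vecs q" unfolding orbit_vecs_def by blast
  qed
  have "q = (q \<circ> p) \<circ> inv_into UNIV p" using permutes_inv_o[OF assms] by (simp add: o_assoc [symmetric])
  hence "orbit_vecs q \<subseteq> orbit_vecs (q \<circ> p)" using *[OF permutes_inv[OF assms], of "q \<circ> p"] by metis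
  thus ?thesis using *[OF assms] by blast
qed

text \<open>Euclidean algorithm on the first coordinates.\<close>

lemma unimodular_invariant:
  fixes G :: "int \<Rightarrow> int \<Rightarrow> int \<Rightarrow> int \<Rightarrow> 'a"
  assumes swap: "\<And>m n m' n'. G m n m' n' = G m' n' m n"
    and neg: "\<And>m n m' n'. G m n m' n' = G m n (- m') (- n')"
    and add: "\<And>m n m' n'. G m n m' n' = G m n (m' + m) (n' + n)"
    and det: "(m * n' - m' * n)\<^sup>2 = 1"
  shows "G m n m' n' = G 1 0 0 1"
  using det
proof (induction "nat (\<bar>m\<bar> + \<bar>m'\<bar>)" arbitrary: m n m' n' rule: less_induct)
  case less
  have sub: "G m n m' n' = G m n (m' - m) (n' - n)" for m n m' n'
    using add[of m n "m' - m" "n' - n"] by simp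
  have col: "G 1 k 0 1 = G 1 0 0 1" for k :: int
  proof (induction k rule: int_induct[where k = 0])
    case (step1 i)
    thus ?case using add[of 0 1 1 i] swap by simp
  next
    case (step2 i)
    thus ?case using sub[of 0 1 1 i] swap by simp
  qed simp
  have neg1: "G m n m' n' = G (- m) (- n) m' n'" for m n m' n'
    using neg swap by metis
  have zero: "G m n 0 n' = G 1 0 0 1" if "(m * n')\<^sup>2 = 1" for m n n'
  proof -
    have "m * n' = 1 \<or> m * n' = -1" using that by (simp add: power2_eq_1_iff)
    hence "(m = 1 \<or> m = -1) \<and> (n' = 1 \<or> n' = -1)"
      by (metis zmult_eq_1_iff mult_minus_left minus_minus)
    then consider "m = 1" "n' = 1" | "m = 1" "n' = -1" | "m = -1" "n' = 1" | "m = -1" "n' = -1"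
      by blast
    thus ?thesis
    proof cases
      case 1 thus ?thesis using col[of n] by simp
    next
      case 2 thus ?thesis using neg[of 1 n 0 1] col[of n] by simp
    next
      case 3 thus ?thesis using neg1[of 1 "- n" 0 1] col[of "- n"] by simp
    next
      case 4 thus ?thesis using neg1[of 1 "- n" 0 "-1"] neg[of 1 "- n" 0 1] col[of "- n"] by simp
    qed
  qed
  have det': "(m' * n - m * n')\<^sup>2 = 1" using less.prems by (simp add: power2_commute)
  \<comment> \<open>If neither first coordinate is 0, adding or subtracting the one of smaller
    absolute value shortens the other.\<close>
  consider "m' = 0" | "m = 0" | "m \<noteq> 0" "m' \<noteq> 0" "\<bar>m - m'\<bar> < \<bar>m\<bar>" | "m \<noteq> 0" "m' \<noteq> 0" "\<bar>m + m'\<bar> < \<bar>m\<bar>"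
    | "m \<noteq> 0" "m' \<noteq> 0" "\<bar>m' - m\<bar> < \<bar>m'\<bar>" | "m \<noteq> 0" "m' \<noteq> 0" "\<bar>m' + m\<bar> < \<bar>m'\<bar>"
    by linarith
  thus ?case
  proof cases
    case 1 thus ?thesis using zero[of m n' n] less.prems by simp
  next
    case 2 thus ?thesis using zero[of m' n n'] det' swap by simp
  next
    case 3
    have "G (m - m') (n - n') m' n' = G 1 0 0 1"
      using 3 less.prems by (intro less.hyps) (auto simp: algebra_simps)
    thus ?thesis using sub[of m' n' m n] swap by metis
  next
    case 4
    have "G (m + m') (n + n') m' n' = G 1 0 0 1"
      using 4 less.prems by (intro less.hyps) (auto simp: algebra_simps)
    thus ?thesis using add[of m' n' m n] swap by metis
  next
    case 5
    have "G m n (m' - m) (n' - n) = G 1 0 0 1"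
      using 5 less.prems by (intro less.hyps) (auto simp: algebra_simps)
    thus ?thesis using sub[of m n m' n'] by metis
  next
    case 6
    have "G m n (m' + m) (n' + n) = G 1 0 0 1"
      using 6 less.prems by (intro less.hyps) (auto simp: algebra_simps)
    thus ?thesis using add[of m n m' n'] by metis
  qed
qed

section \<open>The Ford family and its quadruples\<close>

definition vec_L :: cvec where "vec_L = (0, 0, 0, -1)"

text \<open>The circle of curvature \<open>(m\<alpha> + n)\<^sup>2\<close> tangent to the \<open>x\<close>-axis from above at
  \<open>2n / (\<alpha>(m\<alpha> + n))\<close>: these are the images of the Ford circles.\<close>

definition ford :: "real \<Rightarrow> int \<Rightarrow> int \<Rightarrow> cvec" where
  "ford \<alpha> m n = ((of_int m * \<alpha> + of_int n)\<^sup>2, 4 * (of_int n)\<^sup>2 / \<alpha>\<^sup>2,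
     2 / \<alpha> * of_int n * (of_int m * \<alpha> + of_int n), 1)"

text \<open>Entry 3 belongs to the mediant of the two pairs. The value beyond index 3 is independent
  of the parameters, so identities between quadruples can be stated as equalities of
  functions.\<close>

definition ford_quad :: "real \<Rightarrow> int \<Rightarrow> int \<Rightarrow> int \<Rightarrow> int \<Rightarrow> nat \<Rightarrow> cvec" where
  "ford_quad \<alpha> m n m' n' i = (if i = 0 then ford \<alpha> m n else if i = 1 then ford \<alpha> m' n' else
     if i = 2 then vec_L else if i = 3 then ford \<alpha> (m + m') (n + n') else 0)"

lemma ford_minus [simp]: "ford \<alpha> (- m) (- n) = ford \<alpha> m n"
  by (simp add: ford_def power2_eq_square algebra_simps) (subst minus_divide_left, simp)

text \<open>The first three coordinates of \<open>ford\<close> are quadratic forms in (m, n) and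
  obey the parallelogram law; \<open>vec_L\<close> corrects the constant last coordinate. For
  neighbouring Ford circles, mediant and difference are thus the two circles inscribed between them
  and the axis.\<close>

lemma ford_parallelogram:
  "ford \<alpha> (m - m') (n - n') = 2 *\<^sub>R (ford \<alpha> m n + ford \<alpha> m' n' + vec_L) - ford \<alpha> (m + m') (n + n')"
  by (simp add: ford_def vec_L_def power2_eq_square algebra_simps divide_inverse)

text \<open>Only move 2 disturbs the axis. The signs on the right are chosen so that slot 3 again
  belongs to the sum of the two pairs.\<close>

lemma move_ford_quad:
  "move 3 (ford_quad \<alpha> m n m' n') = ford_quad \<alpha> m n (- m') (- n')"
  "move 0 (ford_quad \<alpha> m n m' n') = ford_quad \<alpha> (m + 2 * m') (n + 2 * n') (- m') (- n')"
  "move 1 (ford_quad \<alpha> m n m' n') = ford_quad \<alpha> (- m) (- n) (2 * m + m') (2 * n + n')"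
proof -
  have *: "move i q = q(i := u)" if "u + 3 *\<^sub>R q i = 2 *\<^sub>R (q 0 + q 1 + q 2 + q 3)"
    for i u and q :: "nat \<Rightarrow> cvec"
    using that by (auto simp: move_def fun_eq_iff algebra_simps)
  have 1: "m + 2 * m' = (m + m') - (- m')" "n + 2 * n' = (n + n') - (- n')"
    "2 * m + m' = (m + m') - (- m)" "2 * n + n' = (n + n') - (- n)"
    "m + m' + (- m') = m" "n + n' + (- n') = n" "m + m' + (- m) = m'" "n + n' + (- n) = n'"
    by simp_all
  show "move 3 (ford_quad \<alpha> m n m' n') = ford_quad \<alpha> m n (- m') (- n')"
    using ford_parallelogram[of \<alpha> m m' n n']
    by (subst *[of "ford \<alpha> (m - m') (n - n')"])
      (auto simp: ford_quad_def fun_eq_iff scaleR_2 scaleR_3 algebra_simps)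
  show "move 0 (ford_quad \<alpha> m n m' n') = ford_quad \<alpha> (m + 2 * m') (n + 2 * n') (- m') (- n')"
    using ford_parallelogram[of \<alpha> "m + m'" "- m'" "n + n'" "- n'"]
    by (subst *[of "ford \<alpha> (m + 2 * m') (n + 2 * n')"])
      (auto simp: ford_quad_def fun_eq_iff scaleR_2 scaleR_3 algebra_simps)
  show "move 1 (ford_quad \<alpha> m n m' n') = ford_quad \<alpha> (- m) (- n) (2 * m + m') (2 * n + n')"
    using ford_parallelogram[of \<alpha> "m + m'" "- m" "n + n'" "- n"]
    by (subst *[of "ford \<alpha> (2 * m + m') (2 * n + n')"])
      (auto simp: ford_quad_def fun_eq_iff scaleR_2 scaleR_3 algebra_simps)
qed

lemma moves_single_orbit_vecs: "i < 4 \<Longrightarrow> orbit_vecs (move i q) = orbit_vecs q"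
  using orbit_vecs_moves[of "[i]" q] by simp

text \<open>Elementary operations on bases of Z^2 become changes of quadruple within the orbit: a
  swap relabels entries 0 and 1, a negation is move 3, and an addition relabels entries 1 and 3 up
  to signs.\<close>

lemma orbit_vecs_ford_quad:
  assumes "(m * n' - m' * n)\<^sup>2 = 1"
  shows "orbit_vecs (ford_quad \<alpha> m n m' n') = orbit_vecs (ford_quad \<alpha> 1 0 0 1)"
proof (rule unimodular_invariant[OF _ _ _ assms])
  fix m n m' n' :: int
  have "ford_quad \<alpha> m n m' n' = ford_quad \<alpha> m' n' m n \<circ> Transposition.transpose 0 1" for m n m' n'
    by (auto simp: ford_quad_def fun_eq_iff transpose_def add.commute)
  moreover have "Transposition.transpose 0 (1::nat) permutes {..<4}" by (rule permutes_swap_id) auto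
  ultimately show swap: "orbit_vecs (ford_quad \<alpha> m n m' n') = orbit_vecs (ford_quad \<alpha> m' n' m n)" for m n m' n'
    using orbit_vecs_perm by metis
  show neg: "orbit_vecs (ford_quad \<alpha> m n m' n') = orbit_vecs (ford_quad \<alpha> m n (- m') (- n'))" for m n m' n'
    using moves_single_orbit_vecs[of 3] move_ford_quad(1) by (metis less_4_iff)
  have "ford_quad \<alpha> (- m) (- n) (m' + m) (n' + n) = ford_quad \<alpha> m n m' n' \<circ> Transposition.transpose 1 3"
    by (auto simp: ford_quad_def fun_eq_iff transpose_def add.commute)
  moreover have "Transposition.transpose 1 (3::nat) permutes {..<4}" by (rule permutes_swap_id) auto
  ultimately have "orbit_vecs (ford_quad \<alpha> (- m) (- n) (m' + m) (n' + n)) = orbit_vecs (ford_quad \<alpha> m n m' n')"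
    using orbit_vecs_perm by metis
  thus "orbit_vecs (ford_quad \<alpha> m n m' n') = orbit_vecs (ford_quad \<alpha> m n (m' + m) (n' + n))"
    using neg swap by metis
qed

lemma lorentz_vec_L [simp]: "lorentz vec_L vec_L = 1" "lorentz (ford \<alpha> m n) vec_L = -1" "lorentz vec_L (ford \<alpha> m n) = -1"
  "lorentz (b, c, x, y) vec_L = - y"
  by (simp_all add: vec_L_def ford_def)

lemma vec_L_in_orbit_vecs_ford_quad: "vec_L \<in> orbit_vecs (ford_quad \<alpha> m n m' n')"
  and ford_in_orbit_vecs_ford_quad: "ford \<alpha> m n \<in> orbit_vecs (ford_quad \<alpha> m n m' n')" "ford \<alpha> m' n' \<in> orbit_vecs (ford_quad \<alpha> m n m' n')"
proof -
  have *: "ford_quad \<alpha> m n m' n' i \<in> orbit_vecs (ford_quad \<alpha> m n m' n')" if "i < 4" for i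
    using that unfolding orbit_vecs_def by (intro CollectI exI[of _ "[]"] exI[of _ i]) auto
  show "vec_L \<in> orbit_vecs (ford_quad \<alpha> m n m' n')" "ford \<alpha> m n \<in> orbit_vecs (ford_quad \<alpha> m n m' n')" "ford \<alpha> m' n' \<in> orbit_vecs (ford_quad \<alpha> m n m' n')"
    using *[of 0] *[of 1] *[of 2] by (simp_all add: ford_quad_def)
qed

definition packing_vecs :: "real \<Rightarrow> cvec set" where "packing_vecs \<alpha> = orbit_vecs (ford_quad \<alpha> 1 0 0 1)"

lemma vec_L_in_packing_vecs: "vec_L \<in> packing_vecs \<alpha>"
  unfolding packing_vecs_def by (rule vec_L_in_orbit_vecs_ford_quad)

lemma ford_in_packing_vecs:
  assumes "coprime m n"
  shows "ford \<alpha> m n \<in> packing_vecs \<alpha>"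
proof -
  obtain u v where "m * u + n * v = 1" using assms bezout_int[of m n] by (auto simp: algebra_simps)
  hence "(m * u - (- v) * n)\<^sup>2 = 1" by (simp add: algebra_simps)
  thus ?thesis using orbit_vecs_ford_quad ford_in_orbit_vecs_ford_quad unfolding packing_vecs_def by metis
qed

context
  fixes \<alpha> :: real
  assumes \<alpha>: "\<alpha> > 0"
begin

text \<open>Product -1 therefore means that the two integer pairs form a basis of Z^2.\<close>

lemma lorentz_ford: "lorentz (ford \<alpha> m n) (ford \<alpha> m' n') = 1 - 2 * (of_int (m * n' - m' * n))\<^sup>2"
  using \<alpha> by (simp add: ford_def field_simps power2_eq_square)

lemma descartes_ford_quad:
  assumes "(m * n' - m' * n)\<^sup>2 = 1"
  shows "descartes (ford_quad \<alpha> m n m' n')"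
proof -
  define e where "e = m * n' - m' * n"
  have e: "m * n' = m' * n + e" "e\<^sup>2 = 1" using assms by (simp_all add: e_def)
  have l: "lorentz (ford \<alpha> a b) (ford \<alpha> c d) = -1" if "(a * d - c * b)\<^sup>2 = 1" for a b c d
    unfolding lorentz_ford using arg_cong[OF that, of real_of_int] by simp
  have "(m * n' - m' * n)\<^sup>2 = 1" "(m' * n - m * n')\<^sup>2 = 1"
    "(m * (n + n') - (m + m') * n)\<^sup>2 = 1" "((m + m') * n - m * (n + n'))\<^sup>2 = 1"
    "(m' * (n + n') - (m + m') * n')\<^sup>2 = 1" "((m + m') * n' - m' * (n + n'))\<^sup>2 = 1"
    using e by (simp_all add: algebra_simps)
  note d = this[THEN l]
  have "lorentz (ford \<alpha> a b) (ford \<alpha> a b) = 1" for a b unfolding lorentz_ford by simp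
  thus ?thesis
    unfolding descartes_def all_less_4_iff ford_quad_def by (simp add: d)
qed

lemmas descartes_std = descartes_ford_quad[of 1 1 0 0, simplified]

lemma packing_vecs_lorentz_self: "v \<in> packing_vecs \<alpha> \<Longrightarrow> lorentz v v = 1"
  unfolding packing_vecs_def by (rule orbit_vecs_lorentz_self[OF descartes_std])

lemma packing_vecs_lorentz: "v \<in> packing_vecs \<alpha> \<Longrightarrow> v' \<in> packing_vecs \<alpha> \<Longrightarrow> v \<noteq> v' \<Longrightarrow> lorentz v v' \<le> -1"
  unfolding packing_vecs_def by (rule orbit_vecs_lorentz[OF descartes_std])

text \<open>A reduced word that leads to a circle touching the axis never uses the letter 2, and the
  other three letters turn Ford quadruples of unimodular pairs into such quadruples.\<close>

lemma tangent_to_L: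
  assumes "v \<in> packing_vecs \<alpha>" "lorentz v vec_L = -1"
  obtains m n where "coprime m n" "v = ford \<alpha> m n"
proof -
  have *: "\<exists>m n m' n'. (m * n' - m' * n)\<^sup>2 = 1 \<and> moves (ford_quad \<alpha> a b c d) w = ford_quad \<alpha> m n m' n'"
    if "set w \<subseteq> {..<4}" "2 \<notin> set w" "(a * d - c * b)\<^sup>2 = 1" for w a b c d
    using that
  proof (induction w arbitrary: a b c d)
    case (Cons i w)
    have "i = 0 \<or> i = 1 \<or> i = 3" using Cons.prems less_4_iff[of i] by auto
    then obtain a' b' c' d' where "move i (ford_quad \<alpha> a b c d) = ford_quad \<alpha> a' b' c' d'" "(a' * d' - c' * b')\<^sup>2 = 1"
    proof (elim disjE)
      assume "i = 0" thus thesis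
        using that[of "a + 2 * c" "b + 2 * d" "- c" "- d"] Cons.prems(3) move_ford_quad(2)
        by (simp add: power2_eq_square algebra_simps)
    next
      assume "i = 1" thus thesis
        using that[of "- a" "- b" "2 * a + c" "2 * b + d"] Cons.prems(3) move_ford_quad(3)
        by (simp add: power2_eq_square algebra_simps)
    next
      assume "i = 3" thus thesis
        using that[of "a" "b" "- c" "- d"] Cons.prems(3) move_ford_quad(1)
        by (simp add: power2_eq_square algebra_simps)
    qed
    thus ?case using Cons.IH Cons.prems by auto
  qed auto
  have cop: "coprime m n \<and> coprime m' n' \<and> coprime (m + m') (n + n')" if "(m * n' - m' * n)\<^sup>2 = 1"
    for m n m' n' :: int
  proof -
    have c: "coprime a b" if "(a * d - c * b)\<^sup>2 = 1" for a b c d :: int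
    proof (rule coprimeI)
      fix e assume "e dvd a" "e dvd b"
      hence "e dvd (a * d - c * b)\<^sup>2" by (simp add: power2_eq_square)
      thus "is_unit e" using that by simp
    qed
    show ?thesis using c[of m n' m' n] c[of m' n m n'] c[of "m + m'" n' m' "n + n'"] that
      by (simp add: power2_commute algebra_simps)
  qed
  have fin: thesis if "(m * n' - m' * n)\<^sup>2 = 1" "v = ford_quad \<alpha> m n m' n' k" "k < 4" for m n m' n' k
    using cop[OF that(1)] that(2,3) \<open>lorentz v vec_L = -1\<close>
      \<open>\<And>m n. coprime m n \<Longrightarrow> v = ford \<alpha> m n \<Longrightarrow> thesis\<close>
    unfolding less_4_iff ford_quad_def by (auto split: if_splits)
  from assms(1)[unfolded packing_vecs_def] show thesis
  proof (cases rule: orbit_vecs_reduced)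
    case (1 k)
    thus thesis using fin[of 1 1 0 0 k] by simp
  next
    case (2 u)
    have "2 \<notin> set u"
      using reduced_tangent_notin[OF descartes_std _ 2(2,3,1), of 2] 2(4) assms(2)
      by (simp add: ford_quad_def)
    then obtain m n m' n' where "(m * n' - m' * n)\<^sup>2 = 1" "moves (ford_quad \<alpha> 1 0 0 1) u = ford_quad \<alpha> m n m' n'"
      using *[of u 1 1 0 0] 2(3) by auto
    moreover have "last u < 4" using 2 last_in_set by blast
    ultimately show thesis using fin 2(4) by metis
  qed
qed

text \<open>Products of at most -1 with the axis and with X bound \<open>y\<close> and
  \<open>c\<close> from below, and the norm x^2 + y^2 - b c = 1 then fixes the sign of
  \<open>b\<close>. So no circle encloses the others, and any further line is horizontal, at height
  at least 2 / \<alpha>^2.\<close>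

lemma packing_vecs_cases:
  assumes "v \<in> packing_vecs \<alpha>"
  obtains "v = vec_L"
  | b c x y where "v = (b, c, x, y)" "b > 0" "c \<ge> 0" "y \<ge> 1"
  | c where "v = (0, c, 0, 1)" "c \<ge> 4 / \<alpha>\<^sup>2"
proof -
  obtain b c x y where v: "v = (b, c, x, y)" by (cases v)
  consider "v = vec_L" | "v \<noteq> vec_L" by blast
  thus thesis
  proof cases
    case 2
    have y: "y \<ge> 1" using packing_vecs_lorentz[OF assms vec_L_in_packing_vecs 2] by (simp add: v)
    have n: "x\<^sup>2 + y\<^sup>2 - b * c = 1" using packing_vecs_lorentz_self[OF assms] v by (simp add: power2_eq_square)
    have "1 \<le> y\<^sup>2" using y by (metis one_power2 power_mono zero_le_one)
    hence bc1: "b * c \<ge> 0" using n zero_le_power2[of x] by linarith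
    have bc2: "x = 0 \<and> y = 1" if "b * c = 0"
    proof -
      have "x\<^sup>2 = 0" "y\<^sup>2 = 1"
        using n that \<open>1 \<le> y\<^sup>2\<close> zero_le_power2[of x] by linarith+
      thus ?thesis using y by (simp add: power2_eq_1_iff)
    qed
    define X where "X = ford \<alpha> 1 0"
    have X: "X \<in> packing_vecs \<alpha>" "X = (\<alpha>\<^sup>2, 0, 0, 1)" using ford_in_packing_vecs[of 1 0 \<alpha>] by (simp_all add: X_def ford_def)
    have "b > 0 \<and> c \<ge> 0 \<or> b = 0 \<and> c \<ge> 4 / \<alpha>\<^sup>2 \<and> x = 0 \<and> y = 1"
    proof (cases "v = X")
      case True
      thus ?thesis using X v \<alpha> by simp
    next
      case False
      have l: "\<alpha>\<^sup>2 * c \<ge> 2 * y + 2" using packing_vecs_lorentz[OF assms X(1) False] by (simp add: X(2) v algebra_simps)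
      hence "\<alpha>\<^sup>2 * c > 0" using y by linarith
      hence c: "c > 0" using \<alpha> by (simp add: zero_less_mult_iff)
      hence b: "b \<ge> 0" using bc1 by (simp add: zero_le_mult_iff)
      show ?thesis
      proof (cases "b = 0")
        case True
        hence "x = 0" "y = 1" using bc2 by auto
        thus ?thesis using True l \<alpha> by (simp add: field_simps)
      qed (use b c in simp)
    qed
    thus thesis using that(2)[OF v] that(3)[of c] v y by auto
  qed (use that(1) in simp)
qed

text \<open>Two lines above the axis would have equal normals and product 1, so a pair of distinct
  lines always includes the axis.\<close>

lemma packing_vecs_separable:
  assumes "v \<in> packing_vecs \<alpha>" "v' \<in> packing_vecs \<alpha>" "v \<noteq> v'"
  shows "separable v v'"
proof -
  have "4 / \<alpha>\<^sup>2 > 0" using \<alpha> by simp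
  hence p: "4 / \<alpha>\<^sup>2 \<le> c \<Longrightarrow> 0 < c" for c by linarith
  have l: "lorentz v v' \<le> -1" by (rule packing_vecs_lorentz[OF assms])
  show ?thesis
    by (rule packing_vecs_cases[OF assms(1)]; rule packing_vecs_cases[OF assms(2)])
      (use l assms(3) in \<open>auto simp: separable_def vec_L_def dest: p\<close>)
qed

lemma circle_of_base: "circle_of (ford \<alpha> 1 0) = circle_X \<alpha>" "circle_of (ford \<alpha> 0 1) = circle_Y \<alpha>" "circle_of vec_L = circle_L"
proof -
  have 1: "ford \<alpha> 1 0 = (\<alpha>\<^sup>2, 0, 0, 1)" "ford \<alpha> 0 1 = (1, 4 / \<alpha>\<^sup>2, 2 / \<alpha>, 1)" by (simp_all add: ford_def)
  show "circle_of (ford \<alpha> 1 0) = circle_X \<alpha>"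
    unfolding 1 using \<alpha> by (subst circle_of_disk) (auto simp: circle_X_def disk_circle_def)
  show "circle_of (ford \<alpha> 0 1) = circle_Y \<alpha>"
    unfolding 1 using \<alpha> by (subst circle_of_disk) (auto simp: circle_Y_def disk_circle_def power2_eq_square)
  show "circle_of vec_L = circle_L" unfolding vec_L_def circle_L_def circle_of_def by simp
qed

lemma packing_eq: "packing \<alpha> = circle_of ` packing_vecs \<alpha>"
proof -
  have "generated_packing {circle_of (ford_quad \<alpha> 1 0 0 1 0), circle_of (ford_quad \<alpha> 1 0 0 1 1), circle_of (ford_quad \<alpha> 1 0 0 1 2)} =
    circle_of ` orbit_vecs (ford_quad \<alpha> 1 0 0 1)"
    using packing_vecs_separable unfolding packing_vecs_def by (intro generated_packing_orbit_vecs descartes_std)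
  thus ?thesis by (simp add: packing_def packing_vecs_def ford_quad_def circle_of_base)
qed

lemma apollonian_packing_packing: "apollonian_packing (packing \<alpha>)"
  unfolding packing_eq packing_vecs_def
  using packing_vecs_separable unfolding packing_vecs_def by (intro apollonian_packing_orbit_vecs descartes_std)

end

section \<open>Similarities acting on vectors\<close>

text \<open>Chosen so that the polynomial of the image circle at the image point is \<mu> times the
  old value; with this factor the Lorentz form is preserved.\<close>

definition sim_act :: "real \<Rightarrow> real^2^2 \<Rightarrow> real^2 \<Rightarrow> cvec \<Rightarrow> cvec" where
  "sim_act \<mu> A t = (\<lambda>(b, c, x, y).
    (b / \<mu>,
     b / \<mu> * ((t$1)\<^sup>2 + (t$2)\<^sup>2) + 2 * ((A$1$1 * x + A$1$2 * y) * t$1 + (A$2$1 * x + A$2$2 * y) * t$2) + \<mu> * c,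
     A$1$1 * x + A$1$2 * y + b / \<mu> * t$1,
     A$2$1 * x + A$2$2 * y + b / \<mu> * t$2))"

lemmas sim_act_simps = sim_act_def[unfolded fun_eq_iff, rule_format, of _ _ _ "(b, c, x, y)" for b c x y, unfolded prod.case]

lemma linear_sim_act: "linear (sim_act \<mu> A t)"
proof (rule linearI)
  fix v w show "sim_act \<mu> A t (v + w) = sim_act \<mu> A t v + sim_act \<mu> A t w"
    by (cases v; cases w) (simp add: sim_act_simps algebra_simps add_divide_distrib)
next
  fix r v show "sim_act \<mu> A t (r *\<^sub>R v) = r *\<^sub>R sim_act \<mu> A t v"
    by (cases v) (simp add: sim_act_simps algebra_simps)
qed

lemma orthogonal_matrix2:
  assumes "orthogonal_matrix (A :: real^2^2)"
  shows "(A$1$1)\<^sup>2 + (A$2$1)\<^sup>2 = 1" "(A$1$2)\<^sup>2 + (A$2$2)\<^sup>2 = 1" "A$1$1 * A$1$2 + A$2$1 * A$2$2 = 0"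
proof -
  have "transpose A ** A = mat 1" using assms by (simp add: orthogonal_matrix_def)
  hence "(transpose A ** A)$i$j = (mat 1 :: real^2^2)$i$j" for i j by simp
  from this[of 1 1] this[of 2 2] this[of 1 2]
  show "(A$1$1)\<^sup>2 + (A$2$1)\<^sup>2 = 1" "(A$1$2)\<^sup>2 + (A$2$2)\<^sup>2 = 1" "A$1$1 * A$1$2 + A$2$1 * A$2$2 = 0"
    by (simp_all add: matrix_matrix_mult_def transpose_def mat_def sum_2 power2_eq_square)
qed

lemma orthogonal_matrix2_inner:
  assumes "orthogonal_matrix (A :: real^2^2)"
  shows "(A$1$1 * x + A$1$2 * y) * (A$1$1 * x' + A$1$2 * y') +
    (A$2$1 * x + A$2$2 * y) * (A$2$1 * x' + A$2$2 * y') = x * x' + y * y'"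
proof -
  have "(A$1$1 * x + A$1$2 * y) * (A$1$1 * x' + A$1$2 * y') +
    (A$2$1 * x + A$2$2 * y) * (A$2$1 * x' + A$2$2 * y') =
    ((A$1$1)\<^sup>2 + (A$2$1)\<^sup>2) * (x * x') + ((A$1$2)\<^sup>2 + (A$2$2)\<^sup>2) * (y * y') +
    (A$1$1 * A$1$2 + A$2$1 * A$2$2) * (x * y' + y * x')"
    by (simp add: power2_eq_square algebra_simps)
  thus ?thesis unfolding orthogonal_matrix2[OF assms] by simp
qed

lemma matrix_vector_mult2: "((A :: real^2^2) *v z)$i = A$i$1 * z$1 + A$i$2 * z$2"
  by (simp add: matrix_vector_mult_def sum_2)

lemma circle_poly_sim_act:
  assumes "orthogonal_matrix A" "\<mu> > 0"
  shows "circle_poly (sim_act \<mu> A t v) (\<mu> *\<^sub>R (A *v z) + t) = \<mu> * circle_poly v z"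
proof -
  obtain b c x y where v: "v = (b, c, x, y)" by (cases v)
  define Z1 Z2 X Y where "Z1 = A$1$1 * z$1 + A$1$2 * z$2" "Z2 = A$2$1 * z$1 + A$2$2 * z$2"
    "X = A$1$1 * x + A$1$2 * y" "Y = A$2$1 * x + A$2$2 * y"
  note d = this
  have "Z1\<^sup>2 + Z2\<^sup>2 = (z$1)\<^sup>2 + (z$2)\<^sup>2" "X * Z1 + Y * Z2 = x * z$1 + y * z$2"
    using orthogonal_matrix2_inner[OF assms(1), of "z$1" "z$2" "z$1" "z$2"]
      orthogonal_matrix2_inner[OF assms(1), of x y "z$1" "z$2"]
    unfolding d by (simp_all add: power2_eq_square)
  hence g: "circle_poly v z = b * (Z1\<^sup>2 + Z2\<^sup>2) - 2 * (X * Z1 + Y * Z2) + c" by (simp add: v)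
  have "circle_poly (sim_act \<mu> A t v) (\<mu> *\<^sub>R (A *v z) + t) =
     b / \<mu> * ((\<mu> * Z1 + t$1)\<^sup>2 + (\<mu> * Z2 + t$2)\<^sup>2) -
     2 * ((X + b / \<mu> * t$1) * (\<mu> * Z1 + t$1) + (Y + b / \<mu> * t$2) * (\<mu> * Z2 + t$2)) +
     (b / \<mu> * ((t$1)\<^sup>2 + (t$2)\<^sup>2) + 2 * (X * t$1 + Y * t$2) + \<mu> * c)"
    by (simp add: v d sim_act_simps matrix_vector_mult2)
  also have "\<dots> = \<mu> * circle_poly v z"
    unfolding g using assms(2) by (simp add: field_simps power2_eq_square)
  finally show ?thesis .
qed

lemma lorentz_sim_act:
  assumes "orthogonal_matrix A" "\<mu> > 0"
  shows "lorentz (sim_act \<mu> A t v) (sim_act \<mu> A t v') = lorentz v v'"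
proof -
  obtain b c x y where v: "v = (b, c, x, y)" by (cases v)
  obtain b' c' x' y' where v': "v' = (b', c', x', y')" by (cases v')
  define X Y X' Y' where "X = A$1$1 * x + A$1$2 * y" "Y = A$2$1 * x + A$2$2 * y"
    "X' = A$1$1 * x' + A$1$2 * y'" "Y' = A$2$1 * x' + A$2$2 * y'"
  note d = this
  have l: "lorentz v v' = X * X' + Y * Y' - (b * c' + c * b') / 2"
    using orthogonal_matrix2_inner[OF assms(1), of x y x' y'] unfolding d v v' by simp
  show ?thesis
    unfolding l unfolding v v' sim_act_simps d[symmetric] lorentz.simps using assms(2)
    by (simp add: field_simps power2_eq_square)
qed

lemma map_circle_circle_of:
  assumes "orthogonal_matrix A" "\<mu> > 0"
  shows "map_circle (\<lambda>z. \<mu> *\<^sub>R (A *v z) + t) (circle_of v) = circle_of (sim_act \<mu> A t v)"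
proof -
  let ?f = "\<lambda>z. \<mu> *\<^sub>R (A *v z) + t"
  have surj: "\<exists>z. w = ?f z" for w
  proof
    have "A ** transpose A = mat 1" using assms(1) by (simp add: orthogonal_matrix_def)
    thus "w = ?f ((1 / \<mu>) *\<^sub>R (transpose A *v (w - t)))"
      using assms(2) by (simp add: matrix_vector_mult_scaleR matrix_vector_mul_assoc del: transpose_matrix_vector)
  qed
  have "?f ` {z. P (circle_poly v z)} = {z. P (circle_poly (sim_act \<mu> A t v) z)}"
    if P: "\<And>r. P (\<mu> * r) \<longleftrightarrow> P r" for P
  proof safe
    fix z assume "P (circle_poly v z)"
    thus "P (circle_poly (sim_act \<mu> A t v) (?f z))" by (simp add: circle_poly_sim_act[OF assms] P)
  next
    fix w assume w: "P (circle_poly (sim_act \<mu> A t v) w)"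
    obtain z where "w = ?f z" using surj by blast
    thus "w \<in> ?f ` {z. P (circle_poly v z)}" using w by (auto simp: circle_poly_sim_act[OF assms] P)
  qed
  from this[of "\<lambda>r. r = 0"] this[of "\<lambda>r. r < 0"] show ?thesis
    using assms(2) unfolding map_circle_def circle_of_def by (simp add: mult_less_0_iff)
qed

section \<open>Similarities that preserve the horizontal direction\<close>

definition axis_sim :: "real \<Rightarrow> real \<Rightarrow> real \<Rightarrow> real \<Rightarrow> real \<Rightarrow> real^2 \<Rightarrow> real^2" where
  "axis_sim e d \<mu> t s z = vector [e * \<mu> * z$1 + t, d * \<mu> * z$2 + s]"

definition axis_act :: "real \<Rightarrow> real \<Rightarrow> real \<Rightarrow> real \<Rightarrow> real \<Rightarrow> cvec \<Rightarrow> cvec" where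
  "axis_act e d \<mu> t s = (\<lambda>(b, c, x, y).
    (b / \<mu>, b / \<mu> * (t\<^sup>2 + s\<^sup>2) + 2 * (e * x * t + d * y * s) + \<mu> * c, e * x + b / \<mu> * t, d * y + b / \<mu> * s))"

lemmas axis_act_simps = axis_act_def[unfolded fun_eq_iff, rule_format, of _ _ _ _ _ "(b, c, x, y)" for b c x y, unfolded prod.case]

definition is_sign :: "real \<Rightarrow> bool" where "is_sign e \<longleftrightarrow> e = 1 \<or> e = -1"

lemma is_sign_square: "is_sign e \<Longrightarrow> e * e = 1"
  by (auto simp: is_sign_def)

definition dmat :: "real \<Rightarrow> real \<Rightarrow> real^2^2" where
  "dmat e d = vector [vector [e, 0], vector [0, d]]"

lemma dmat_nth [simp]: "dmat e d $ 1 $ 1 = e" "dmat e d $ 1 $ 2 = 0" "dmat e d $ 2 $ 1 = 0" "dmat e d $ 2 $ 2 = d"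
  by (simp_all add: dmat_def)

lemma orthogonal_dmat:
  assumes "is_sign e" "is_sign d"
  shows "orthogonal_matrix (dmat e d)"
  unfolding orthogonal_matrix
  using is_sign_square[OF assms(1)] is_sign_square[OF assms(2)]
  by (simp add: vec_eq_iff forall_2 matrix_matrix_mult_def transpose_def mat_def sum_2)

lemma axis_sim_eq: "axis_sim e d \<mu> t s = (\<lambda>z. \<mu> *\<^sub>R (dmat e d *v z) + vector [t, s])"
  by (simp add: fun_eq_iff vec2_eq_iff axis_sim_def matrix_vector_mult2)

lemma axis_act_eq: "axis_act e d \<mu> t s = sim_act \<mu> (dmat e d) (vector [t, s])"
  by (auto simp: fun_eq_iff sim_act_simps axis_act_simps)

lemma similarity_axis_sim: "is_sign e \<Longrightarrow> is_sign d \<Longrightarrow> \<mu> > 0 \<Longrightarrow> similarity (axis_sim e d \<mu> t s)"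
  unfolding similarity_def axis_sim_eq using orthogonal_dmat by blast

lemma orientation_preserving_axis_sim:
  assumes "is_sign e" "is_sign d" "\<mu> > 0"
  shows "orientation_preserving_similarity (axis_sim e d \<mu> t s) \<longleftrightarrow> e = d"
proof
  assume "orientation_preserving_similarity (axis_sim e d \<mu> t s)"
  then obtain \<nu> A b where A: "\<nu> > 0" "det A = 1" "axis_sim e d \<mu> t s = (\<lambda>x. \<nu> *\<^sub>R (A *v x) + b)"
    unfolding orientation_preserving_similarity_def by blast
  have *: "\<mu> *\<^sub>R (dmat e d *v z) + vector [t, s] = \<nu> *\<^sub>R (A *v z) + b" for z
    using A(3) unfolding axis_sim_eq by metis
  have b: "vector [t, s] = b" using *[of 0] by simp
  have "\<mu> *\<^sub>R (dmat e d *v z) = \<nu> *\<^sub>R (A *v z)" for z using *[of z] unfolding b by simp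
  \<comment> \<open>The decomposition given by the definition is arbitrary, so its determinant is
    recovered from the values on the standard basis, as \<mu>^2 e d = \<nu>^2 det A.\<close>
  from this[of "vector [1, 0]"] this[of "vector [0, 1]"]
  have "\<mu> * e = \<nu> * A$1$1" "0 = \<nu> * A$2$1" "0 = \<nu> * A$1$2" "\<mu> * d = \<nu> * A$2$2"
    by (simp_all add: vec2_eq_iff matrix_vector_mult2)
  hence a: "A$2$1 = 0" "A$1$2 = 0" "\<mu> * e = \<nu> * A$1$1" "\<mu> * d = \<nu> * A$2$2"
    using A(1) by simp_all
  have "(\<mu> * \<mu>) * (e * d) = (\<mu> * e) * (\<mu> * d)" by simp
  also have "\<dots> = (\<nu> * \<nu>) * det A" unfolding a(3,4) by (simp add: det_2 a(1,2))
  finally have "(\<mu> * \<mu>) * (e * d) = (\<nu> * \<nu>) * det A" .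
  hence "(\<mu> * \<mu>) * (e * d) > 0" using A(1,2) by simp
  hence "e * d > 0" using assms(3) by (simp add: zero_less_mult_iff)
  thus "e = d" using assms(1,2) by (auto simp: is_sign_def)
next
  assume "e = d"
  hence "det (dmat e d) = 1" using assms by (auto simp: det_2 is_sign_def)
  thus "orientation_preserving_similarity (axis_sim e d \<mu> t s)"
    unfolding orientation_preserving_similarity_def axis_sim_eq using orthogonal_dmat assms by blast
qed

lemma lorentz_axis_act:
  assumes "is_sign e" "is_sign d" "\<mu> > 0"
  shows "lorentz (axis_act e d \<mu> t s v) (axis_act e d \<mu> t s v') = lorentz v v'"
  unfolding axis_act_eq using assms by (intro lorentz_sim_act orthogonal_dmat)

lemma axis_act_vec_L: "axis_act e d \<mu> t s vec_L = (0, - 2 * d * s, 0, - d)"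
  by (simp add: vec_L_def axis_act_simps)

section \<open>Symmetries of the packing as isometries of the orbit\<close>

lemma orbit_vecs_cong:
  assumes "\<And>i. i < 4 \<Longrightarrow> q i = q' i"
  shows "orbit_vecs q = orbit_vecs q'"
proof -
  have "\<forall>i<4. moves q w i = moves q' w i" if "\<forall>i<4. q i = q' i" for w q q'
    using that
  proof (induction w arbitrary: q q')
    case (Cons j w)
    have "\<forall>i<4. move j q i = move j q' i" using Cons.prems unfolding move_def by simp
    thus ?case using Cons.IH by simp
  qed simp
  hence *: "moves q w k = moves q' w k" if "k < 4" for w k using that assms by blast
  show ?thesis unfolding orbit_vecs_def by (intro Collect_cong ex_cong1) (use * in auto)
qed

text \<open>By \<open>descartes_fourth\<close> the image of the fourth entry is one of two vectors
  that differ by a move, and a move does not change the orbit; so three entries suffice.\<close>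

lemma isometry_orbit_vecs:
  assumes f: "linear f" "\<And>v w. lorentz (f v) (f w) = lorentz v w"
    and q: "descartes q" "descartes q'" "f (q 0) = q' 0" "f (q 1) = q' 1" "f (q 2) = q' 2"
  shows "f ` orbit_vecs q = orbit_vecs q'"
proof -
  have "f ` orbit_vecs q = {f (moves q w k) |w k. set w \<subseteq> {..<4} \<and> k < 4}"
    unfolding orbit_vecs_def by blast
  also have "\<dots> = orbit_vecs (f \<circ> q)"
    unfolding orbit_vecs_def moves_linear[OF f(1), symmetric] comp_apply ..
  also have "\<dots> = orbit_vecs q'"
  proof -
    have "f (q 3) = q' 3 \<or> f (q 3) = move 3 q' 3"
    proof (rule descartes_fourth[OF q(2)])
      show "lorentz (f (q 3)) (f (q 3)) = 1" unfolding f using q(1) by (simp add: descartes_def)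
      fix i :: nat assume "i < 4" "i \<noteq> 3"
      hence "i = 0 \<or> i = 1 \<or> i = 2" by (auto simp: less_4_iff)
      hence "q' i = f (q i)" using q(3-5) by auto
      thus "lorentz (f (q 3)) (q' i) = -1"
        using q(1) \<open>i < 4\<close> \<open>i \<noteq> 3\<close> unfolding descartes_def by (simp add: f(2))
    qed simp
    thus ?thesis
    proof
      assume "f (q 3) = q' 3"
      thus ?thesis using q(3-5) by (intro orbit_vecs_cong) (auto simp: less_4_iff)
    next
      assume "f (q 3) = move 3 q' 3"
      hence "orbit_vecs (f \<circ> q) = orbit_vecs (move 3 q')" using q(3-5) by (intro orbit_vecs_cong) (auto simp: less_4_iff move_def)
      thus ?thesis by (simp add: moves_single_orbit_vecs)
    qed
  qed
  finally show ?thesis .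
qed

lemma descartes_perm:
  assumes "descartes q" "p permutes {..<4}"
  shows "descartes (q \<circ> p)"
  using assms permutes_in_image[OF assms(2)] permutes_inj[OF assms(2)]
  unfolding descartes_def by (auto simp: inj_eq)

text \<open>Nothing is lost in passing from circles to vectors, because \<open>circle_of\<close> is
  injective on vectors of norm 1.\<close>

lemma map_circle_packing_iff:
  assumes "\<alpha> > 0" "orthogonal_matrix A" "\<mu> > 0"
  shows "map_circle (\<lambda>z. \<mu> *\<^sub>R (A *v z) + t) ` packing \<alpha> = packing \<alpha> \<longleftrightarrow> sim_act \<mu> A t ` packing_vecs \<alpha> = packing_vecs \<alpha>"
proof -
  have inj: "inj_on circle_of {v. lorentz v v = 1}" by (intro inj_onI circle_of_inj) simp_all
  have s: "packing_vecs \<alpha> \<subseteq> {v. lorentz v v = 1}" "sim_act \<mu> A t ` packing_vecs \<alpha> \<subseteq> {v. lorentz v v = 1}"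
    using packing_vecs_lorentz_self[OF assms(1)] by (auto simp: lorentz_sim_act[OF assms(2,3)])
  have "map_circle (\<lambda>z. \<mu> *\<^sub>R (A *v z) + t) ` packing \<alpha> = circle_of ` sim_act \<mu> A t ` packing_vecs \<alpha>"
    unfolding packing_eq[OF assms(1)] image_image map_circle_circle_of[OF assms(2,3)] ..
  thus ?thesis unfolding packing_eq[OF assms(1)]
    using inj_on_image_eq_iff[OF inj s(2,1)] by simp
qed

lemma axis_sim_in_Symm:
  assumes "\<alpha> > 0" "is_sign e" "is_sign d" "\<mu> > 0" "axis_act e d \<mu> t s ` packing_vecs \<alpha> = packing_vecs \<alpha>"
  shows "axis_sim e d \<mu> t s \<in> carrier (Symm (packing \<alpha>))"
  using assms similarity_axis_sim[of e d \<mu> t s]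
    map_circle_packing_iff[of \<alpha> "dmat e d" \<mu> "vector [t, s]"] orthogonal_dmat
  by (simp add: Symm_def axis_sim_eq axis_act_eq)

text \<open>The axis goes to a line of the packing, and all of these have normal (0, 1) or (0, -1);
  orthogonality then makes the linear part diagonal with signs.\<close>

lemma Symm_packing_axis_sim:
  assumes \<alpha>: "\<alpha> > 0" and "\<Phi> \<in> carrier (Symm (packing \<alpha>))"
  obtains e d \<mu> t s where "is_sign e" "is_sign d" "\<mu> > 0" "\<Phi> = axis_sim e d \<mu> t s"
    "axis_act e d \<mu> t s ` packing_vecs \<alpha> = packing_vecs \<alpha>"
proof -
  obtain \<mu> A b where A: "\<mu> > 0" "orthogonal_matrix A" "\<Phi> = (\<lambda>x. \<mu> *\<^sub>R (A *v x) + b)"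
    and inv: "map_circle \<Phi> ` packing \<alpha> = packing \<alpha>"
    using assms(2) by (auto simp: Symm_def similarity_def)
  have im: "sim_act \<mu> A b ` packing_vecs \<alpha> = packing_vecs \<alpha>"
    using map_circle_packing_iff[OF \<alpha> A(2,1), of b] inv A(3) by simp
  have v: "sim_act \<mu> A b vec_L = (0, - 2 * (A$1$2 * b$1 + A$2$2 * b$2), - (A$1$2), - (A$2$2))"
    by (simp add: vec_L_def sim_act_simps)
  have "sim_act \<mu> A b vec_L \<in> packing_vecs \<alpha>" using vec_L_in_packing_vecs im by blast
  from this[unfolded v] have a2: "A$1$2 = 0 \<and> is_sign (A$2$2)"
    by (rule packing_vecs_cases[OF \<alpha>]) (auto simp: vec_L_def is_sign_def)
  hence a3: "A$2$1 = 0" using orthogonal_matrix2(3)[OF A(2)] by (auto simp: is_sign_def)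
  hence a1: "is_sign (A$1$1)" using orthogonal_matrix2(1)[OF A(2)]
    by (simp add: is_sign_def power2_eq_1_iff)
  have "A = dmat (A$1$1) (A$2$2)" using a2 a3 by (simp add: vec_eq_iff forall_2)
  moreover have "b = vector [b$1, b$2]" by (simp add: vec2_eq_iff)
  ultimately have "\<Phi> = axis_sim (A$1$1) (A$2$2) \<mu> (b$1) (b$2)" "sim_act \<mu> A b = axis_act (A$1$1) (A$2$2) \<mu> (b$1) (b$2)"
    unfolding A(3) axis_sim_eq axis_act_eq by simp_all
  thus thesis using that[OF a1 _ A(1)] a2 im by auto
qed

lemma subgroup_Symm_plus: "subgroup (carrier (Symm_plus P)) (Symm P)"
proof -
  interpret group "Symm P" by (rule group_Symm)
  show ?thesis
  proof (rule subgroupI)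
    show "carrier (Symm_plus P) \<subseteq> carrier (Symm P)" by (auto simp: Symm_plus_def)
    have "(id :: real^2 \<Rightarrow> real^2) = (\<lambda>x. 1 *\<^sub>R (mat 1 *v x) + 0)" by auto
    hence "orientation_preserving_similarity id"
      unfolding orientation_preserving_similarity_def
      by (intro exI conjI) (rule zero_less_one, rule orthogonal_matrix_id, rule det_I)
    hence "\<one>\<^bsub>Symm P\<^esub> \<in> carrier (Symm_plus P)"
      using one_closed by (simp add: Symm_plus_def) (simp add: Symm_def)
    thus "carrier (Symm_plus P) \<noteq> {}" by blast
  next
    fix \<Phi> assume "\<Phi> \<in> carrier (Symm_plus P)"
    hence *: "\<Phi> \<in> carrier (Symm P)" "orientation_preserving_similarity \<Phi>"
      by (auto simp: Symm_plus_def)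
    obtain \<mu> A b where A: "\<mu> > 0" "orthogonal_matrix A" "det A = 1" "\<Phi> = (\<lambda>x. \<mu> *\<^sub>R (A *v x) + b)"
      using *(2) unfolding orientation_preserving_similarity_def by blast
    define \<Psi> where "\<Psi> = (\<lambda>x. (1 / \<mu>) *\<^sub>R (transpose A *v x) + - ((1 / \<mu>) *\<^sub>R (transpose A *v b)))"
    have 1: "\<Psi> \<circ> \<Phi> = id" using similarity_inverse_aux A by (simp add: \<Psi>_def)
    have i: "inv\<^bsub>Symm P\<^esub> \<Phi> \<in> carrier (Symm P)" "\<Phi> \<circ> inv\<^bsub>Symm P\<^esub> \<Phi> = id"
      using *(1) inv_closed r_inv[OF *(1)] by (auto simp: Symm_def)
    have "inv\<^bsub>Symm P\<^esub> \<Phi> = (\<Psi> \<circ> \<Phi>) \<circ> inv\<^bsub>Symm P\<^esub> \<Phi>" unfolding 1 by simp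
    also have "\<dots> = \<Psi>" unfolding comp_assoc i(2) by simp
    finally have eq: "inv\<^bsub>Symm P\<^esub> \<Phi> = \<Psi>" .
    have "1 / \<mu> > 0" "orthogonal_matrix (transpose A)" "det (transpose A) = 1"
      using A by (auto simp: orthogonal_matrix_transpose)
    hence "orientation_preserving_similarity \<Psi>"
      unfolding orientation_preserving_similarity_def \<Psi>_def by blast
    thus "inv\<^bsub>Symm P\<^esub> \<Phi> \<in> carrier (Symm_plus P)" using i(1) eq by (simp add: Symm_plus_def)
  next
    fix \<Phi> \<Psi> assume "\<Phi> \<in> carrier (Symm_plus P)" "\<Psi> \<in> carrier (Symm_plus P)"
    hence *: "\<Phi> \<in> carrier (Symm P)" "\<Psi> \<in> carrier (Symm P)"
      "orientation_preserving_similarity \<Phi>" "orientation_preserving_similarity \<Psi>"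
      by (auto simp: Symm_plus_def)
    obtain \<mu> A b where A: "\<mu> > 0" "orthogonal_matrix A" "det A = 1" "\<Phi> = (\<lambda>x. \<mu> *\<^sub>R (A *v x) + b)"
      using *(3) unfolding orientation_preserving_similarity_def by blast
    obtain \<mu>' A' b' where A': "\<mu>' > 0" "orthogonal_matrix A'" "det A' = 1" "\<Psi> = (\<lambda>x. \<mu>' *\<^sub>R (A' *v x) + b')"
      using *(4) unfolding orientation_preserving_similarity_def by blast
    have "\<mu> * \<mu>' > 0" "orthogonal_matrix (A ** A')" "det (A ** A') = 1"
      using A A' by (auto simp: orthogonal_matrix_mul det_mul)
    hence "orientation_preserving_similarity (\<Phi> \<circ> \<Psi>)"
      unfolding A(4) A'(4) similarity_comp_aux orientation_preserving_similarity_def by blast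
    moreover have "\<Phi> \<circ> \<Psi> \<in> carrier (Symm P)" using m_closed[OF *(1,2)] by (simp add: Symm_def)
    ultimately show "\<Phi> \<otimes>\<^bsub>Symm P\<^esub> \<Psi> \<in> carrier (Symm_plus P)"
      by (simp add: Symm_plus_def) (simp add: Symm_def)
  qed
qed

section \<open>Rational parameter\<close>

definition bool_sign :: "bool \<Rightarrow> 'a :: ring_1" where "bool_sign e = (if e then -1 else 1)"

lemma is_sign_bool_sign: "is_sign (bool_sign e)" by (simp add: is_sign_def bool_sign_def)

lemma is_sign_cases: "is_sign e \<Longrightarrow> \<exists>b. e = bool_sign b"
  unfolding is_sign_def bool_sign_def by (metis (full_types))

lemma axis_sim_comp:
  "axis_sim e d \<mu> t s \<circ> axis_sim e' d' \<mu>' t' s' =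
    axis_sim (e * e') (d * d') (\<mu> * \<mu>') (e * \<mu> * t' + t) (d * \<mu> * s' + s)"
  by (simp add: fun_eq_iff axis_sim_def vec2_eq_iff algebra_simps)

lemma axis_sim_inject:
  assumes "axis_sim e d \<mu> t s = axis_sim e' d' \<mu>' t' s'"
  shows "t = t'" "s = s'" "e * \<mu> = e' * \<mu>'" "d * \<mu> = d' * \<mu>'"
proof -
  have *: "axis_sim e d \<mu> t s z = axis_sim e' d' \<mu>' t' s' z" for z using assms by simp
  from *[of 0] show ts: "t = t'" "s = s'" by (simp_all add: axis_sim_def vec2_eq_iff)
  from *[of "vector [1, 0]"] *[of "vector [0, 1]"] ts
  show "e * \<mu> = e' * \<mu>'" "d * \<mu> = d' * \<mu>'" by (simp_all add: axis_sim_def vec2_eq_iff)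
qed

text \<open>Thanks to the norm, images of curved circles need only be compared in curvature and
  centre.\<close>

lemma lorentz_self_eqI:
  assumes "lorentz (b, c, x, y) (b, c, x, y) = 1" "lorentz (b, c', x, y) (b, c', x, y) = 1" "b \<noteq> 0"
  shows "c = c'"
proof -
  have "x * x + y * y - b * c = 1" "x * x + y * y - b * c' = 1" using assms(1,2) by simp_all
  hence "b * c = b * c'" by linarith
  thus ?thesis using assms(3) by simp
qed

context
  fixes \<alpha> :: real and p q m0 n0 :: int
  assumes pq: "p > 0" "q > 0" and alpha: "\<alpha> = of_int p / of_int q" and bez: "m0 * p + n0 * q = 1"
begin

lemma alpha_pos: "\<alpha> > 0" using pq alpha by simp

text \<open>The line at height 2 q^2. It arises as the Ford circle of the pair (q, -p), whose
  curvature vanishes.\<close>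

definition vec_M :: cvec where "vec_M = (0, 4 * (of_int q)\<^sup>2, 0, 1)"

lemma ford_vec_M: "ford \<alpha> q (- p) = vec_M"
  using pq by (simp add: ford_def vec_M_def alpha field_simps power2_eq_square)

lemma coprime_pq: "coprime p q"
proof (rule coprimeI)
  fix e assume "e dvd p" "e dvd q"
  hence "e dvd m0 * p + n0 * q" by simp
  thus "is_unit e" using bez by simp
qed

lemma vec_M_in_packing_vecs: "vec_M \<in> packing_vecs \<alpha>"
  unfolding ford_vec_M[symmetric] by (rule ford_in_packing_vecs) (use coprime_pq in \<open>simp add: coprime_commute\<close>)

lemma linear_form_zero:
  assumes "coprime m n" "of_int m * \<alpha> + of_int n = 0"
  shows "ford \<alpha> m n = vec_M"
proof -
  have "real_of_int (m * p + n * q) = 0" using assms(2) pq by (simp add: alpha field_simps)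
  hence e: "m * p + n * q = 0" by linarith
  hence "q dvd m * p" by (metis dvd_add_left_iff dvd_triv_right dvd_0_right)
  hence "q dvd m" using coprime_pq by (simp add: coprime_commute coprime_dvd_mult_left_iff)
  then obtain j where j: "m = q * j" by blast
  have "q * (n + p * j) = 0" using e unfolding j by (simp add: algebra_simps)
  hence n: "n = - p * j" using pq by simp
  have "is_unit j" using assms(1) unfolding j n by (meson coprime_common_divisor dvd_triv_right)
  hence "j = 1 \<or> j = -1" by auto
  thus ?thesis using ford_vec_M ford_minus[of \<alpha> q "- p"] unfolding j n by auto
qed

lemma packing_vecs_line:
  assumes "v \<in> packing_vecs \<alpha>" "fst v = 0"
  shows "v = vec_L \<or> v = vec_M"
proof -
  consider "v = vec_L" | b c x y where "v = (b, c, x, y)" "b > 0" | c where "v = (0, c, 0, 1)"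
    using packing_vecs_cases[OF alpha_pos assms(1)] by metis
  thus ?thesis
  proof cases
    case (3 c)
    hence "lorentz v vec_L = -1" by simp
    then obtain m n where mn: "coprime m n" "v = ford \<alpha> m n"
      using tangent_to_L[OF alpha_pos assms(1)] by blast
    hence "of_int m * \<alpha> + of_int n = 0" using assms(2) by (simp add: ford_def)
    thus ?thesis using linear_form_zero mn by simp
  qed (use assms(2) in auto)
qed

definition x0 :: real where "x0 = 2 * of_int n0 / of_int p"

text \<open>The solutions of m p + n q = 1 differ by multiples of (q, -p). They give the circles of
  radius q^2 that touch both lines of the strip, each touching the next.\<close>

lemma ford_base: "ford \<alpha> (m0 - k * q) (n0 + k * p) =
  (1 / (of_int q)\<^sup>2, 4 * (of_int (n0 + k * p))\<^sup>2 / \<alpha>\<^sup>2, x0 + 2 * of_int k, 1)"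
proof -
  have "of_int (m0 - k * q) * \<alpha> + of_int (n0 + k * p) = real_of_int (m0 * p + n0 * q) / of_int q"
    using pq by (simp add: alpha field_simps)
  hence l: "of_int (m0 - k * q) * \<alpha> + of_int (n0 + k * p) = 1 / of_int q" unfolding bez by simp
  have "2 / \<alpha> * of_int (n0 + k * p) * (1 / of_int q) = x0 + 2 * of_int k"
    using pq by (simp add: alpha x0_def field_simps)
  thus ?thesis unfolding ford_def l by (simp add: power_divide)
qed

text \<open>The chain of circles of radius q^2 models the integers: \<open>k\<close> shifts it by k
  circles, \<open>e\<close> reflects it in the vertical line through the centre of circle 0, which
  has abscissa q^2 x0, and \<open>d\<close> exchanges the two lines.\<close>

definition strip_sim :: "int \<Rightarrow> bool \<Rightarrow> bool \<Rightarrow> real^2 \<Rightarrow> real^2" where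
  "strip_sim k e d = axis_sim (bool_sign e) (bool_sign d) 1 ((of_int q)\<^sup>2 * (x0 * (1 - bool_sign e) + 2 * of_int k))
     (if d then 2 * (of_int q)\<^sup>2 else 0)"

text \<open>A circle of the chain and the two lines form a tangent triple, and the map carries the
  triple of circle 0 to that of circle \<open>k\<close>; \<open>isometry_orbit_vecs\<close> does the
  rest.\<close>

lemma strip_sim_in_Symm: "strip_sim k e d \<in> carrier (Symm (packing \<alpha>))"
proof -
  define t where "t = (of_int q)\<^sup>2 * (x0 * (1 - bool_sign e) + 2 * real_of_int k)"
  define s where "s = (if d then 2 * (real_of_int q)\<^sup>2 else 0)"
  define f where "f = axis_act (bool_sign e) (bool_sign d) 1 t s"
  have f: "linear f" "\<And>v w. lorentz (f v) (f w) = lorentz v w"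
    unfolding f_def using lorentz_axis_act[of "bool_sign e" "bool_sign d" 1] is_sign_bool_sign by (auto simp: axis_act_eq linear_sim_act)
  define Q where "Q k = ford_quad \<alpha> (m0 - k * q) (n0 + k * p) q (- p)" for k
  have det: "((m0 - k * q) * (- p) - q * (n0 + k * p))\<^sup>2 = 1" for k
  proof -
    have "(m0 - k * q) * (- p) - q * (n0 + k * p) = - (m0 * p + n0 * q)" by (simp add: algebra_simps)
    thus ?thesis unfolding bez by simp
  qed
  have D: "descartes (Q k)" for k unfolding Q_def by (rule descartes_ford_quad[OF alpha_pos det])
  have O: "orbit_vecs (Q k) = packing_vecs \<alpha>" for k unfolding Q_def packing_vecs_def by (rule orbit_vecs_ford_quad[OF det])
  have Q: "Q k 0 = ford \<alpha> (m0 - k * q) (n0 + k * p)" "Q k 1 = vec_M" "Q k 2 = vec_L" for k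
    by (simp_all add: Q_def ford_quad_def ford_vec_M)
  have q0: "real_of_int q \<noteq> 0" using pq by simp
  have "f (Q 0 0) = Q k 0"
  proof -
    obtain c where c: "Q 0 0 = (1 / (of_int q)\<^sup>2, c, x0, 1)" using ford_base[of 0] by (simp add: Q)
    obtain c' where c': "Q k 0 = (1 / (of_int q)\<^sup>2, c', x0 + 2 * of_int k, 1)" unfolding Q ford_base by blast
    obtain c'' where "f (Q 0 0) = (1 / (of_int q)\<^sup>2, c'', bool_sign e * x0 + 1 / (of_int q)\<^sup>2 * t, bool_sign d + 1 / (of_int q)\<^sup>2 * s)"
      unfolding c f_def axis_act_simps by simp
    moreover have "bool_sign e * x0 + 1 / (of_int q)\<^sup>2 * t = x0 + 2 * of_int k"
      using q0 by (simp add: t_def field_simps)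
    moreover have "bool_sign d + 1 / (of_int q)\<^sup>2 * s = 1"
      using q0 by (cases d) (simp_all add: s_def bool_sign_def)
    ultimately have c'': "f (Q 0 0) = (1 / (of_int q)\<^sup>2, c'', x0 + 2 * of_int k, 1)" by simp
    have l: "lorentz (f (Q 0 0)) (f (Q 0 0)) = 1" "lorentz (Q k 0) (Q k 0) = 1"
      unfolding f(2) using D[of 0] D[of k] by (simp_all add: descartes_def)
    have "c'' = c'" by (rule lorentz_self_eqI[OF l[unfolded c' c'']]) (use q0 in simp)
    thus ?thesis using c' c'' by simp
  qed
  moreover have "f vec_M = (if d then vec_L else vec_M)" "f vec_L = (if d then vec_M else vec_L)"
    by (simp_all add: f_def vec_M_def vec_L_def axis_act_simps s_def bool_sign_def)
  ultimately have fQ: "f (Q 0 0) = Q k 0" "f (Q 0 1) = (if d then Q k 2 else Q k 1)"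
    "f (Q 0 2) = (if d then Q k 1 else Q k 2)" unfolding Q by simp_all
  have "f ` orbit_vecs (Q 0) = packing_vecs \<alpha>"
  proof (cases d)
    case False
    thus ?thesis using isometry_orbit_vecs[OF f D D fQ(1)] fQ O by simp
  next
    case True
    have p: "Transposition.transpose 1 (2::nat) permutes {..<4}" by (rule permutes_swap_id) auto
    have "f ` orbit_vecs (Q 0) = orbit_vecs (Q k \<circ> Transposition.transpose 1 2)"
      using True fQ by (intro isometry_orbit_vecs f D descartes_perm p) (auto simp: transpose_def)
    thus ?thesis using orbit_vecs_perm[OF p] O by simp
  qed
  hence "f ` packing_vecs \<alpha> = packing_vecs \<alpha>" unfolding O .
  thus ?thesis
    unfolding strip_sim_def t_def[symmetric] s_def[symmetric]
    using alpha_pos is_sign_bool_sign f_def by (intro axis_sim_in_Symm) auto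
qed

lemma Symm_strip_sim:
  assumes "\<Phi> \<in> carrier (Symm (packing \<alpha>))"
  shows "\<exists>k e d. \<Phi> = strip_sim k e d"
proof -
  obtain e' d' \<mu> t s where 1: "is_sign e'" "is_sign d'" "\<mu> > 0" "\<Phi> = axis_sim e' d' \<mu> t s"
    "axis_act e' d' \<mu> t s ` packing_vecs \<alpha> = packing_vecs \<alpha>"
    using Symm_packing_axis_sim[OF alpha_pos assms] by metis
  obtain e d where ed: "e' = bool_sign e" "d' = bool_sign d" using is_sign_cases 1 by metis
  have q0: "real_of_int q \<noteq> 0" using pq by simp
  have "axis_act e' d' \<mu> t s vec_L \<in> packing_vecs \<alpha>" "axis_act e' d' \<mu> t s vec_M \<in> packing_vecs \<alpha>"
    using vec_L_in_packing_vecs vec_M_in_packing_vecs 1(5) by blast+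
  moreover have dv: "axis_act e' d' \<mu> t s vec_L = (0, - 2 * bool_sign d * s, 0, - bool_sign d)"
    "axis_act e' d' \<mu> t s vec_M = (0, 2 * bool_sign d * s + \<mu> * (4 * (of_int q)\<^sup>2), 0, bool_sign d)"
    by (simp_all add: vec_L_def vec_M_def axis_act_simps ed)
  ultimately have "(0, - 2 * bool_sign d * s, 0, - bool_sign d) = vec_L \<or> (0, - 2 * bool_sign d * s, 0, - bool_sign d) = vec_M"
    "(0, 2 * bool_sign d * s + \<mu> * (4 * (of_int q)\<^sup>2), 0, bool_sign d) = vec_L \<or>
     (0, 2 * bool_sign d * s + \<mu> * (4 * (of_int q)\<^sup>2), 0, bool_sign d) = vec_M"
    by (metis packing_vecs_line fst_conv)+
  \<comment> \<open>The two lines go to the two lines, so the width of the strip is kept and the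
    scale is 1.\<close>
  hence "s = (if d then 2 * (of_int q)\<^sup>2 else 0) \<and> \<mu> = 1"
    using q0 by (cases d) (simp_all add: vec_L_def vec_M_def bool_sign_def)
  hence s: "s = (if d then 2 * (of_int q)\<^sup>2 else 0)" and mu: "\<mu> = 1" by auto
  have co: "coprime m0 n0"
  proof (rule coprimeI)
    fix c assume "c dvd m0" "c dvd n0"
    hence "c dvd m0 * p + n0 * q" by simp
    thus "is_unit c" using bez by simp
  qed
  obtain c where c: "ford \<alpha> m0 n0 = (1 / (of_int q)\<^sup>2, c, x0, 1)" using ford_base[of 0] by simp
  let ?w = "axis_act e' d' \<mu> t s (ford \<alpha> m0 n0)"
  obtain c' where c': "?w = (1 / (of_int q)\<^sup>2, c', bool_sign e * x0 + t / (of_int q)\<^sup>2, 1)"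
    unfolding c axis_act_simps ed mu s using q0 by (simp add: bool_sign_def)
  have "?w \<in> packing_vecs \<alpha>" using ford_in_packing_vecs[OF co, of \<alpha>] 1(5) by blast
  moreover have "lorentz ?w vec_L = -1" unfolding c' by simp
  ultimately obtain m n where mn: "?w = ford \<alpha> m n" using tangent_to_L[OF alpha_pos] by metis
  hence "(of_int m * \<alpha> + of_int n)\<^sup>2 = (1 / of_int q)\<^sup>2" using c' by (simp add: ford_def power_divide)
  hence "of_int m * \<alpha> + of_int n = 1 / of_int q \<or> of_int (- m) * \<alpha> + of_int (- n) = 1 / of_int q"
    by (auto simp: power2_eq_iff)
  then obtain m n where mn: "?w = ford \<alpha> m n" "of_int m * \<alpha> + of_int n = 1 / of_int q"
    using mn ford_minus[of \<alpha> m n] by metis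
  have "real_of_int (m * p + n * q) = 1" using mn(2) pq by (simp add: alpha field_simps)
  hence mpnq: "m * p + n * q = 1" by linarith
  \<comment> \<open>Both pairs have product 1 with (p, q), so they differ by a multiple of (-q, p);
    the multiplier is their determinant.\<close>
  define k where "k = m0 * n - m * n0"
  have "n0 + k * p = n0 * (m * p + n * q) + (m0 * n - m * n0) * p" unfolding mpnq by (simp add: k_def)
  also have "\<dots> = n * (m0 * p + n0 * q)" by (simp add: algebra_simps)
  finally have n: "n = n0 + k * p" unfolding bez by simp
  have "m0 - k * q = m0 * (m * p + n * q) - (m0 * n - m * n0) * q" unfolding mpnq by (simp add: k_def)
  also have "\<dots> = m * (m0 * p + n0 * q)" by (simp add: algebra_simps)
  finally have m: "m = m0 - k * q" unfolding bez by simp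
  have "bool_sign e * x0 + t / (of_int q)\<^sup>2 = x0 + 2 * of_int k"
    using c' unfolding mn(1) m n ford_base by simp
  hence "t = (of_int q)\<^sup>2 * (x0 * (1 - bool_sign e) + 2 * of_int k)"
    using q0 by (simp add: field_simps)
  hence "\<Phi> = strip_sim k e d" unfolding 1(4) strip_sim_def ed mu s by simp
  thus ?thesis by blast
qed

lemma strip_sim_comp: "strip_sim k e d \<circ> strip_sim k' e' d' = strip_sim (k + (if e then - k' else k')) (e \<noteq> e') (d \<noteq> d')"
  unfolding strip_sim_def axis_sim_comp by (cases e; cases e'; cases d; cases d') (simp_all add: bool_sign_def algebra_simps)

lemma strip_sim_inject: "strip_sim k e d = strip_sim k' e' d' \<longleftrightarrow> k = k' \<and> e = e' \<and> d = d'"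
proof
  assume *: "strip_sim k e d = strip_sim k' e' d'"
  have q0: "real_of_int q \<noteq> 0" using pq by simp
  have ed: "e = e'" "d = d'" using axis_sim_inject(3,4)[OF *[unfolded strip_sim_def]]
    by (cases e; cases e'; cases d; cases d'; simp add: bool_sign_def)+
  moreover have "k = k'" using axis_sim_inject(1)[OF *[unfolded strip_sim_def]] q0 ed by simp
  ultimately show "k = k' \<and> e = e' \<and> d = d'" by simp
qed simp

lemma orientation_preserving_strip_sim: "orientation_preserving_similarity (strip_sim k e d) \<longleftrightarrow> e = d"
proof -
  have "(bool_sign e :: real) = bool_sign d \<longleftrightarrow> e = d" by (cases e; cases d) (simp_all add: bool_sign_def)
  thus ?thesis unfolding strip_sim_def orientation_preserving_axis_sim[OF is_sign_bool_sign is_sign_bool_sign zero_less_one] .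
qed

lemma rational_strip: "strip_packing (packing \<alpha>)"
proof -
  have m: "circle_of vec_L \<in> packing \<alpha>" "circle_of vec_M \<in> packing \<alpha>"
    unfolding packing_eq[OF alpha_pos] using vec_L_in_packing_vecs vec_M_in_packing_vecs by blast+
  have "lorentz vec_M vec_M = 1" "fst vec_L = 0" "fst vec_M = 0" by (simp_all add: vec_L_def vec_M_def)
  hence s: "straight_line (fst (circle_of vec_L))" "straight_line (fst (circle_of vec_M))"
    using straight_line_circle_of lorentz_vec_L(1) by blast+
  have "0 \<in> fst (circle_of vec_L)" "0 \<notin> fst (circle_of vec_M)" using pq by (auto simp: circle_of_def vec_L_def vec_M_def)
  hence "fst (circle_of vec_L) \<noteq> fst (circle_of vec_M)" by blast
  thus ?thesis
    unfolding strip_packing_def using apollonian_packing_packing[OF alpha_pos] m s by blast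
qed

lemma rational_Symm: "Symm (packing \<alpha>) \<cong> D_inf \<times>\<times> integer_mod_group 2"
proof -
  \<comment> \<open>The pair (k, e) acts on the chain as \<open>D_inf\<close> acts on the integers;
    the exchange of the two lines has order 2 and commutes with this action.\<close>
  define h where "h = (\<lambda>((k, e), j :: int). strip_sim k e (j = 1))"
  have "h \<in> iso (D_inf \<times>\<times> integer_mod_group 2) (Symm (packing \<alpha>))"
  proof (rule isoI)
    show "h \<in> hom (D_inf \<times>\<times> integer_mod_group 2) (Symm (packing \<alpha>))"
    proof (rule homI)
      fix x assume "x \<in> carrier (D_inf \<times>\<times> integer_mod_group 2)"
      show "h x \<in> carrier (Symm (packing \<alpha>))"
        by (cases x) (auto simp: h_def strip_sim_in_Symm split: prod.split)
    next
      fix x y assume xy: "x \<in> carrier (D_inf \<times>\<times> integer_mod_group 2)" "y \<in> carrier (D_inf \<times>\<times> integer_mod_group 2)"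
      obtain k e i where x: "x = ((k, e), i)" by (cases x) auto
      obtain l f j where y: "y = ((l, f), j)" by (cases y) auto
      have "i = 0 \<or> i = 1" "j = 0 \<or> j = 1"
        using xy by (auto simp: x y carrier_integer_mod_group)
      thus "h (x \<otimes>\<^bsub>D_inf \<times>\<times> integer_mod_group 2\<^esub> y) = h x \<otimes>\<^bsub>Symm (packing \<alpha>)\<^esub> h y"
        by (auto simp: x y h_def mult_integer_mod_group D_inf_def Symm_def strip_sim_comp strip_sim_inject)
    qed
    show "bij_betw h (carrier (D_inf \<times>\<times> integer_mod_group 2)) (carrier (Symm (packing \<alpha>)))"
      unfolding bij_betw_def
    proof (intro conjI inj_onI subset_antisym subsetI)
      fix x y assume "x \<in> carrier (D_inf \<times>\<times> integer_mod_group 2)" "y \<in> carrier (D_inf \<times>\<times> integer_mod_group 2)" "h x = h y"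
      thus "x = y" by (cases x; cases y) (auto simp: h_def strip_sim_inject carrier_integer_mod_group)
    next
      fix \<Phi> assume "\<Phi> \<in> carrier (Symm (packing \<alpha>))"
      then obtain k e d where "\<Phi> = strip_sim k e d" using Symm_strip_sim by blast
      hence "\<Phi> = h ((k, e), if d then 1 else 0)" by (simp add: h_def)
      moreover have "((k, e), if d then 1 else 0) \<in> carrier (D_inf \<times>\<times> integer_mod_group 2)"
        by (simp add: carrier_integer_mod_group D_inf_def)
      ultimately show "\<Phi> \<in> h ` carrier (D_inf \<times>\<times> integer_mod_group 2)" by blast
    qed (auto simp: h_def strip_sim_in_Symm split: prod.split)
  qed
  hence "D_inf \<times>\<times> integer_mod_group 2 \<cong> Symm (packing \<alpha>)" by (auto simp: is_iso_def)
  thus ?thesis 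
    by (rule group.iso_sym[OF DirProd_group[OF group_D_inf group_integer_mod_group]])
qed

text \<open>Orientation is kept when both reflections occur or neither does. This leaves the
  diagonal e = d, again a copy of \<open>D_inf\<close>.\<close>

lemma rational_Symm_plus: "Symm_plus (packing \<alpha>) \<cong> D_inf"
proof -
  have in_plus: "strip_sim k e e \<in> carrier (Symm_plus (packing \<alpha>))" for k e
    by (simp add: Symm_plus_def strip_sim_in_Symm orientation_preserving_strip_sim)
  have "(\<lambda>(k, e). strip_sim k e e) \<in> iso D_inf (Symm_plus (packing \<alpha>))"
  proof (rule isoI)
    show "(\<lambda>(k, e). strip_sim k e e) \<in> hom D_inf (Symm_plus (packing \<alpha>))"
    proof (rule homI)
      fix x y
      show "(\<lambda>(k, e). strip_sim k e e) x \<in> carrier (Symm_plus (packing \<alpha>))"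
        by (cases x) (simp add: in_plus)
      show "(\<lambda>(k, e). strip_sim k e e) (x \<otimes>\<^bsub>D_inf\<^esub> y) =
        (\<lambda>(k, e). strip_sim k e e) x \<otimes>\<^bsub>Symm_plus (packing \<alpha>)\<^esub> (\<lambda>(k, e). strip_sim k e e) y"
        by (cases x; cases y) (simp add: D_inf_def Symm_plus_def Symm_def strip_sim_comp)
    qed
    show "bij_betw (\<lambda>(k, e). strip_sim k e e) (carrier D_inf) (carrier (Symm_plus (packing \<alpha>)))"
      unfolding bij_betw_def
    proof (intro conjI inj_onI subset_antisym subsetI)
      fix \<Phi> assume *: "\<Phi> \<in> carrier (Symm_plus (packing \<alpha>))"
      hence "\<Phi> \<in> carrier (Symm (packing \<alpha>))" by (simp add: Symm_plus_def)
      then obtain k e d where "\<Phi> = strip_sim k e d" using Symm_strip_sim by blast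
      moreover from this have "e = d" using * by (simp add: Symm_plus_def orientation_preserving_strip_sim)
      ultimately have "\<Phi> = (\<lambda>(k, e). strip_sim k e e) (k, e)" by simp
      thus "\<Phi> \<in> (\<lambda>(k, e). strip_sim k e e) ` carrier D_inf" by (auto simp: D_inf_def)
    qed (auto simp: in_plus strip_sim_inject)
  qed
  hence "D_inf \<cong> Symm_plus (packing \<alpha>)" by (auto simp: is_iso_def)
  thus ?thesis by (rule group.iso_sym[OF group_D_inf])
qed

end

theorem rational_case:
  assumes "\<alpha> > 0" "\<alpha> \<in> \<rat>"
  shows "strip_packing (packing \<alpha>)" "Symm (packing \<alpha>) \<cong> D_inf \<times>\<times> integer_mod_group 2"
    "Symm_plus (packing \<alpha>) \<cong> D_inf"
proof -
  obtain p q :: int where pq: "q > 0" "coprime p q" "\<alpha> = of_int p / of_int q"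
    using assms(2) by (elim Rats_cases')
  have p: "p > 0" using assms(1) pq by (simp add: zero_less_divide_iff)
  obtain m n where "m * p + n * q = 1" using bezout_int[of p q] pq(2) by auto
  note * = p pq(1,3) this
  show "strip_packing (packing \<alpha>)" "Symm (packing \<alpha>) \<cong> D_inf \<times>\<times> integer_mod_group 2"
    "Symm_plus (packing \<alpha>) \<cong> D_inf"
    by (rule rational_strip[OF *] rational_Symm[OF *] rational_Symm_plus[OF *])+
qed

section \<open>Cyclic groups and Pell's equation\<close>

text \<open>By finiteness \<open>L\<close> has a least positive value; division with remainder by it
  leaves a remainder that must be 0, and the kernel of \<open>L\<close> is trivial.\<close>

lemma (in group) discrete_real_embedding_cyclic:
  fixes L :: "'a \<Rightarrow> real"
  assumes mult: "\<And>x y. x \<in> carrier G \<Longrightarrow> y \<in> carrier G \<Longrightarrow> L (x \<otimes> y) = L x + L y"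
    and inj: "\<And>x. x \<in> carrier G \<Longrightarrow> L x = 0 \<Longrightarrow> x = \<one>"
    and fin: "\<And>c. finite {L x |x. x \<in> carrier G \<and> 0 < L x \<and> L x \<le> c}"
    and nontriv: "\<exists>x\<in>carrier G. L x \<noteq> 0"
  obtains g where "g \<in> carrier G" "L g > 0" "\<And>x. x \<in> carrier G \<Longrightarrow> \<exists>k::int. x = g [^] k"
    "\<And>k::int. L (g [^] k) = of_int k * L g"
proof -
  have L1: "L \<one> = 0" using mult[of \<one> \<one>] by simp
  have Linv: "L (inv x) = - L x" if "x \<in> carrier G" for x
    using mult[of x "inv x"] that L1 by simp
  have Lnat: "L (x [^] n) = of_nat n * L x" if "x \<in> carrier G" for x and n :: nat
  proof (induction n)
    case (Suc n)
    have "L (x [^] Suc n) = L (x [^] n) + L x" using that by (simp add: mult)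
    thus ?case unfolding Suc by (simp add: algebra_simps)
  qed (simp add: L1)
  have Lint: "L (x [^] k) = of_int k * L x" if "x \<in> carrier G" for x and k :: int
  proof (cases "k < 0")
    case True
    hence "L (x [^] k) = L (inv (x [^] nat (- k)))" by (simp only: int_pow_def2 if_True)
    also have "\<dots> = - (of_nat (nat (- k)) * L x)"
      unfolding Linv[OF nat_pow_closed[OF that]] Lnat[OF that] ..
    finally show ?thesis using True by simp
  next
    case False
    hence "L (x [^] k) = L (x [^] nat k)" by (simp only: int_pow_def2 if_False)
    also have "\<dots> = of_nat (nat k) * L x" by (rule Lnat[OF that])
    finally show ?thesis using False by simp
  qed
  obtain x0 where x0: "x0 \<in> carrier G" "L x0 > 0"
  proof -
    obtain x where "x \<in> carrier G" "L x \<noteq> 0" using nontriv by blast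
    moreover have "L (inv x) > 0" if "x \<in> carrier G" "L x < 0" for x using Linv[of x] that by simp
    ultimately show thesis using that by (metis inv_closed linorder_neqE_linordered_idom)
  qed
  define S where "S = {L x |x. x \<in> carrier G \<and> 0 < L x \<and> L x \<le> L x0}"
  have S: "finite S" "S \<noteq> {}" unfolding S_def using fin x0 by auto
  from Min_in[OF this] obtain g where g: "g \<in> carrier G" "0 < L g" "L g = Min S" "L g \<le> L x0"
    unfolding S_def by auto
  have min: "L g \<le> L x" if "x \<in> carrier G" "0 < L x" for x
  proof (cases "L x \<le> L x0")
    case True
    hence "L x \<in> S" using that unfolding S_def by blast
    thus ?thesis using g(3) S by simp
  qed (use g(4) in simp)
  show thesis
  proof (rule that[OF g(1,2) _ Lint[OF g(1)]])
    fix x assume x: "x \<in> carrier G"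
    define k where "k = \<lfloor>L x / L g\<rfloor>"
    define y where "y = x \<otimes> g [^] (- k)"
    have y: "y \<in> carrier G" using x g by (simp add: y_def)
    have "L y = L x - of_int k * L g" using x g by (simp add: y_def mult Lint)
    moreover have "of_int k \<le> L x / L g" "L x / L g < of_int k + 1"
      unfolding k_def by linarith+
    hence "of_int k * L g \<le> L x" "L x < (of_int k + 1) * L g"
      using g(2) by (simp_all add: field_simps)
    ultimately have "0 \<le> L y" "L y < L g" by (simp_all add: algebra_simps)
    hence "L y = 0" using min[OF y] by linarith
    hence e: "x \<otimes> g [^] (- k) = \<one>" using inj[OF y] by (simp add: y_def)
    have "x = (x \<otimes> g [^] (- k)) \<otimes> g [^] k"
      using x g by (simp add: m_assoc int_pow_mult[symmetric])
    hence "x = g [^] k" using e g(1) by simp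
    thus "\<exists>k::int. x = g [^] k" ..
  qed
qed

text \<open>Among the cosets of 1, g and g g two must agree. If neither g nor g g lies in
  \<open>H\<close>, the last two agree, and cancelling puts g into \<open>H\<close>.\<close>

lemma (in group) rcosets_card_2_square:
  assumes H: "subgroup H G" "card (rcosets H) = 2" and g: "g \<in> carrier G" "g \<notin> H"
  shows "g \<otimes> g \<in> H"
proof (rule ccontr)
  interpret H: subgroup H G by (rule H)
  assume gg: "g \<otimes> g \<notin> H"
  have ne: "H #> g \<noteq> H" "H #> (g \<otimes> g) \<noteq> H"
    using coset_join1[of H g] coset_join1[of H "g \<otimes> g"] g gg H by auto
  have in_r: "H #> x \<in> rcosets H" if "x \<in> carrier G" for x using that by (auto simp: RCOSETS_def)
  have "H #> \<one> = H" using H.subset by (rule coset_mult_one)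
  hence "{H, H #> g, H #> (g \<otimes> g)} \<subseteq> rcosets H" using in_r[of \<one>] in_r[of g] in_r[of "g \<otimes> g"] g by auto
  moreover have "finite (rcosets H)" using H(2) card.infinite by fastforce
  ultimately have "card {H, H #> g, H #> (g \<otimes> g)} \<le> 2" using card_mono H(2) by metis
  hence eq: "H #> (g \<otimes> g) = H #> g" using ne by (auto simp: card_insert_if split: if_splits)
  have "g \<otimes> g \<in> H #> g" using rcos_self[of "g \<otimes> g" H] g H eq by auto
  then obtain h where h: "h \<in> H" "g \<otimes> g = h \<otimes> g" unfolding r_coset_def by blast
  hence "g = h" using g H.subset by (simp add: subset_iff)
  thus False using h g by simp
qed

text \<open>The right-hand side does not depend on \<open>H\<close>, so a cyclic group has at most
  one subgroup of index 2; this is how the orientation-preserving subgroup is recognised.\<close>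

lemma (in group) cyclic_index_2:
  assumes g: "g \<in> carrier G" "\<And>x. x \<in> carrier G \<Longrightarrow> \<exists>k::int. x = g [^] k"
    and H: "subgroup H G" "card (rcosets H) = 2"
  shows "H = {g [^] (2 * k) |k::int. True}"
proof -
  interpret H: subgroup H G by (rule H)
  have gH: "g \<notin> H"
  proof
    assume "g \<in> H"
    hence "carrier G \<subseteq> H" using g(2) subgroup_int_pow_closed[OF H(1)] by blast
    hence "H = carrier G" using H.subset by blast
    hence "rcosets H \<subseteq> {H}" using coset_join2 H(1) by (auto simp: RCOSETS_def)
    hence "card (rcosets H) \<le> card {H}" by (rule card_mono[rotated]) simp
    thus False using H(2) by simp
  qed
  have g2: "g [^] (2::int) \<in> H"
    using rcosets_card_2_square[OF H g(1) gH] int_pow_mult[OF g(1), of 1 1] g(1) by simp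
  have even: "g [^] (2 * k) \<in> H" for k :: int
    using subgroup_int_pow_closed[OF H(1) g2, of k] g(1) by (simp add: int_pow_pow)
  have odd: "g [^] (2 * k + 1) \<notin> H" for k :: int
  proof
    assume "g [^] (2 * k + 1) \<in> H"
    hence "g [^] (2 * (- k)) \<otimes> g [^] (2 * k + 1) \<in> H" using even[of "- k"] by blast
    moreover have "g [^] (2 * (- k)) \<otimes> g [^] (2 * k + 1) = g [^] (1::int)"
      using int_pow_mult[OF g(1), of "2 * (- k)" "2 * k + 1"] by simp
    ultimately show False using g(1) gH by simp
  qed
  show ?thesis
  proof (intro subset_antisym subsetI)
    fix x assume x: "x \<in> H"
    then obtain k :: int where k: "x = g [^] k" using g(2) H.subset by blast
    have "even k" using odd x k by (metis oddE)
    thus "x \<in> {g [^] (2 * k) |k::int. True}" using k by blast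
  qed (use even in auto)
qed

lemma (in group) card_rcosets_2I:
  assumes K: "subgroup K G" and r: "r \<in> carrier G" "r \<notin> K"
    and q: "\<And>x. x \<in> carrier G \<Longrightarrow> x \<notin> K \<Longrightarrow> x \<otimes> inv r \<in> K"
  shows "card (rcosets K) = 2"
proof -
  have Kc: "K \<subseteq> carrier G" using K subgroup.subset by blast
  have "rcosets K = {K, K #> r}"
  proof (intro subset_antisym subsetI)
    fix C assume "C \<in> rcosets K"
    then obtain x where x: "x \<in> carrier G" "C = K #> x" by (auto simp: RCOSETS_def)
    show "C \<in> {K, K #> r}"
    proof (cases "x \<in> K")
      case True
      thus ?thesis using coset_join2[of x K] x K by simp
    next
      case False
      have "x = (x \<otimes> inv r) \<otimes> r" using x r by (simp add: m_assoc)
      hence "x \<in> K #> r" using q[OF x(1) False] unfolding r_coset_def by blast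
      thus ?thesis using repr_independence[of x K r] x r K by simp
    qed
  next
    fix C assume C: "C \<in> {K, K #> r}"
    have "K #> \<one> = K" using Kc by (rule coset_mult_one)
    hence "K = K #> \<one>" ..
    hence "\<exists>x\<in>carrier G. C = K #> x" using C r one_closed by blast
    thus "C \<in> rcosets K" by (auto simp: RCOSETS_def)
  qed
  moreover have "K #> r \<noteq> K" using coset_join1[of K r] Kc r K by auto
  ultimately show ?thesis by simp
qed

section \<open>Pell's equation and quadratic irrationals\<close>

lemma irrational_linear_form:
  fixes \<theta> :: real
  assumes "\<theta> \<notin> \<rat>" "of_int u * \<theta> + of_int v = 0"
  shows "u = 0" "v = 0"
proof -
  show "u = 0"
  proof (rule ccontr)
    assume "u \<noteq> 0"
    hence "\<theta> = - of_int v / of_int u" using assms(2) by (simp add: field_simps)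
    thus False using assms(1) by auto
  qed
  thus "v = 0" using assms(2) by simp
qed

text \<open>Dirichlet approximation bounds h^2 - D k^2 = - (k \<theta> - h) (k \<theta> + h). Were
  the set finite, the distances |k \<theta> - h| would have a positive minimum by irrationality, and
  a finer approximation would undercut it.\<close>

lemma infinitely_many_small_norms:
  fixes \<theta> :: real and D :: int
  assumes irr: "\<theta> \<notin> \<rat>" and pos: "\<theta> > 0" and D: "\<theta>\<^sup>2 = of_int D"
  shows "infinite {(h :: int, k :: int). 0 \<le> h \<and> 0 < k \<and> \<bar>real_of_int (h\<^sup>2 - D * k\<^sup>2)\<bar> \<le> 2 * \<theta> + 1}"
proof
  define S where "S = {(h :: int, k :: int). 0 \<le> h \<and> 0 < k \<and> \<bar>real_of_int (h\<^sup>2 - D * k\<^sup>2)\<bar> \<le> 2 * \<theta> + 1}"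
  assume "finite {(h :: int, k :: int). 0 \<le> h \<and> 0 < k \<and> \<bar>real_of_int (h\<^sup>2 - D * k\<^sup>2)\<bar> \<le> 2 * \<theta> + 1}"
  hence fin: "finite S" unfolding S_def .
  have pos_S: "k > 0" if "(h, k) \<in> S" for h k using that by (simp add: S_def)
  have approx: "\<exists>h k. (h, k) \<in> S \<and> \<bar>of_int k * \<theta> - of_int h\<bar> < 1 / real N" if N: "N > 0" for N
  proof -
    obtain h k :: int where hk: "0 < k" "k \<le> int N" "\<bar>of_int k * \<theta> - of_int h\<bar> < 1 / real N"
      using Dirichlet_approx[OF N, of \<theta>] by blast
    have N1: "1 / real N \<le> 1" using N by simp
    hence d1: "\<bar>of_int k * \<theta> - of_int h\<bar> < 1" using hk(3) by linarith
    have k\<theta>: "of_int k * \<theta> > 0" using hk(1) pos by simp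
    hence "real_of_int h > -1" using d1 by linarith
    hence h: "h \<ge> 0" by linarith
    have "real_of_int (h\<^sup>2 - D * k\<^sup>2) = (of_int h)\<^sup>2 - \<theta>\<^sup>2 * (of_int k)\<^sup>2" by (simp add: D)
    also have "\<dots> = - ((of_int k * \<theta> - of_int h) * (of_int k * \<theta> + of_int h))"
      by (simp add: power2_eq_square algebra_simps)
    finally have "\<bar>real_of_int (h\<^sup>2 - D * k\<^sup>2)\<bar> = \<bar>of_int k * \<theta> - of_int h\<bar> * \<bar>of_int k * \<theta> + of_int h\<bar>"
      by (simp add: abs_mult)
    \<comment> \<open>The second factor uses k \<le> N and h < k \<theta> + 1.\<close>
    also have "\<dots> \<le> 1 / real N * (2 * real N * \<theta> + 1)"
    proof (rule mult_mono)
      have "of_int k * \<theta> \<le> real N * \<theta>" using hk(2) pos by (intro mult_right_mono) linarith+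
      thus "\<bar>of_int k * \<theta> + of_int h\<bar> \<le> 2 * real N * \<theta> + 1" using d1 h k\<theta> by linarith
    qed (use hk in auto)
    also have "\<dots> = 2 * \<theta> + 1 / real N" using N by (simp add: field_simps)
    also have "\<dots> \<le> 2 * \<theta> + 1" using N1 by simp
    finally have "(h, k) \<in> S" using hk(1) h unfolding S_def by simp
    thus ?thesis using hk(3) by blast
  qed
  define d where "d h k = \<bar>real_of_int k * \<theta> - real_of_int h\<bar>" for h k
  define E where "E = (\<lambda>p. d (fst p) (snd p)) ` S"
  have "S \<noteq> {}" using approx[OF zero_less_one] by blast
  hence E: "finite E" "E \<noteq> {}" unfolding E_def using fin by simp_all
  have dE: "d h k \<in> E" if "(h, k) \<in> S" for h k unfolding E_def by (rule image_eqI[OF _ that]) simp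
  have "e > 0" if eE: "e \<in> E" for e
  proof -
    obtain p where "p \<in> S" "e = d (fst p) (snd p)" using eE unfolding E_def by blast
    then obtain h k where hk: "(h, k) \<in> S" "e = d h k" by (metis prod.collapse)
    have "of_int k * \<theta> + of_int (- h) \<noteq> 0"
      using irrational_linear_form(1)[OF irr, of k "- h"] pos_S[OF hk(1)] by auto
    thus ?thesis unfolding hk(2) d_def by simp
  qed
  hence "Min E > 0" using E by simp
  then obtain N where N: "N > 0" "1 / real N < Min E"
    using ex_inverse_of_nat_less[of "Min E"] by (auto simp: inverse_eq_divide)
  obtain h k where hk: "(h, k) \<in> S" "d h k < 1 / real N" using approx[OF N(1)] unfolding d_def by blast
  have "Min E \<le> d h k" using Min_le[OF E(1) dE[OF hk(1)]] .
  thus False using hk(2) N(2) by linarith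
qed

lemma pell_solution:
  fixes \<theta> :: real and D :: int
  assumes irr: "\<theta> \<notin> \<rat>" and pos: "\<theta> > 0" and D: "\<theta>\<^sup>2 = of_int D"
  obtains x y :: int where "x\<^sup>2 - D * y\<^sup>2 = 1" "y \<noteq> 0"
proof -
  define S where "S = {(h :: int, k :: int). 0 \<le> h \<and> 0 < k \<and> \<bar>real_of_int (h\<^sup>2 - D * k\<^sup>2)\<bar> \<le> 2 * \<theta> + 1}"
  define nr where "nr = (\<lambda>h k :: int. h\<^sup>2 - D * k\<^sup>2)"
  \<comment> \<open>The pigeonhole key: the norm together with both coordinates modulo the norm. It
    takes finitely many values on \<open>S\<close>, so two distinct elements of \<open>S\<close>
    share it.\<close>
  define f where "f = (\<lambda>(h, k). (nr h k, h mod nr h k, k mod nr h k))"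
  define M where "M = \<lceil>2 * \<theta> + 1\<rceil>"
  have nr0: "nr h k \<noteq> 0" if "k > 0" for h k
  proof
    assume "nr h k = 0"
    hence "real_of_int (h\<^sup>2 - D * k\<^sup>2) = 0" by (simp only: nr_def of_int_0)
    hence "(of_int h)\<^sup>2 = (of_int k * \<theta>)\<^sup>2" by (simp add: D power_mult_distrib)
    hence "of_int h = of_int k * \<theta> \<or> of_int h = - (of_int k * \<theta>)" by (simp only: power2_eq_iff)
    hence "of_int k * \<theta> + of_int (- h) = 0 \<or> of_int k * \<theta> + of_int h = 0" by auto
    hence "k = 0" using irrational_linear_form[OF irr] by blast
    thus False using that by simp
  qed
  have "f s \<in> {-M..M} \<times> {-M..M} \<times> {-M..M}" if s: "s \<in> S" for s
  proof -
    obtain h k where hk: "s = (h, k)" by (cases s)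
    define a where "a = nr h k"
    have "\<bar>real_of_int a\<bar> \<le> 2 * \<theta> + 1" using s unfolding hk by (auto simp: S_def nr_def a_def)
    hence a: "\<bar>a\<bar> \<le> M" unfolding M_def by linarith
    have "a \<noteq> 0" unfolding a_def using s unfolding hk by (intro nr0) (simp add: S_def)
    hence "\<bar>x mod a\<bar> < \<bar>a\<bar>" for x by (rule abs_mod_less)
    from this[of h] this[of k] a have "\<bar>a\<bar> \<le> M" "\<bar>h mod a\<bar> \<le> M" "\<bar>k mod a\<bar> \<le> M" by linarith+
    thus ?thesis unfolding hk f_def prod.case a_def[symmetric] by (auto simp: abs_le_iff)
  qed
  hence "f ` S \<subseteq> {-M..M} \<times> {-M..M} \<times> {-M..M}" by blast
  hence "finite (f ` S)" by (rule finite_subset) simp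
  moreover have "infinite S" unfolding S_def by (rule infinitely_many_small_norms[OF assms])
  ultimately obtain s where s: "infinite {t \<in> S. f t = f s}"
    using pigeonhole_infinite by blast
  obtain h1 k1 where t1: "(h1, k1) \<in> S" "f (h1, k1) = f s"
    using infinite_imp_nonempty[OF s] by auto
  have "infinite ({t \<in> S. f t = f s} - {(h1, k1)})" using s by simp
  hence "{t \<in> S. f t = f s} - {(h1, k1)} \<noteq> {}" by (rule infinite_imp_nonempty)
  then obtain h2 k2 where t2: "(h2, k2) \<in> S" "f (h2, k2) = f s" "(h2, k2) \<noteq> (h1, k1)"
    by auto
  define N where "N = nr h1 k1"
  have "f (h1, k1) = f (h2, k2)" using t1 t2 by simp
  hence N: "N = h1\<^sup>2 - D * k1\<^sup>2" "N = h2\<^sup>2 - D * k2\<^sup>2" "h1 mod N = h2 mod N" "k1 mod N = k2 mod N"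
    by (auto simp: f_def N_def nr_def)
  have k: "k1 > 0" "k2 > 0" using t1 t2 by (auto simp: S_def)
  have N0: "N \<noteq> 0" unfolding N_def by (rule nr0[OF k(1)])
  have "N dvd h2 - h1" "N dvd k2 - k1" using N(3,4) by (metis mod_eq_dvd_iff)+
  then obtain u v where "h2 - h1 = N * u" "k2 - k1 = N * v" by (elim dvdE)
  hence uv: "h2 = h1 + N * u" "k2 = k1 + N * v" by simp_all
  \<comment> \<open>x + y \<theta> is the quotient (h2 + k2 \<theta>) / (h1 + k1 \<theta>). Equal
    norms give it norm 1, and the congruences make it integral.\<close>
  define x y where "x = 1 + h1 * u - D * k1 * v" and "y = h1 * v - k1 * u"
  have "N * x = (h1\<^sup>2 - D * k1\<^sup>2) + N * (h1 * u - D * k1 * v)"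
    unfolding x_def N(1)[symmetric] by (simp add: algebra_simps)
  hence Nx: "N * x = h1 * h2 - D * k1 * k2" unfolding uv
    by (simp add: power2_eq_square algebra_simps)
  have Ny: "N * y = h1 * k2 - h2 * k1" unfolding y_def uv by (simp add: algebra_simps)
  have "N\<^sup>2 * (x\<^sup>2 - D * y\<^sup>2) = (N * x)\<^sup>2 - D * (N * y)\<^sup>2" by (simp add: power2_eq_square algebra_simps)
  also have "\<dots> = (h1\<^sup>2 - D * k1\<^sup>2) * (h2\<^sup>2 - D * k2\<^sup>2)"
    unfolding Nx Ny by (simp add: power2_eq_square algebra_simps)
  also have "\<dots> = N\<^sup>2 * 1" unfolding N(1)[symmetric] N(2)[symmetric] by (simp add: power2_eq_square)
  finally have "x\<^sup>2 - D * y\<^sup>2 = 1" using N0 by simp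
  \<comment> \<open>For y = 0 the two pairs would be proportional with equal norms and positive
    second entries, hence equal.\<close>
  moreover have "y \<noteq> 0"
  proof
    assume "y = 0"
    hence e: "h1 * k2 = h2 * k1" using Ny by simp
    have "N * k2\<^sup>2 = (h1 * k2)\<^sup>2 - D * k1\<^sup>2 * k2\<^sup>2" by (subst N(1)) (simp add: power2_eq_square algebra_simps)
    also have "\<dots> = N * k1\<^sup>2" unfolding e by (subst N(2)) (simp add: power2_eq_square algebra_simps)
    finally have "k2\<^sup>2 = k1\<^sup>2" using N0 by simp
    hence "k2 = k1" using k by (auto simp: power2_eq_iff)
    moreover from this have "h1 = h2" using e k by simp
    ultimately show False using t2(3) by simp
  qed
  ultimately show thesis by (rule that)
qed

text \<open>If the quadratic had a rational root, \<alpha> would be that root or the other one,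
  which is then rational too. Without linear factors a quadratic is irreducible.\<close>

lemma algebraic_of_degree_2I:
  fixes \<alpha> :: real and a b c :: int
  assumes irr: "\<alpha> \<notin> \<rat>" and a: "a \<noteq> 0" and root: "of_int a * \<alpha>\<^sup>2 + of_int b * \<alpha> + of_int c = 0"
  shows "algebraic_of_degree 2 \<alpha>"
proof -
  define p :: "rat poly" where "p = [:of_int c, of_int b, of_int a:]"
  have p: "degree p = 2" "p \<noteq> 0" using a by (simp_all add: p_def)
  have noroot: "poly p r \<noteq> 0" for r
  proof
    assume "poly p r = 0"
    hence "of_int a * r\<^sup>2 + of_int b * r + of_int c = 0"
      by (simp add: p_def power2_eq_square algebra_simps)
    hence "real_of_rat (of_int a * r\<^sup>2 + of_int b * r + of_int c) = 0" by (simp only: of_rat_0)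
    hence r: "of_int a * (of_rat r)\<^sup>2 + of_int b * of_rat r + of_int c = (0::real)"
      by (simp add: of_rat_add of_rat_mult of_rat_power)
    have "(\<alpha> - of_rat r) * (of_int a * (\<alpha> + of_rat r) + of_int b) =
      (of_int a * \<alpha>\<^sup>2 + of_int b * \<alpha> + of_int c) - (of_int a * (of_rat r)\<^sup>2 + of_int b * of_rat r + of_int c)"
      by (simp add: power2_eq_square algebra_simps)
    hence "(\<alpha> - of_rat r) * (of_int a * (\<alpha> + of_rat r) + of_int b) = 0" unfolding root r by simp
    hence "\<alpha> - of_rat r = 0 \<or> of_int a * (\<alpha> + of_rat r) + of_int b = 0" by simp
    hence "\<alpha> = of_rat r \<or> \<alpha> = - of_int b / of_int a - of_rat r"
      using a by (auto simp: field_simps)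
    moreover have "real_of_rat r \<in> \<rat>" "- of_int b / of_int a - real_of_rat r \<in> \<rat>" by simp_all
    ultimately show False using irr by metis
  qed
  have lin: "\<exists>r. poly u r = 0" if u1: "degree u = 1" for u :: "rat poly"
  proof -
    obtain t s where u: "u = [:s, t:]" "t \<noteq> 0" by (rule degree1_coeffs[OF u1])
    thus ?thesis unfolding u(1) by (intro exI[of _ "- s / t"]) simp
  qed
  have "irreducible p"
  proof (rule irreducibleI)
    fix u v assume uv: "p = u * v"
    hence n0: "u \<noteq> 0" "v \<noteq> 0" using p by auto
    hence "degree u + degree v = 2" using uv p by (simp add: degree_mult_eq)
    moreover have "degree u \<noteq> 1" using lin[of u] noroot uv by auto
    ultimately have "degree u = 0 \<or> degree v = 0" by linarith
    thus "is_unit u \<or> is_unit v" using n0 by (simp add: is_unit_iff_degree)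
  qed (use p in \<open>auto simp: is_unit_iff_degree\<close>)
  moreover have "poly (map_poly of_rat p) \<alpha> = 0"
    using root by (simp add: p_def map_poly_pCons power2_eq_square algebra_simps)
  ultimately show ?thesis unfolding algebraic_of_degree_def using p(1) by blast
qed

section \<open>Irrational parameter\<close>

text \<open>A positive unit \<open>\<lambda>\<close> of the multiplier ring of the lattice \<open>\<int>\<alpha> + \<int>\<close>, together with the integer
  matrix of multiplication by \<open>\<lambda>\<close>.\<close>

definition lattice_unit :: "real \<Rightarrow> real \<Rightarrow> int \<Rightarrow> int \<Rightarrow> int \<Rightarrow> int \<Rightarrow> bool" where
  "lattice_unit \<alpha> l m n m' n' \<longleftrightarrow> l > 0 \<and> l * \<alpha> = of_int m * \<alpha> + of_int n \<and>
     l = of_int m' * \<alpha> + of_int n' \<and> (m * n' - m' * n)\<^sup>2 = 1"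

text \<open>Multiplication by \<open>l\<close> scales Ford curvatures by l^2, hence lengths by 1 /
  l^2. X goes to the Ford circle of (m, n); its contact point 2 n / (\<alpha> (m \<alpha> + n)),
  with m \<alpha> + n = l \<alpha>, is the translation. The determinant decides on the horizontal
  reflection.\<close>

definition unit_sim :: "real \<Rightarrow> real \<Rightarrow> int \<Rightarrow> int \<Rightarrow> int \<Rightarrow> int \<Rightarrow> real^2 \<Rightarrow> real^2" where
  "unit_sim \<alpha> l m n m' n' =
     axis_sim (of_int (m * n' - m' * n)) 1 (1 / l\<^sup>2) (2 * of_int n / (\<alpha>\<^sup>2 * l)) 0"

text \<open>Read off from the map alone, so that no choice of a unit or a matrix enters.\<close>

definition log_scale :: "(real^2 \<Rightarrow> real^2) \<Rightarrow> real" where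
  "log_scale \<Phi> = - ln (\<Phi> (vector [0, 1]) $ 2)"

lemma log_scale_axis_sim: "\<mu> > 0 \<Longrightarrow> log_scale (axis_sim e 1 \<mu> t 0) = - ln \<mu>"
  by (simp add: log_scale_def axis_sim_def)

lemma is_sign_of_int: "(k :: int)\<^sup>2 = 1 \<Longrightarrow> is_sign (of_int k)"
  by (auto simp: is_sign_def power2_eq_1_iff)

text \<open>The integer matrix has the eigenvector (\<alpha>, 1) with eigenvalue \<open>l\<close>,
  so \<open>l\<close> is a root of its characteristic polynomial.\<close>

lemma lattice_unit_char_poly:
  assumes "\<alpha> \<noteq> 0" "lattice_unit \<alpha> l m n m' n'"
  shows "l\<^sup>2 - of_int (m + n') * l + of_int (m * n' - m' * n) = 0"
proof -
  have l: "l * \<alpha> = of_int m * \<alpha> + of_int n" "l = of_int m' * \<alpha> + of_int n'"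
    using assms(2) by (auto simp: lattice_unit_def)
  have "(l - of_int m) * \<alpha> = of_int n" "l - of_int n' = of_int m' * \<alpha>"
    using l by (simp_all add: algebra_simps)
  hence "(l - of_int m) * (l - of_int n') = of_int n * of_int m'"
    by (metis mult.assoc mult.left_commute mult.commute)
  thus ?thesis by (simp add: power2_eq_square algebra_simps)
qed

text \<open>For l \<ge> 1 the trace is l + e / l with e = 1 or e = -1, so a bound on
  \<open>l\<close> bounds the trace and leaves finitely many characteristic polynomials.\<close>

lemma finite_lattice_units:
  assumes "\<alpha> \<noteq> 0"
  shows "finite {l. \<exists>m n m' n'. lattice_unit \<alpha> l m n m' n' \<and> 1 \<le> l \<and> l \<le> c}"
proof -
  define N where "N = \<lceil>c\<rceil> + 1"
  define R where "R = (\<lambda>(T :: int, e :: int). {x :: real. poly [:of_int e, - of_int T, 1:] x = 0})"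
  have "{l. \<exists>m n m' n'. lattice_unit \<alpha> l m n m' n' \<and> 1 \<le> l \<and> l \<le> c} \<subseteq> (\<Union>p \<in> {-N..N} \<times> {-1..1}. R p)"
  proof safe
    fix l m n m' n' assume l: "lattice_unit \<alpha> l m n m' n'" "1 \<le> l" "l \<le> c"
    define T e where "T = m + n'" "e = m * n' - m' * n"
    note Te = this
    have ch: "l\<^sup>2 - of_int T * l + of_int e = 0" using lattice_unit_char_poly[OF assms l(1)] by (simp add: Te)
    have e: "e = 1 \<or> e = -1" using l(1) by (simp add: lattice_unit_def Te power2_eq_1_iff)
    have "of_int T = l + of_int e / l" using ch l(2) by (simp add: field_simps power2_eq_square)
    moreover have "1 / l \<le> 1" "0 < 1 / l" using l(2) by simp_all
    hence "\<bar>of_int e / l\<bar> \<le> 1" using e by auto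
    ultimately have "\<bar>real_of_int T\<bar> \<le> c + 1" using l by linarith
    hence "T \<in> {-N..N}" unfolding N_def by simp linarith
    moreover have "l \<in> R (T, e)" using ch by (simp add: R_def power2_eq_square algebra_simps)
    moreover have "e \<in> {-1..1}" using e by auto
    ultimately show "l \<in> (\<Union>p \<in> {-N..N} \<times> {-1..1}. R p)" by blast
  qed
  moreover have "finite (R p)" for p
  proof (cases p)
    case (Pair T e)
    show ?thesis unfolding Pair R_def prod.case by (rule poly_roots_finite) simp
  qed
  hence "finite (\<Union>p \<in> {-N..N} \<times> {-1..1}. R p)" by (intro finite_UN_I) auto
  ultimately show ?thesis by (rule finite_subset)
qed

context
  fixes \<alpha> :: real
  assumes pos: "\<alpha> > 0" and irr: "\<alpha> \<notin> \<rat>"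
begin

text \<open>X and Y go to the Ford circles of the two rows of the matrix, and the axis is fixed; the
  rows being unimodular, this is another base of the same orbit.\<close>

lemma unit_sim_in_Symm:
  assumes u: "lattice_unit \<alpha> l m n m' n'"
  shows "unit_sim \<alpha> l m n m' n' \<in> carrier (Symm (packing \<alpha>))"
proof -
  define e where "e = m * n' - m' * n"
  have l: "l > 0" "l * \<alpha> = of_int m * \<alpha> + of_int n" "l = of_int m' * \<alpha> + of_int n'" "e\<^sup>2 = 1"
    using u by (auto simp: lattice_unit_def e_def)
  define t where "t = 2 * of_int n / (\<alpha>\<^sup>2 * l)"
  define f where "f = axis_act (of_int e) 1 (1 / l\<^sup>2) t 0"
  have s: "is_sign (of_int e)" "is_sign 1" "1 / l\<^sup>2 > 0" using is_sign_of_int l by (auto simp: is_sign_def)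
  have f: "linear f" "\<And>v w. lorentz (f v) (f w) = lorentz v w"
    unfolding f_def using lorentz_axis_act[OF s] by (auto simp: axis_act_eq linear_sim_act)
  have D: "descartes (ford_quad \<alpha> 1 0 0 1)" "descartes (ford_quad \<alpha> m n m' n')"
    using descartes_ford_quad[OF pos] l(4) by (simp_all add: e_def)
  have e2: "real_of_int e * of_int e = 1" using is_sign_square[OF s(1)] .
  \<comment> \<open>Cramer's rule for the two equations that express l \<alpha> and l; here the
    determinant turns into the horizontal sign.\<close>
  have key: "l * (\<alpha> * of_int n' - of_int n) = of_int e * \<alpha>"
  proof -
    have "l * (\<alpha> * of_int n' - of_int n) = (l * \<alpha>) * of_int n' - l * of_int n" by (simp add: algebra_simps)
    also have "\<dots> = (of_int m * \<alpha> + of_int n) * of_int n' - (of_int m' * \<alpha> + of_int n') * of_int n"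
      using l(2,3) by simp
    also have "\<dots> = of_int e * \<alpha>" by (simp add: e_def algebra_simps)
    finally show ?thesis .
  qed
  have eqI: "v = w" if "fst v = fst w" "fst v \<noteq> 0" "snd (snd v) = snd (snd w)" "lorentz v v = 1" "lorentz w w = 1" for v w
    using that by (cases v; cases w) (auto dest: lorentz_self_eqI simp del: lorentz.simps)
  have 0: "f (ford \<alpha> 1 0) = ford \<alpha> m n"
  proof (rule eqI)
    show "snd (snd (f (ford \<alpha> 1 0))) = snd (snd (ford \<alpha> m n))"
      unfolding f_def ford_def axis_act_simps l(2)[symmetric] t_def using pos l(1)
      by (simp add: field_simps power2_eq_square)
    show "fst (f (ford \<alpha> 1 0)) = fst (ford \<alpha> m n)" "fst (f (ford \<alpha> 1 0)) \<noteq> 0"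
      unfolding f_def ford_def axis_act_simps l(2)[symmetric] using pos l(1)
      by (simp_all add: power_mult_distrib)
  qed (simp_all add: f(2) lorentz_ford[OF pos])
  have 1: "f (ford \<alpha> 0 1) = ford \<alpha> m' n'"
  proof (rule eqI)
    have "of_int e * (2 / \<alpha>) + l\<^sup>2 * t = 2 / \<alpha> * of_int n' * l"
    proof -
      have "\<alpha>\<^sup>2 * (of_int e * (2 / \<alpha>) + l\<^sup>2 * t) = 2 * (of_int e * \<alpha>) + 2 * of_int n * l"
        using pos l(1) by (simp add: t_def field_simps power2_eq_square)
      also have "\<dots> = \<alpha>\<^sup>2 * (2 / \<alpha> * of_int n' * l)"
        unfolding key[symmetric] using pos by (simp add: field_simps power2_eq_square)
      finally show ?thesis using pos by (metis mult_cancel_left power_not_zero less_irrefl)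
    qed
    thus "snd (snd (f (ford \<alpha> 0 1))) = snd (snd (ford \<alpha> m' n'))"
      unfolding f_def ford_def axis_act_simps l(3)[symmetric] by simp
    show "fst (f (ford \<alpha> 0 1)) = fst (ford \<alpha> m' n')" "fst (f (ford \<alpha> 0 1)) \<noteq> 0"
      unfolding f_def ford_def axis_act_simps l(3)[symmetric] using pos l(1) by simp_all
  qed (simp_all add: f(2) lorentz_ford[OF pos])
  have 2: "f vec_L = vec_L" by (simp add: f_def axis_act_vec_L) (simp add: vec_L_def)
  have "f ` orbit_vecs (ford_quad \<alpha> 1 0 0 1) = orbit_vecs (ford_quad \<alpha> m n m' n')"
    using 0 1 2 by (intro isometry_orbit_vecs[OF f D]) (simp_all add: ford_quad_def)
  also have "\<dots> = packing_vecs \<alpha>" unfolding packing_vecs_def by (rule orbit_vecs_ford_quad) (use l(4) in \<open>simp add: e_def\<close>)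
  finally have "f ` packing_vecs \<alpha> = packing_vecs \<alpha>" by (simp add: packing_vecs_def)
  thus ?thesis
    unfolding unit_sim_def e_def[symmetric] t_def[symmetric]
    using pos s f_def by (intro axis_sim_in_Symm) auto
qed

text \<open>A second line would touch the axis at infinity and so be a Ford circle of curvature 0,
  which requires m \<alpha> + n = 0.\<close>

lemma packing_vecs_line_irrational:
  assumes "v \<in> packing_vecs \<alpha>" "fst v = 0"
  shows "v = vec_L"
proof -
  consider "v = vec_L" | b c x y where "v = (b, c, x, y)" "b > 0" | c where "v = (0, c, 0, 1)"
    using packing_vecs_cases[OF pos assms(1)] by metis
  thus ?thesis
  proof cases
    case (3 c)
    hence "lorentz v vec_L = -1" by simp
    then obtain m n where mn: "coprime m n" "v = ford \<alpha> m n"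
      using tangent_to_L[OF pos assms(1)] by blast
    hence "of_int m * \<alpha> + of_int n = 0" using assms(2) by (simp add: ford_def)
    hence "m = 0" "n = 0" using irrational_linear_form[OF irr] by blast+
    thus ?thesis using mn by simp
  qed (use assms(2) in auto)
qed

text \<open>The images of X and Y touch the axis, which is fixed, so they are Ford circles. Their
  curvatures give the rows of the matrix up to sign, their mutual product gives the square of its
  determinant, and their centres give translation and reflection.\<close>

lemma Symm_unit_sim:
  assumes "\<Phi> \<in> carrier (Symm (packing \<alpha>))"
  shows "\<exists>l m n m' n'. lattice_unit \<alpha> l m n m' n' \<and> \<Phi> = unit_sim \<alpha> l m n m' n'"
proof -
  obtain e d \<mu> t s where 1: "is_sign e" "is_sign d" "\<mu> > 0" "\<Phi> = axis_sim e d \<mu> t s"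
    "axis_act e d \<mu> t s ` packing_vecs \<alpha> = packing_vecs \<alpha>"
    using Symm_packing_axis_sim[OF pos assms] by metis
  define f where "f = axis_act e d \<mu> t s"
  have mem: "f v \<in> packing_vecs \<alpha>" if "v \<in> packing_vecs \<alpha>" for v using 1(5) that unfolding f_def by blast
  have lorf: "lorentz (f v) (f w) = lorentz v w" for v w unfolding f_def by (rule lorentz_axis_act[OF 1(1-3)])
  have fL: "f vec_L = vec_L" by (rule packing_vecs_line_irrational[OF mem[OF vec_L_in_packing_vecs]]) (simp add: f_def axis_act_vec_L)
  hence ds: "d = 1" "s = 0" by (auto simp: f_def axis_act_vec_L) (auto simp: vec_L_def)
  have tang: "lorentz (f (ford \<alpha> a b)) vec_L = -1" for a b using lorf[of "ford \<alpha> a b" vec_L] unfolding fL by simp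
  define l where "l = 1 / sqrt \<mu>"
  have l: "l > 0" "1 / \<mu> = l\<^sup>2" "\<mu> = 1 / l\<^sup>2" using 1(3) by (simp_all add: l_def power_divide)
  \<comment> \<open>Curvature determines the lattice element up to sign only; \<open>ford\<close> is
    even, so the sign can be chosen to match \<open>r\<close>.\<close>
  have ford_sign: "\<exists>a' b'. ford \<alpha> a b = ford \<alpha> a' b' \<and> of_int a' * \<alpha> + of_int b' = r"
    if "(of_int a * \<alpha> + of_int b)\<^sup>2 = r\<^sup>2" for a b r
  proof -
    have "of_int a * \<alpha> + of_int b = r \<or> of_int (- a) * \<alpha> + of_int (- b) = r"
      using that by (auto simp: power2_eq_iff)
    thus ?thesis using ford_minus[of \<alpha> a b] by metis
  qed
  obtain m n where X: "f (ford \<alpha> 1 0) = ford \<alpha> m n"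
    by (rule tangent_to_L[OF pos mem[OF ford_in_packing_vecs[of 1 0]] tang]) simp
  have "fst (f (ford \<alpha> 1 0)) = (l * \<alpha>)\<^sup>2"
    using l(2) by (simp add: f_def ford_def axis_act_simps power_mult_distrib divide_inverse mult.commute)
  hence "(of_int m * \<alpha> + of_int n)\<^sup>2 = (l * \<alpha>)\<^sup>2" unfolding X by (simp add: ford_def)
  then obtain m n where X: "f (ford \<alpha> 1 0) = ford \<alpha> m n" "of_int m * \<alpha> + of_int n = l * \<alpha>"
    using ford_sign X by metis
  obtain m' n' where Y: "f (ford \<alpha> 0 1) = ford \<alpha> m' n'"
    by (rule tangent_to_L[OF pos mem[OF ford_in_packing_vecs[of 0 1]] tang]) simp
  have "fst (f (ford \<alpha> 0 1)) = l\<^sup>2"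
    using l(2) by (simp add: f_def ford_def axis_act_simps)
  hence "(of_int m' * \<alpha> + of_int n')\<^sup>2 = l\<^sup>2" unfolding Y by (simp add: ford_def)
  then obtain m' n' where Y: "f (ford \<alpha> 0 1) = ford \<alpha> m' n'" "of_int m' * \<alpha> + of_int n' = l"
    using ford_sign Y by metis
  have "lorentz (ford \<alpha> m n) (ford \<alpha> m' n') = -1"
    unfolding X(1)[symmetric] Y(1)[symmetric] lorf by (simp add: lorentz_ford[OF pos])
  hence "(real_of_int (m * n' - m' * n))\<^sup>2 = 1" unfolding lorentz_ford[OF pos] by simp
  hence det: "(m * n' - m' * n)\<^sup>2 = 1" by (metis of_int_eq_1_iff of_int_power)
  have u: "lattice_unit \<alpha> l m n m' n'" unfolding lattice_unit_def using l(1) X(2) Y(2) det by simp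
  have "fst (snd (snd (f (ford \<alpha> 1 0)))) = l\<^sup>2 * \<alpha>\<^sup>2 * t"
    using l(2) by (simp add: f_def ford_def axis_act_simps divide_inverse mult.commute)
  hence "l\<^sup>2 * \<alpha>\<^sup>2 * t = 2 / \<alpha> * of_int n * (l * \<alpha>)" unfolding X(1) by (simp add: ford_def X(2))
  hence t: "t = 2 * of_int n / (\<alpha>\<^sup>2 * l)" using pos l(1) by (simp add: field_simps power2_eq_square)
  have "fst (snd (snd (f (ford \<alpha> 0 1)))) = e * (2 / \<alpha>) + l\<^sup>2 * t"
    using l(2) by (simp add: f_def ford_def axis_act_simps)
  hence "e * (2 / \<alpha>) + l\<^sup>2 * t = 2 / \<alpha> * of_int n' * l" unfolding Y(1) by (simp add: ford_def Y(2))
  hence "\<alpha> * (e * \<alpha> + l * of_int n) = \<alpha> * (l * (\<alpha> * of_int n'))" using pos l(1) unfolding t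
    by (simp add: field_simps power2_eq_square)
  hence "e * \<alpha> + l * of_int n = l * (\<alpha> * of_int n')" using pos by (metis mult_cancel_left less_irrefl)
  hence "e * \<alpha> = l * (\<alpha> * of_int n' - of_int n)" by (simp add: algebra_simps)
  also have "\<dots> = (l * \<alpha>) * of_int n' - l * of_int n" by (simp add: algebra_simps)
  also have "\<dots> = of_int (m * n' - m' * n) * \<alpha>"
    unfolding X(2)[symmetric] by (subst Y(2)[symmetric]) (simp add: algebra_simps)
  finally have "e = of_int (m * n' - m' * n)" using pos by simp
  hence "\<Phi> = unit_sim \<alpha> l m n m' n'" unfolding 1(4) unit_sim_def ds t l(3) by simp
  thus ?thesis using u by blast
qed

lemma log_scale_unit_sim: "l > 0 \<Longrightarrow> log_scale (unit_sim \<alpha> l m n m' n') = 2 * ln l"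
  unfolding unit_sim_def by (subst log_scale_axis_sim) (simp_all add: ln_div ln_realpow)

lemma orientation_preserving_unit_sim:
  assumes "lattice_unit \<alpha> l m n m' n'"
  shows "orientation_preserving_similarity (unit_sim \<alpha> l m n m' n') \<longleftrightarrow> m * n' - m' * n = 1"
proof -
  have s: "is_sign (of_int (m * n' - m' * n))" "is_sign 1" "1 / l\<^sup>2 > 0"
    using assms is_sign_of_int[of "m * n' - m' * n"] by (simp_all only: lattice_unit_def is_sign_def) simp_all
  show ?thesis unfolding unit_sim_def orientation_preserving_axis_sim[OF s] by linarith
qed

lemma unit_sim_one:
  assumes "lattice_unit \<alpha> 1 m n m' n'"
  shows "unit_sim \<alpha> 1 m n m' n' = id"
proof -
  have "of_int (m - 1) * \<alpha> + of_int n = 0" "of_int m' * \<alpha> + of_int (n' - 1) = 0"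
    using assms by (auto simp: lattice_unit_def algebra_simps)
  hence "m - 1 = 0" "n = 0" "m' = 0" "n' - 1 = 0" using irrational_linear_form[OF irr] by blast+
  thus ?thesis by (simp add: unit_sim_def axis_sim_def fun_eq_iff vec2_eq_iff)
qed

lemma log_scale_mult:
  assumes "\<Phi> \<in> carrier (Symm (packing \<alpha>))" "\<Psi> \<in> carrier (Symm (packing \<alpha>))"
  shows "log_scale (\<Phi> \<circ> \<Psi>) = log_scale \<Phi> + log_scale \<Psi>"
proof -
  obtain l m n m' n' where 1: "lattice_unit \<alpha> l m n m' n'" "\<Phi> = unit_sim \<alpha> l m n m' n'"
    using Symm_unit_sim[OF assms(1)] by blast
  obtain k a b a' b' where 2: "lattice_unit \<alpha> k a b a' b'" "\<Psi> = unit_sim \<alpha> k a b a' b'"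
    using Symm_unit_sim[OF assms(2)] by blast
  have "l > 0" "k > 0" using 1 2 by (auto simp: lattice_unit_def)
  thus ?thesis unfolding 1(2) 2(2) unit_sim_def axis_sim_comp
    by (simp add: log_scale_axis_sim ln_mult ln_div)
qed

text \<open>The kernel of \<open>log_scale\<close> is trivial because, by irrationality, the unit 1
  has only the identity matrix. Its positive values are locally finite because they are 2 ln l for
  lattice units l in a bounded range.\<close>

lemma Symm_cyclic:
  assumes "lattice_unit \<alpha> l0 a b a' b'" "l0 \<noteq> 1"
  obtains g where "g \<in> carrier (Symm (packing \<alpha>))"
    "\<And>x. x \<in> carrier (Symm (packing \<alpha>)) \<Longrightarrow> \<exists>k::int. x = g [^]\<^bsub>Symm (packing \<alpha>)\<^esub> k"
    "inj (\<lambda>k::int. g [^]\<^bsub>Symm (packing \<alpha>)\<^esub> k)"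
proof -
  let ?G = "Symm (packing \<alpha>)"
  interpret group ?G by (rule group_Symm)
  obtain g where g: "g \<in> carrier ?G" "log_scale g > 0" "\<And>x. x \<in> carrier ?G \<Longrightarrow> \<exists>k::int. x = g [^]\<^bsub>?G\<^esub> k"
    "\<And>k::int. log_scale (g [^]\<^bsub>?G\<^esub> k) = of_int k * log_scale g"
  proof (rule discrete_real_embedding_cyclic)
    fix x y assume "x \<in> carrier ?G" "y \<in> carrier ?G"
    thus "log_scale (x \<otimes>\<^bsub>?G\<^esub> y) = log_scale x + log_scale y"
      using log_scale_mult by (simp add: Symm_def)
  next
    fix x assume x: "x \<in> carrier ?G" "log_scale x = 0"
    obtain l m n m' n' where 1: "lattice_unit \<alpha> l m n m' n'" "x = unit_sim \<alpha> l m n m' n'"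
      using Symm_unit_sim[OF x(1)] by blast
    have "l > 0" using 1 by (simp add: lattice_unit_def)
    hence "l = 1" using x(2) unfolding 1(2) by (simp add: log_scale_unit_sim)
    thus "x = \<one>\<^bsub>?G\<^esub>" using unit_sim_one 1 by (simp add: Symm_def)
  next
    fix c :: real
    let ?U = "{l. \<exists>m n m' n'. lattice_unit \<alpha> l m n m' n' \<and> 1 \<le> l \<and> l \<le> exp (c / 2)}"
    have "{log_scale x |x. x \<in> carrier ?G \<and> 0 < log_scale x \<and> log_scale x \<le> c} \<subseteq> (\<lambda>l. 2 * ln l) ` ?U"
    proof safe
      fix x assume x: "x \<in> carrier ?G" "0 < log_scale x" "log_scale x \<le> c"
      obtain l m n m' n' where 1: "lattice_unit \<alpha> l m n m' n'" "x = unit_sim \<alpha> l m n m' n'"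
        using Symm_unit_sim[OF x(1)] by blast
      have l: "l > 0" using 1 by (simp add: lattice_unit_def)
      have eq: "log_scale x = 2 * ln l" unfolding 1(2) by (rule log_scale_unit_sim[OF l])
      have "0 < ln l" "ln l \<le> c / 2" using x(2,3) eq by simp_all
      hence "exp 0 \<le> exp (ln l)" "exp (ln l) \<le> exp (c / 2)" by (simp_all only: exp_le_cancel_iff)
      hence "1 \<le> l" "l \<le> exp (c / 2)" unfolding exp_ln[OF l] by simp_all
      thus "log_scale x \<in> (\<lambda>l. 2 * ln l) ` ?U" using eq 1(1) by blast
    qed
    moreover have "finite ((\<lambda>l. 2 * ln l) ` ?U)"
      using pos by (intro finite_imageI finite_lattice_units) simp
    ultimately show "finite {log_scale x |x. x \<in> carrier ?G \<and> 0 < log_scale x \<and> log_scale x \<le> c}"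
      by (rule finite_subset)
  next
    have "l0 > 0" using assms(1) by (simp add: lattice_unit_def)
    hence "log_scale (unit_sim \<alpha> l0 a b a' b') \<noteq> 0" using assms(2) by (simp add: log_scale_unit_sim)
    thus "\<exists>x\<in>carrier ?G. log_scale x \<noteq> 0" using unit_sim_in_Symm[OF assms(1)] by blast
  qed (rule that)
  have "inj (\<lambda>k::int. g [^]\<^bsub>?G\<^esub> k)"
  proof (rule injI)
    fix j k :: int assume "g [^]\<^bsub>?G\<^esub> j = g [^]\<^bsub>?G\<^esub> k"
    hence "of_int j * log_scale g = of_int k * log_scale g" using g(4) by metis
    thus "j = k" using g(2) by simp
  qed
  thus thesis using that g by blast
qed

text \<open>2 A \<alpha> + B is a square root of D, so the number inside the absolute value has norm
  e. Multiplication by it preserves Z \<alpha> + Z because x and y B have the same parity; negating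
  both x and y makes it positive.\<close>

lemma quadratic_units:
  fixes A B C D :: int
  assumes root: "of_int A * \<alpha>\<^sup>2 + of_int B * \<alpha> + of_int C = 0" and D: "D = B\<^sup>2 - 4 * A * C"
    and sol: "x\<^sup>2 - D * y\<^sup>2 = 4 * e" "e\<^sup>2 = 1"
  shows "\<exists>m n m' n'. m * n' - m' * n = e \<and>
    lattice_unit \<alpha> \<bar>(of_int x + of_int y * (2 * of_int A * \<alpha> + of_int B)) / 2\<bar> m n m' n'"
proof -
  have main: "\<exists>m n m' n'. m * n' - m' * n = e \<and> lattice_unit \<alpha> l m n m' n'"
    if l: "l = (of_int x + of_int y * (2 * of_int A * \<alpha> + of_int B)) / 2" "l > 0" "x\<^sup>2 - D * y\<^sup>2 = 4 * e" for l x y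
  proof -
    have "even (x\<^sup>2 - B\<^sup>2 * y\<^sup>2)"
    proof -
      have "x\<^sup>2 - B\<^sup>2 * y\<^sup>2 = 2 * (2 * e - 2 * (A * C * y\<^sup>2))" using l(3) unfolding D by (simp add: algebra_simps)
      thus ?thesis by simp
    qed
    hence "even (x - y * B)" by auto
    then obtain k where k: "x - y * B = 2 * k" by (elim evenE)
    \<comment> \<open>The second row expresses l; the first comes from l \<alpha> on replacing A
      \<alpha>^2 by - B \<alpha> - C.\<close>
    define m n m' n' where "m = k" "n = - (C * y)" "m' = A * y" "n' = k + y * B"
    note d = this
    have x: "x = 2 * k + y * B" using k by simp
    have "4 * (m * n' - m' * n) = x\<^sup>2 - D * y\<^sup>2"
      unfolding d D x by (simp add: power2_eq_square algebra_simps)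
    hence det: "m * n' - m' * n = e" using l(3) by simp
    have l1: "l = of_int m' * \<alpha> + of_int n'" unfolding l(1) d x by (simp add: field_simps)
    have "l * \<alpha> - (of_int m * \<alpha> + of_int n) = of_int y * (of_int A * \<alpha>\<^sup>2 + of_int B * \<alpha> + of_int C)"
      unfolding l1 d by (simp add: power2_eq_square algebra_simps)
    hence "l * \<alpha> = of_int m * \<alpha> + of_int n" unfolding root by simp
    hence "lattice_unit \<alpha> l m n m' n'" unfolding lattice_unit_def det using l1 l(2) sol(2) by simp
    thus ?thesis using det by blast
  qed
  define l where "l = (of_int x + of_int y * (2 * of_int A * \<alpha> + of_int B)) / 2"
  have "l \<noteq> 0"
  proof
    assume "l = 0"
    hence "real_of_int x = - (of_int y * (2 * of_int A * \<alpha> + of_int B))" by (simp add: l_def)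
    hence "(real_of_int x)\<^sup>2 = (of_int y)\<^sup>2 * (2 * of_int A * \<alpha> + of_int B)\<^sup>2" by (simp add: power_mult_distrib)
    also have "(2 * of_int A * \<alpha> + of_int B)\<^sup>2 = 4 * of_int A * (of_int A * \<alpha>\<^sup>2 + of_int B * \<alpha> + of_int C) + of_int D"
      unfolding D by (simp add: power2_eq_square algebra_simps)
    also have "\<dots> = of_int D" unfolding root by simp
    finally have "real_of_int (x\<^sup>2 - D * y\<^sup>2) = 0" by simp
    hence "x\<^sup>2 - D * y\<^sup>2 = 0" by linarith
    thus False using sol by auto
  qed
  then consider "l > 0" | "- l > 0" by linarith
  thus ?thesis
  proof cases
    case 1
    thus ?thesis using main[OF l_def 1 sol(1)] unfolding l_def[symmetric] by simp
  next
    case 2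
    have "- l = (of_int (- x) + of_int (- y) * (2 * of_int A * \<alpha> + of_int B)) / 2" by (simp add: l_def field_simps)
    thus ?thesis using main[of "- l" "- x" "- y"] 2 sol(1) unfolding l_def[symmetric] by simp
  qed
qed

text \<open>The quadratic relation that the matrix imposes on \<alpha> is proportional to the
  primitive polynomial, and primitivity makes the factor \<open>y\<close> an integer. Its
  discriminant is the squared trace minus 4 times the determinant, so the trace m + n' serves as
  \<open>x\<close>.\<close>

lemma lattice_unit_solution:
  assumes q: "primitive_quadratic_of \<alpha> q" and u: "lattice_unit \<alpha> l m n m' n'"
  shows "\<exists>x y. x\<^sup>2 - quadratic_discriminant q * y\<^sup>2 = 4 * (m * n' - m' * n)"
proof -
  define A B C where "A = coeff q 2" "B = coeff q 1" "C = coeff q 0"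
  note ABC = this
  have q': "degree q = 2" "Polynomial.content q = 1" using q by (auto simp: primitive_quadratic_of_def)
  have root: "of_int A * \<alpha>\<^sup>2 + of_int B * \<alpha> + of_int C = 0"
    using q poly_real_quadratic[OF q'(1), of \<alpha>] by (simp add: primitive_quadratic_of_def ABC)
  have A0: "A \<noteq> 0" using q'(1) leading_coeff_0_iff[of q] by (auto simp: ABC)
  have l: "l * \<alpha> = of_int m * \<alpha> + of_int n" "l = of_int m' * \<alpha> + of_int n'"
    using u by (auto simp: lattice_unit_def)
  have rel: "of_int m' * \<alpha>\<^sup>2 + of_int (n' - m) * \<alpha> - of_int n = 0"
    using l(1) unfolding l(2) by (simp add: power2_eq_square algebra_simps)
  have "of_int (A * (n' - m) - m' * B) * \<alpha> + of_int (- A * n - m' * C) =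
      of_int A * (of_int m' * \<alpha>\<^sup>2 + of_int (n' - m) * \<alpha> - of_int n) -
      of_int m' * (of_int A * \<alpha>\<^sup>2 + of_int B * \<alpha> + of_int C)"
    by (simp add: algebra_simps)
  hence "of_int (A * (n' - m) - m' * B) * \<alpha> + of_int (- A * n - m' * C) = 0" unfolding rel root by simp
  hence pr: "A * (n' - m) = m' * B" "- A * n = m' * C" using irrational_linear_form[OF irr] by fastforce+
  define r where "r = [:- n, n' - m, m':]"
  have eq: "smult A r = smult m' q"
  proof (rule poly_eqI)
    fix i :: nat
    consider "i = 0" | "i = 1" | "i = 2" | "i > 2" by linarith
    thus "coeff (smult A r) i = coeff (smult m' q) i"
      using pr q'(1) by cases (auto simp: r_def ABC coeff_eq_0 eval_nat_numeral)
  qed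
  have "\<bar>A\<bar> * Polynomial.content r = \<bar>m'\<bar>"
    using arg_cong[OF eq, of Polynomial.content] q'(2) by simp
  hence "A dvd m'" by (metis abs_dvd_iff dvd_abs_iff dvd_triv_left)
  then obtain y where y: "m' = A * y" by blast
  have "A * (n' - m) = A * (B * y)" "A * (- n) = A * (C * y)"
    using pr unfolding y by (simp_all add: ac_simps)
  hence "n' - m = B * y" "- n = C * y" using A0 by (simp_all only: mult_cancel_left) simp_all
  hence nm: "n' = m + B * y" "n = - (C * y)" by simp_all
  have "(m + n')\<^sup>2 - quadratic_discriminant q * y\<^sup>2 = 4 * (m * n' - m' * n)"
    unfolding quadratic_discriminant_def ABC[symmetric] y nm
    by (simp add: power2_eq_square algebra_simps)
  thus ?thesis by blast
qed

lemma quadratic_case: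
  assumes q: "primitive_quadratic_of \<alpha> q"
  shows "Symm (packing \<alpha>) \<cong> integer_group"
    "\<not> (\<exists>x y :: int. x\<^sup>2 - quadratic_discriminant q * y\<^sup>2 = - 4) \<Longrightarrow> Symm_plus (packing \<alpha>) = Symm (packing \<alpha>)"
    "\<exists>x y :: int. x\<^sup>2 - quadratic_discriminant q * y\<^sup>2 = - 4 \<Longrightarrow>
       subgroup H (Symm (packing \<alpha>)) \<and> card (rcosets\<^bsub>Symm (packing \<alpha>)\<^esub> H) = 2 \<longleftrightarrow>
       H = carrier (Symm_plus (packing \<alpha>))"
proof -
  let ?G = "Symm (packing \<alpha>)"
  interpret group ?G by (rule group_Symm)
  define A B C D where "A = coeff q 2" "B = coeff q 1" "C = coeff q 0" "D = quadratic_discriminant q"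
  note ABC = this
  have q': "degree q = 2" using q by (auto simp: primitive_quadratic_of_def)
  have root: "of_int A * \<alpha>\<^sup>2 + of_int B * \<alpha> + of_int C = 0"
    using q poly_real_quadratic[OF q', of \<alpha>] by (simp add: primitive_quadratic_of_def ABC)
  have A0: "A \<noteq> 0" using q' leading_coeff_0_iff[of q] by (auto simp: ABC)
  have D: "D = B\<^sup>2 - 4 * A * C" by (simp add: ABC quadratic_discriminant_def)
  define \<theta> where "\<theta> = 2 * of_int A * \<alpha> + of_int B"
  have "\<theta>\<^sup>2 = 4 * of_int A * (of_int A * \<alpha>\<^sup>2 + of_int B * \<alpha> + of_int C) + of_int D"
    unfolding D \<theta>_def by (simp add: power2_eq_square algebra_simps)
  hence \<theta>2: "\<theta>\<^sup>2 = of_int D" unfolding root by simp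
  have \<theta>irr: "\<theta> \<notin> \<rat>"
  proof
    assume "\<theta> \<in> \<rat>"
    hence "(\<theta> - of_int B) / (2 * of_int A) \<in> \<rat>" by simp
    moreover have "(\<theta> - of_int B) / (2 * of_int A) = \<alpha>" using A0 by (simp add: \<theta>_def)
    ultimately show False using irr by simp
  qed
  have "\<bar>\<theta>\<bar> \<notin> \<rat>" using \<theta>irr by (metis Rats_minus_iff abs_if)
  moreover have "\<theta> \<noteq> 0" using \<theta>irr by auto
  ultimately obtain x y :: int where xy: "x\<^sup>2 - D * y\<^sup>2 = 1" "y \<noteq> 0"
    using pell_solution[of "\<bar>\<theta>\<bar>" D] \<theta>2 by auto
  \<comment> \<open>Doubling brings Pell's equation to the right side 4 that
    \<open>quadratic_units\<close> expects; since y is nonzero, the resulting unit is not 1.\<close>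
  have "(2 * x)\<^sup>2 - D * (2 * y)\<^sup>2 = 4 * 1" using xy(1) by (simp add: power_mult_distrib)
  from quadratic_units[OF root D this] obtain m n m' n' where
    u: "lattice_unit \<alpha> \<bar>(of_int (2 * x) + of_int (2 * y) * \<theta>) / 2\<bar> m n m' n'" unfolding \<theta>_def by auto
  have "\<bar>(of_int (2 * x) + of_int (2 * y) * \<theta>) / 2\<bar> \<noteq> 1"
  proof
    assume "\<bar>(of_int (2 * x) + of_int (2 * y) * \<theta>) / 2\<bar> = 1"
    hence "of_int y * \<theta> + of_int (x - 1) = 0 \<or> of_int y * \<theta> + of_int (x + 1) = 0"
      by (auto simp: abs_if field_simps split: if_splits)
    thus False using irrational_linear_form(1)[OF \<theta>irr] xy(2) by blast
  qed
  then obtain g where g: "g \<in> carrier ?G" "\<And>x. x \<in> carrier ?G \<Longrightarrow> \<exists>k::int. x = g [^]\<^bsub>?G\<^esub> k"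
    "inj (\<lambda>k::int. g [^]\<^bsub>?G\<^esub> k)"
    using Symm_cyclic[OF u] by metis
  have "(\<lambda>k::int. g [^]\<^bsub>?G\<^esub> k) \<in> iso integer_group ?G"
  proof (rule isoI)
    show "(\<lambda>k::int. g [^]\<^bsub>?G\<^esub> k) \<in> hom integer_group ?G" by (rule hom_integer_group_pow[OF g(1)])
    show "bij_betw (\<lambda>k::int. g [^]\<^bsub>?G\<^esub> k) (carrier integer_group) (carrier ?G)"
      unfolding bij_betw_def using g by auto
  qed
  hence "integer_group \<cong> ?G" by (auto simp: is_iso_def)
  thus "?G \<cong> integer_group" by (rule group.iso_sym[OF group_integer_group])
  have det: "m * n' - m' * n = 1 \<or> m * n' - m' * n = -1" if "lattice_unit \<alpha> l m n m' n'" for l m n m' n'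
    using that by (simp add: lattice_unit_def power2_eq_1_iff)
  show "Symm_plus (packing \<alpha>) = ?G" if no: "\<not> (\<exists>x y :: int. x\<^sup>2 - quadratic_discriminant q * y\<^sup>2 = - 4)"
  proof -
    have "orientation_preserving_similarity \<Phi>" if "\<Phi> \<in> carrier ?G" for \<Phi>
    proof -
      obtain l m n m' n' where 1: "lattice_unit \<alpha> l m n m' n'" "\<Phi> = unit_sim \<alpha> l m n m' n'"
        using Symm_unit_sim[OF \<open>\<Phi> \<in> carrier ?G\<close>] by blast
      have "m * n' - m' * n \<noteq> -1"
      proof
        assume "m * n' - m' * n = -1"
        hence "\<exists>x y. x\<^sup>2 - quadratic_discriminant q * y\<^sup>2 = - 4" using lattice_unit_solution[OF q 1(1)] by simp
        thus False using no by blast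
      qed
      thus ?thesis using det[OF 1(1)] orientation_preserving_unit_sim[OF 1(1)] 1(2) by simp
    qed
    hence "{\<Phi> \<in> carrier ?G. orientation_preserving_similarity \<Phi>} = carrier ?G" by blast
    thus ?thesis unfolding Symm_plus_def by simp
  qed
  assume "\<exists>x y :: int. x\<^sup>2 - quadratic_discriminant q * y\<^sup>2 = - 4"
  then obtain x y :: int where "x\<^sup>2 - D * y\<^sup>2 = 4 * (-1)" unfolding ABC(4) by auto
  from quadratic_units[OF root D this] obtain l m n m' n' where
    r: "m * n' - m' * n = -1" "lattice_unit \<alpha> l m n m' n'" by auto
  let ?K = "carrier (Symm_plus (packing \<alpha>))"
  define \<rho> where "\<rho> = unit_sim \<alpha> l m n m' n'"
  have K: "subgroup ?K ?G" by (rule subgroup_Symm_plus)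
  have K_iff: "\<Phi> \<in> ?K \<longleftrightarrow> \<Phi> \<in> carrier ?G \<and> orientation_preserving_similarity \<Phi>" for \<Phi>
    by (simp add: Symm_plus_def)
  have \<rho>: "\<rho> \<in> carrier ?G" "\<rho> \<notin> ?K"
    using unit_sim_in_Symm[OF r(2)] orientation_preserving_unit_sim[OF r(2)] r(1)
    by (simp_all add: \<rho>_def K_iff)
  \<comment> \<open>Orientation-reversing symmetries have horizontal sign -1, and the two signs
    cancel in a composite; so the reversing elements form a single coset.\<close>
  have rr: "a \<circ> b \<in> ?K" if ab: "a \<in> carrier ?G" "a \<notin> ?K" "b \<in> carrier ?G" "b \<notin> ?K" for a b
  proof -
    have form: "\<exists>\<mu> t. \<mu> > 0 \<and> \<Phi> = axis_sim (-1) 1 \<mu> t 0" if p: "\<Phi> \<in> carrier ?G" "\<Phi> \<notin> ?K" for \<Phi>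
    proof -
      obtain l m n m' n' where 1: "lattice_unit \<alpha> l m n m' n'" "\<Phi> = unit_sim \<alpha> l m n m' n'"
        using Symm_unit_sim[OF p(1)] by blast
      have "m * n' - m' * n = -1"
        using det[OF 1(1)] orientation_preserving_unit_sim[OF 1(1)] p 1(2) by (auto simp: K_iff)
      hence "\<Phi> = axis_sim (-1) 1 (1 / l\<^sup>2) (2 * of_int n / (\<alpha>\<^sup>2 * l)) 0"
        unfolding 1(2) unit_sim_def by simp
      moreover have "1 / l\<^sup>2 > 0" using 1(1) by (simp add: lattice_unit_def)
      ultimately show ?thesis by blast
    qed
    obtain \<mu> t \<nu> s where f: "\<mu> > 0" "a = axis_sim (-1) 1 \<mu> t 0" "\<nu> > 0" "b = axis_sim (-1) 1 \<nu> s 0"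
      using form ab by metis
    have "orientation_preserving_similarity (a \<circ> b)"
      unfolding f(2,4) axis_sim_comp using f(1,3)
      by (subst orientation_preserving_axis_sim) (simp_all add: is_sign_def)
    moreover have "a \<circ> b \<in> carrier ?G" using m_closed[OF ab(1,3)] by (simp add: Symm_def)
    ultimately show ?thesis by (simp add: K_iff)
  qed
  have card_K: "card (rcosets\<^bsub>?G\<^esub> ?K) = 2"
  proof (rule card_rcosets_2I[OF K \<rho>])
    fix x assume x: "x \<in> carrier ?G" "x \<notin> ?K"
    have "inv\<^bsub>?G\<^esub> \<rho> \<notin> ?K" using \<rho> subgroup.m_inv_closed[OF K, of "inv\<^bsub>?G\<^esub> \<rho>"] by auto
    hence "x \<circ> inv\<^bsub>?G\<^esub> \<rho> \<in> ?K" using rr x \<rho>(1) by simp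
    thus "x \<otimes>\<^bsub>?G\<^esub> inv\<^bsub>?G\<^esub> \<rho> \<in> ?K" by (simp add: Symm_def)
  qed
  show "subgroup H ?G \<and> card (rcosets\<^bsub>?G\<^esub> H) = 2 \<longleftrightarrow> H = ?K"
  proof
    assume H: "subgroup H ?G \<and> card (rcosets\<^bsub>?G\<^esub> H) = 2"
    \<comment> \<open>Both subgroups consist of the even powers of the generator.\<close>
    show "H = ?K"
      by (rule trans[OF cyclic_index_2[OF g(1,2) conjunct1[OF H] conjunct2[OF H]]
          cyclic_index_2[OF g(1,2) K card_K, symmetric]])
  qed (use K card_K in simp)
qed

text \<open>A nonzero m' would make \<alpha> a root of an integral quadratic. So m' = 0, and
  irrationality reduces the matrix to a scalar n' with n'^4 = 1; positivity of the unit leaves n' =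
  1.\<close>

lemma generic_case:
  assumes "\<not> algebraic_of_degree 2 \<alpha>"
  shows "carrier (Symm (packing \<alpha>)) = {id}" "carrier (Symm_plus (packing \<alpha>)) = {id}"
proof -
  have "\<Phi> = id" if "\<Phi> \<in> carrier (Symm (packing \<alpha>))" for \<Phi>
  proof -
    obtain l m n m' n' where 1: "lattice_unit \<alpha> l m n m' n'" "\<Phi> = unit_sim \<alpha> l m n m' n'"
      using Symm_unit_sim[OF \<open>\<Phi> \<in> _\<close>] by blast
    have l: "l > 0" "l * \<alpha> = of_int m * \<alpha> + of_int n" "l = of_int m' * \<alpha> + of_int n'"
      using 1(1) by (auto simp: lattice_unit_def)
    have "of_int m' * \<alpha>\<^sup>2 + of_int (n' - m) * \<alpha> + of_int (- n) = 0"
      using l(2) unfolding l(3) by (simp add: power2_eq_square algebra_simps)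
    hence m': "m' = 0" using algebraic_of_degree_2I[OF irr] assms by blast
    have "of_int (n' - m) * \<alpha> + of_int (- n) = 0"
      using l(2) unfolding l(3) m' by (simp add: algebra_simps)
    hence n: "n' - m = 0" "- n = 0" using irrational_linear_form[OF irr] by blast+
    hence "(n' * n')\<^sup>2 = 1" using 1(1) m' by (simp add: lattice_unit_def)
    hence "n' * n' = 1 \<or> n' * n' = -1" by (simp only: power2_eq_1_iff)
    moreover have n0: "n' > 0" using l(1) unfolding l(3) m' by simp
    hence "n' * n' > 0" by simp
    ultimately have "n' * n' = 1" by linarith
    hence "n' = 1" using n0 by (simp add: zmult_eq_1_iff)
    hence "l = 1" using l(3) m' by simp
    thus ?thesis using unit_sim_one 1 by simp
  qed
  moreover have "id \<in> carrier (Symm (packing \<alpha>))"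
    using monoid.one_closed[OF group.is_monoid[OF group_Symm[of "packing \<alpha>"]]] by (simp add: Symm_def)
  ultimately show S: "carrier (Symm (packing \<alpha>)) = {id}" by blast
  have "\<one>\<^bsub>Symm (packing \<alpha>)\<^esub> \<in> carrier (Symm_plus (packing \<alpha>))"
    using subgroup_Symm_plus subgroup.one_closed by blast
  moreover have "carrier (Symm_plus (packing \<alpha>)) \<subseteq> carrier (Symm (packing \<alpha>))" by (auto simp: Symm_plus_def)
  ultimately show "carrier (Symm_plus (packing \<alpha>)) = {id}" unfolding S by auto
qed

end

theorem theorem1p2:
  fixes \<alpha> :: real
  assumes "\<alpha> > 0"
  shows
    "(\<alpha> \<in> \<rat> \<longrightarrow>
        strip_packing (packing \<alpha>) \<and>
        Symm (packing \<alpha>) \<cong> D_inf \<times>\<times> integer_mod_group 2 \<and>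
        subgroup (carrier (Symm_plus (packing \<alpha>))) (Symm (packing \<alpha>)) \<and>
        Symm_plus (packing \<alpha>) \<cong> D_inf) \<and>
     (algebraic_of_degree 2 \<alpha> \<longrightarrow>
        Symm (packing \<alpha>) \<cong> integer_group \<and>
        (\<forall>q D. primitive_quadratic_of \<alpha> q \<and> D = quadratic_discriminant q \<longrightarrow>
           (\<not> (\<exists>x y :: int. x\<^sup>2 - D * y\<^sup>2 = - 4) \<longrightarrow>
              Symm_plus (packing \<alpha>) = Symm (packing \<alpha>)) \<and>
           ((\<exists>x y :: int. x\<^sup>2 - D * y\<^sup>2 = - 4) \<longrightarrow>
              (\<forall>H. subgroup H (Symm (packing \<alpha>)) \<and>
                   card (rcosets\<^bsub>Symm (packing \<alpha>)\<^esub> H) = 2 \<longleftrightarrow>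
                   H = carrier (Symm_plus (packing \<alpha>)))))) \<and>
     (\<alpha> \<notin> \<rat> \<and> \<not> algebraic_of_degree 2 \<alpha> \<longrightarrow>
        carrier (Symm_plus (packing \<alpha>)) = {id} \<and> carrier (Symm (packing \<alpha>)) = {id})"
proof (intro conjI impI allI)
  assume "\<alpha> \<in> \<rat>"
  from rational_case[OF assms this]
  show "strip_packing (packing \<alpha>)" "Symm (packing \<alpha>) \<cong> D_inf \<times>\<times> integer_mod_group 2"
    "Symm_plus (packing \<alpha>) \<cong> D_inf" .
  show "subgroup (carrier (Symm_plus (packing \<alpha>))) (Symm (packing \<alpha>))" by (rule subgroup_Symm_plus)
next
  assume alg: "algebraic_of_degree 2 \<alpha>"
  note irr = algebraic_of_degree_2_irrational[OF alg]
  obtain q where "primitive_quadratic_of \<alpha> q" using primitive_quadratic_exists[OF alg] by blast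
  from quadratic_case(1)[OF assms irr this] show "Symm (packing \<alpha>) \<cong> integer_group" .
  fix q D assume q: "primitive_quadratic_of \<alpha> q \<and> D = quadratic_discriminant q"
  note qc = quadratic_case[OF assms irr conjunct1[OF q]]
  show "Symm_plus (packing \<alpha>) = Symm (packing \<alpha>)" if "\<not> (\<exists>x y :: int. x\<^sup>2 - D * y\<^sup>2 = - 4)"
    using qc(2) that q by blast
  show "subgroup H (Symm (packing \<alpha>)) \<and> card (rcosets\<^bsub>Symm (packing \<alpha>)\<^esub> H) = 2 \<longleftrightarrow>
      H = carrier (Symm_plus (packing \<alpha>))" if "\<exists>x y :: int. x\<^sup>2 - D * y\<^sup>2 = - 4" for H
    using qc(3)[of H] that unfolding conjunct2[OF q] .
next
  assume "\<alpha> \<notin> \<rat> \<and> \<not> algebraic_of_degree 2 \<alpha>"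
  thus "carrier (Symm_plus (packing \<alpha>)) = {id}" "carrier (Symm (packing \<alpha>)) = {id}"
    using generic_case[OF assms] by blast+
qed

end
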